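(* Let $d\ge1$, $p\ge2$, and let $\Lambda^{(i)}(\boldsymbol{\theta})$, $\boldsymbol{\theta}\in\mathbb{S}^d$, $i\in\mathbb{N}_0$, be a sequence of independent random fields satisfying the convergence hypotheses (C) of the context with this $p$ and some $b>1$, and let $\mu$ be the limiting measure, so that $\mu(B)\in L_p$. Suppose moreover that: (i) the fields $\Lambda^{(i)}$ are strongly isotropic and $E(\Lambda^{(i)}(\mathbb{0}_d))^q=E(\Lambda^{(j)}(\boldsymbol{\theta}))^q$ for all $\boldsymbol{\theta}\in\mathbb{S}^d$, $q\in[0,p]$, $i,j\in\mathbb{N}_0$; (ii) for every $q\in(0,1)$, with $\boldsymbol{q}=(q-1,1)$, there is a non-decreasing function $\rho(\cdot,\boldsymbol{q})$ on $[0,\infty)$ such that $$\rho\big(b^i d_{\mathbb{S}^d}(\boldsymbol{\theta}_1,\boldsymbol{\theta}_2),\boldsymbol{q}\big)\ge E\Big((\Lambda^{(i)}(\boldsymbol{\theta}_1))^{q-1}\Lambda^{(i)}(\boldsymbol{\theta}_2)\Big)\quad\text{for all } i\in\mathbb{N}_0,\ \boldsymbol{\theta}_1,\boldsymbol{\theta}_2\in\mathbb{S}^d,$$ and $$\sum_{i=0}^\infty\ln\left(\frac{\rho(b^{-i},\boldsymbol{q})}{E(\Lambda^{(i)}(\mathbb{0}_d))^q}\right)<\infty;$$ (iii) for every $q\in[1,p]$ there are a point $\widetilde{\boldsymbol{\theta}}\in\mathbb{S}^d$, an integer $k'\ge2$ and, with $\widetilde{\boldsymbol{p}}=(q/k',\dots,q/k')$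 ($k'$ entries), a positive non-increasing function $\upsilon(\cdot,\widetilde{\boldsymbol{p}})$ on $[0,\infty)$ such that $$\upsilon(b^ix,\widetilde{\boldsymbol{p}})\le\min_{\substack{\boldsymbol{\theta}_j\in B_x(\widetilde{\boldsymbol{\theta}})\\ j=1,\dots,k'}}E\Big(\prod_{j=1}^{k'}(\Lambda^{(i)}(\boldsymbol{\theta}_j))^{q/k'}\Big)\quad\text{for all } i\in\mathbb{N}_0,\ x\in[0,\pi],$$ and $$\sum_{i=0}^\infty\ln\left(\frac{E(\Lambda^{(i)}(\widetilde{\boldsymbol{\theta}}))^q}{\upsilon(b^{-i},\widetilde{\boldsymbol{p}})}\right)<\infty.$$ Then the Rényi function of the limiting measure $\mu$ is $$\tau_\mu(q)=q-1-\frac1d\log_bE\big(\Lambda^{(0)}(\mathbb{0}_d)\big)^q,\qquad q\in[0,p].$$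
   Context: All random objects live on a fixed probability space $(\Omega,\mathcal{F},P)$. $\mathbb{N}_0=\{0,1,\dots\}$. $\mathbb{S}^d$ is the unit sphere centred at the origin in $\mathbb{R}^{d+1}$, with Borel $\sigma$-algebra $\mathcal{B}(\mathbb{S}^d)$, surface (Lebesgue) measure $\sigma$, angular distance $d_{\mathbb{S}^d}$ and north pole $\mathbb{0}_d$; $B_u(\boldsymbol{\theta})=\{\boldsymbol{\theta}_1\in\mathbb{S}^d: d_{\mathbb{S}^d}(\boldsymbol{\theta}_1,\boldsymbol{\theta})\le u\}$, $u\in[0,\pi]$. Put $\Lambda_n(\boldsymbol{\theta})=\prod_{i=0}^n\Lambda^{(i)}(\boldsymbol{\theta})$ and $\mu_n(B)=\int_B\Lambda_n(\boldsymbol{\theta})\,\sigma(d\boldsymbol{\theta})$, $B\in\mathcal{B}(\mathbb{S}^d)$. $E(X)^q$ means $E[X^q]$ and $\mu^q(B)=(\mu(B))^q$. A random field on $\mathbb{S}^d$ is strongly isotropic if its finite-dimensional distributions are invariant under rotations of $\mathbb{S}^d$. Convergence hypotheses (C): each $\Lambda^{(i)}$ is $\mathcal{B}(\mathbb{S}^d)\times\mathcal{F}$-measurable, $P(\Lambda^{(i)}(\boldsymbol{\theta})\ge0\ \forall\boldsymbol{\theta})=1$, $E\Lambda^{(i)}(\boldsymbol{\theta})=1$, $E(\Lambda^{(i)}(\boldsymbol{\theta}))^2<\infty$ for all $\boldsymbol{\theta}$; and there are an integer $k\ge2$, a vector $\boldsymbol{p}=(p_1,\dots,p_k)$ with all $p_j\ge1$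 and $\sum_jp_j=p\ge2$, a constant $b>1$ and a non-increasing function $\rho(\cdot,\boldsymbol{p})$ on $[0,\infty)$ with $$\rho\Big(b^i\min_{m\ne h}d_{\mathbb{S}^d}(\boldsymbol{\theta}_m,\boldsymbol{\theta}_h),\boldsymbol{p}\Big)\ge E\Big(\prod_{j=1}^k(\Lambda^{(i)}(\boldsymbol{\theta}_j))^{p_j}\Big)\quad\text{for all } i\in\mathbb{N}_0,\ \boldsymbol{\theta}_1,\dots,\boldsymbol{\theta}_k\in\mathbb{S}^d,$$ $b>\rho(0,\boldsymbol{p})^{1/d}$ and $\sum_{i=0}^\infty\ln(\rho(b^i,\boldsymbol{p}))<\infty$. The same $b$ is used in (ii) and (iii). Under (C), for each Borel set $B$ under consideration, $\mu_n(B)\to\mu(B)$ as $n\to\infty$ with probability 1 and in $L_p$; $\mu$ is the limiting measure. Rényi function: for a random measure $\mu$ on $\mathbb{S}^d$, $$\tau_\mu(q)=\liminf_{l\to\infty}\frac{\log\Big(\sum_{\Delta_l^{(m)}\in\Delta_l}E\mu^q(\Delta_l^{(m)})\Big)}{\log|\Delta_l^{(0)}|},\qquad q\ge0,$$ where $\Delta_l=\{\Delta_l^{(m)}\}_m$ is the mesh formed by the $l$-level dyadic decomposition of $\mathbb{S}^d$: nested finite partitions of $\mathbb{S}^d$ into Borel cells such that, for constants $c,C>0$ independent of $l,m$, each cell contains a point $\boldsymbol{\theta}_l^{(m)}$ with $B_{c2^{-l}}(\boldsymbol{\theta}_l^{(m)})\subset\Delta_l^{(m)}\subset B_{C2^{-l}}(\boldsymbol{\theta}_l^{(m)})$;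 $|\cdot|$ denotes the Lebesgue measure $\sigma$. *)

theory Defs
  imports "HOL-Probability.Probability"
begin

section \<open>Geometry of the sphere\<close>

text \<open>The sphere \<open>S\<^sup>d\<close> is \<open>sphere 0 1\<close> in \<open>real ^ 'n\<close> with \<open>CARD('n) = d + 1\<close>.\<close>

abbreviation sphere_borel :: "('a::euclidean_space) measure" where
  "sphere_borel \<equiv> restrict_space borel (sphere 0 1)"

text \<open>Surface measure through the polar-coordinate formula
  \<open>\<sigma>(B) = (d + 1) \<cdot> Leb {r \<theta> | 0 < r \<le> 1, \<theta> \<in> B}\<close>, where \<open>d + 1\<close> is the dimension of the
  ambient space; see \<open>emeasure_surface_measure\<close>.\<close>

definition surface_measure :: "('a::euclidean_space) measure" where
  "surface_measure =
     scale_measure (of_nat DIM('a))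
       (distr (restrict_space lborel (cball 0 1 - {0})) sphere_borel (\<lambda>x. x /\<^sub>R norm x))"

lemma space_surface_measure [simp]: "space surface_measure = sphere 0 1"
  by (simp add: surface_measure_def space_scale_measure space_restrict_space)

lemma sets_surface_measure [simp, measurable_cong]: "sets surface_measure = sets sphere_borel"
  by (simp add: surface_measure_def)

lemma emeasure_surface_measure:
  fixes B :: "'a::euclidean_space set"
  assumes "B \<in> sets sphere_borel"
  shows "emeasure surface_measure B =
           of_nat DIM('a) * emeasure lborel {r *\<^sub>R \<theta> | r \<theta>. 0 < r \<and> r \<le> 1 \<and> \<theta> \<in> B}"
proof -
  let ?R = "restrict_space lborel (cball 0 1 - {0::'a})"
  have BS: "B \<subseteq> sphere 0 1"
    using sets.sets_into_space[OF assms] by (simp add: space_restrict_space)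
  have meas: "(\<lambda>x::'a. x /\<^sub>R norm x) \<in> measurable ?R sphere_borel"
    by (rule measurable_restrict_space2)
      (auto simp: space_restrict_space intro!: measurable_restrict_space1)
  have "(\<lambda>x. x /\<^sub>R norm x) -` B \<inter> space ?R = {r *\<^sub>R \<theta> | r \<theta>. 0 < r \<and> r \<le> 1 \<and> \<theta> \<in> B}"
  proof (intro set_eqI iffI)
    fix x assume "x \<in> (\<lambda>x. x /\<^sub>R norm x) -` B \<inter> space ?R"
    then have "x = norm x *\<^sub>R (x /\<^sub>R norm x)" "0 < norm x" "norm x \<le> 1" "x /\<^sub>R norm x \<in> B"
      by (auto simp: space_restrict_space)
    then show "x \<in> {r *\<^sub>R \<theta> | r \<theta>. 0 < r \<and> r \<le> 1 \<and> \<theta> \<in> B}"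
      by blast
  next
    fix x assume "x \<in> {r *\<^sub>R \<theta> | r \<theta>. 0 < r \<and> r \<le> 1 \<and> \<theta> \<in> B}"
    then obtain r \<theta> where *: "x = r *\<^sub>R \<theta>" "0 < r" "r \<le> 1" "\<theta> \<in> B" by blast
    with BS have "norm \<theta> = 1" by auto
    with * show "x \<in> (\<lambda>x. x /\<^sub>R norm x) -` B \<inter> space ?R"
      by (auto simp: space_restrict_space)
  qed
  moreover have "emeasure ?R {r *\<^sub>R \<theta> | r \<theta>. 0 < r \<and> r \<le> 1 \<and> \<theta> \<in> B} =
                 emeasure lborel {r *\<^sub>R \<theta> | r \<theta>. 0 < r \<and> r \<le> 1 \<and> \<theta> \<in> B}"
    using BS by (intro emeasure_restrict_space) auto
  ultimately show ?thesis
    using assms meas by (simp add: surface_measure_def emeasure_distr)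
qed

definition ang_dist :: "('a::real_inner) \<Rightarrow> 'a \<Rightarrow> real" where
  "ang_dist x y = arccos (x \<bullet> y)"

definition cap :: "real \<Rightarrow> ('a::euclidean_space) \<Rightarrow> 'a set" where
  "cap u \<theta> = {\<theta>' \<in> sphere 0 1. ang_dist \<theta>' \<theta> \<le> u}"

definition min_ang_dist :: "nat \<Rightarrow> (nat \<Rightarrow> 'a::real_inner) \<Rightarrow> real" where
  "min_ang_dist k \<theta> = Min {ang_dist (\<theta> m) (\<theta> h) | m h. m < k \<and> h < k \<and> m \<noteq> h}"

text \<open>Here \<open>N l\<close> is the number of cells of level \<open>l\<close>, and \<open>\<Delta> l m\<close> (\<open>m < N l\<close>) are these cells.\<close>

definition dyadic_mesh :: "(nat \<Rightarrow> nat) \<Rightarrow> (nat \<Rightarrow> nat \<Rightarrow> ('a::euclidean_space) set) \<Rightarrow> bool" where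
  "dyadic_mesh N \<Delta> \<longleftrightarrow>
     (\<forall>l. \<forall>m<N l. \<Delta> l m \<in> sets sphere_borel) \<and>
     (\<forall>l. disjoint_family_on (\<Delta> l) {..<N l} \<and> (\<Union>m<N l. \<Delta> l m) = sphere 0 1) \<and>
     (\<forall>l. \<forall>m<N (Suc l). \<exists>m'<N l. \<Delta> (Suc l) m \<subseteq> \<Delta> l m') \<and>
     (\<exists>c>0. \<exists>C>0. \<forall>l. \<forall>m<N l. \<exists>\<theta>\<in>\<Delta> l m.
        cap (c / 2 ^ l) \<theta> \<subseteq> \<Delta> l m \<and> \<Delta> l m \<subseteq> cap (C / 2 ^ l) \<theta>)"


section \<open>Powers, moments and logarithms\<close>

text \<open>Real powers on \<open>[0, \<infinity>]\<close> with the conventions \<open>x\<^sup>0 = 1\<close> (also for \<open>x = 0\<close>) and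
  \<open>0\<^sup>a = \<infinity>\<close> for \<open>a < 0\<close>; \<^const>\<open>powr\<close> would give \<open>0\<close> in both cases.\<close>

definition epow :: "ennreal \<Rightarrow> real \<Rightarrow> ennreal" where
  "epow x a =
     (if a = 0 then 1
      else if x = 0 then (if 0 < a then 0 else \<infinity>)
      else if x = \<infinity> then (if 0 < a then \<infinity> else 0)
      else ennreal (enn2real x powr a))"

text \<open>\<open>E X\<^sup>q\<close> in \<open>[0, \<infinity>]\<close>, for an almost surely nonnegative \<open>X\<close>.\<close>

definition moment :: "'w measure \<Rightarrow> ('w \<Rightarrow> real) \<Rightarrow> real \<Rightarrow> ennreal" where
  "moment M X q = (\<integral>\<^sup>+\<omega>. epow (ennreal (X \<omega>)) q \<partial>M)"

definition ennreal_ln :: "ennreal \<Rightarrow> ereal" where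
  "ennreal_ln x =
     (if x = 0 then -\<infinity> else if x = \<infinity> then \<infinity> else ereal (ln (enn2real x)))"


section \<open>Random fields on the sphere\<close>

text \<open>Rotations of the sphere are the maps given by \<open>SO(d + 1)\<close>.\<close>

definition strongly_isotropic :: "'w measure \<Rightarrow> (real ^ 'n \<Rightarrow> 'w \<Rightarrow> real) \<Rightarrow> bool" where
  "strongly_isotropic M X \<longleftrightarrow>
     (\<forall>Q :: real ^ 'n ^ 'n. rotation_matrix Q \<longrightarrow>
        (\<forall>k. \<forall>\<theta> :: nat \<Rightarrow> real ^ 'n. (\<forall>j<k. \<theta> j \<in> sphere 0 1) \<longrightarrow>
           distr M (PiM {..<k} (\<lambda>_. borel)) (\<lambda>\<omega>. \<lambda>j\<in>{..<k}. X (Q *v \<theta> j) \<omega>) =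
           distr M (PiM {..<k} (\<lambda>_. borel)) (\<lambda>\<omega>. \<lambda>j\<in>{..<k}. X (\<theta> j) \<omega>)))"

text \<open>A field is viewed as a random element of the product space of real functions on the sphere,
  so independence is that of the \<open>\<sigma>\<close>-algebras generated by the whole fields.\<close>

definition independent_fields ::
    "'w measure \<Rightarrow> (nat \<Rightarrow> 'a::euclidean_space \<Rightarrow> 'w \<Rightarrow> real) \<Rightarrow> bool" where
  "independent_fields M \<Lambda> \<longleftrightarrow>
     prob_space.indep_vars M (\<lambda>_. PiM (sphere 0 1) (\<lambda>_. borel))
       (\<lambda>i \<omega>. \<lambda>\<theta>\<in>sphere 0 1. \<Lambda> i \<theta> \<omega>) UNIV"

text \<open>The requirement \<open>\<rho> > 0\<close> only makes \<open>ln (\<rho> (b ^ i))\<close> meaningful for all \<open>i\<close>. The terms of that series are nonincreasing in \<open>i\<close> and, as \<open>\<rho> \<ge> 1\<close> follows from the other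
  clauses, nonnegative, so finiteness of the sum is summability.\<close>

definition convergence_hypotheses ::
    "nat \<Rightarrow> 'w measure \<Rightarrow> (nat \<Rightarrow> 'a::euclidean_space \<Rightarrow> 'w \<Rightarrow> real) \<Rightarrow> real \<Rightarrow> real \<Rightarrow> bool" where
  "convergence_hypotheses d M \<Lambda> p b \<longleftrightarrow>
     (\<forall>i. (\<lambda>(\<theta>, \<omega>). \<Lambda> i \<theta> \<omega>) \<in> borel_measurable (sphere_borel \<Otimes>\<^sub>M M)) \<and>
     (\<forall>i. AE \<omega> in M. \<forall>\<theta>\<in>sphere 0 1. 0 \<le> \<Lambda> i \<theta> \<omega>) \<and>
     (\<forall>i. \<forall>\<theta>\<in>sphere 0 1.
        integrable M (\<Lambda> i \<theta>) \<and> integral\<^sup>L M (\<Lambda> i \<theta>) = 1 \<and>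
        integrable M (\<lambda>\<omega>. (\<Lambda> i \<theta> \<omega>)\<^sup>2)) \<and>
     1 < b \<and> 2 \<le> p \<and>
     (\<exists>k\<ge>2. \<exists>ps :: nat \<Rightarrow> real. \<exists>\<rho> :: real \<Rightarrow> real.
        (\<forall>j<k. 1 \<le> ps j) \<and> (\<Sum>j<k. ps j) = p \<and>
        antimono_on {0..} \<rho> \<and> (\<forall>t\<ge>0. 0 < \<rho> t) \<and>
        (\<forall>i. \<forall>\<theta> :: nat \<Rightarrow> 'a. (\<forall>j<k. \<theta> j \<in> sphere 0 1) \<longrightarrow>
           (\<integral>\<^sup>+\<omega>. (\<Prod>j<k. epow (ennreal (\<Lambda> i (\<theta> j) \<omega>)) (ps j)) \<partial>M)
             \<le> ennreal (\<rho> (b ^ i * min_ang_dist k \<theta>))) \<and>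
        \<rho> 0 powr (1 / real d) < b \<and>
        summable (\<lambda>i. ln (\<rho> (b ^ i))))"


section \<open>Random measures\<close>

definition random_measure :: "'w measure \<Rightarrow> ('w \<Rightarrow> ('a::euclidean_space) measure) \<Rightarrow> bool" where
  "random_measure M \<mu> \<longleftrightarrow>
     (\<forall>\<omega>\<in>space M. sets (\<mu> \<omega>) = sets sphere_borel \<and> finite_measure (\<mu> \<omega>)) \<and>
     (\<forall>B\<in>sets sphere_borel. (\<lambda>\<omega>. emeasure (\<mu> \<omega>) B) \<in> borel_measurable M)"

definition product_measure ::
    "(nat \<Rightarrow> 'a::euclidean_space \<Rightarrow> 'w \<Rightarrow> real) \<Rightarrow> nat \<Rightarrow> 'w \<Rightarrow> 'a measure" where
  "product_measure \<Lambda> n \<omega> = density surface_measure (\<lambda>\<theta>. ennreal (\<Prod>i\<le>n. \<Lambda> i \<theta> \<omega>))"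

definition limiting_measure ::
    "'w measure \<Rightarrow> (nat \<Rightarrow> 'a::euclidean_space \<Rightarrow> 'w \<Rightarrow> real) \<Rightarrow> real \<Rightarrow>
     ('w \<Rightarrow> 'a measure) \<Rightarrow> bool" where
  "limiting_measure M \<Lambda> p \<mu> \<longleftrightarrow>
     random_measure M \<mu> \<and>
     (\<forall>B\<in>sets sphere_borel.
        (AE \<omega> in M. (\<lambda>n. emeasure (product_measure \<Lambda> n \<omega>) B) \<longlonglongrightarrow> emeasure (\<mu> \<omega>) B) \<and>
        (\<lambda>n. \<integral>\<^sup>+\<omega>. ennreal (\<bar>measure (product_measure \<Lambda> n \<omega>) B - measure (\<mu> \<omega>) B\<bar> powr p) \<partial>M)
          \<longlonglongrightarrow> 0)"

definition renyi_function ::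
    "'w measure \<Rightarrow> ('w \<Rightarrow> 'a::euclidean_space measure) \<Rightarrow>
     (nat \<Rightarrow> nat) \<Rightarrow> (nat \<Rightarrow> nat \<Rightarrow> 'a set) \<Rightarrow> real \<Rightarrow> ereal" where
  "renyi_function M \<mu> N \<Delta> q =
     liminf (\<lambda>l. ennreal_ln (\<Sum>m<N l. \<integral>\<^sup>+\<omega>. epow (emeasure (\<mu> \<omega>) (\<Delta> l m)) q \<partial>M)
                 / ereal (ln (measure surface_measure (\<Delta> l 0))))"

end

theory Submission
  imports Defs
begin

text \<open>
  Everything rests on one estimate (\<open>cell_moment_law\<close>): if a cell \<open>B\<close> has the size of a cap of radius
  \<open>b\<^sup>-\<^sup>n\<close>, then \<open>E \<mu>(B)\<^sup>q\<close> is of the order of \<open>(E \<Lambda>\<^sup>q)\<^sup>n \<sigma>(B)\<^sup>q\<close>. At level \<open>l\<close> of the mesh there are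
  about \<open>2\<^sup>l\<^sup>d\<close> cells of volume about \<open>2\<^sup>-\<^sup>l\<^sup>d\<close>, and \<open>b\<^sup>n \<approx> 2\<^sup>l\<close>; the sum of the moments thus grows like
  \<open>2 powr (l d (1 - q) + l log b (E \<Lambda>\<^sup>q))\<close>, and dividing its logarithm by \<open>- l d ln 2\<close> gives the formula
  (\<open>renyi_function_of_cell_moments\<close>).

  For the estimate, write the density of the first \<open>m \<ge> n\<close> factors as \<open>f g\<close>, where \<open>f\<close> is the product of
  the first \<open>n\<close> factors, which are correlated over the whole of \<open>B\<close>, and \<open>g\<close> is the product of the others.
  Let \<open>Z = \<integral>\<^sub>B f g\<close> and \<open>X = \<integral>\<^sub>B g\<close>, so that \<open>E X = \<sigma>(B)\<close>.

  \<^item> The convergence hypotheses give \<open>E X\<^sup>p \<le> c \<sigma>(B)\<^sup>p\<close> (\<open>tail_moment_le\<close>). Interpolation with \<open>E X\<close>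
    makes \<open>E X\<^sup>q\<close> comparable with \<open>\<sigma>(B)\<^sup>q\<close>.

  \<^item> Jensen's inequality for the weight \<open>g\<close> compares \<open>Z\<^sup>q\<close> with \<open>X\<^sup>q\<^sup>-\<^sup>1 \<integral>\<^sub>B f\<^sup>q g\<close>, from above for \<open>q \<ge> 1\<close>
    and from below for \<open>q < 1\<close>. As \<open>f\<close> is independent of \<open>g\<close>, the expectation of the latter is
    \<open>(E \<Lambda>\<^sup>q)\<^sup>n E X\<^sup>q\<close> (\<open>decoupling\<close>).

  \<^item> For the opposite bounds let \<open>y\<close> be the centre of \<open>B\<close>. Then \<open>E f(y)\<^sup>q\<^sup>-\<^sup>1 Z\<close> is the integral over \<open>B\<close> of
    the two-point correlations \<open>E f(y)\<^sup>q\<^sup>-\<^sup>1 f(\<theta>)\<close>, which the correlation hypotheses compare with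
    \<open>(E \<Lambda>\<^sup>q)\<^sup>n\<close> (\<open>correlation_product_le\<close> and \<open>correlation_product_ge\<close>). Hoelder's inequality turns this
    into a bound on \<open>E Z\<^sup>q\<close>.

  The constants do not depend on \<open>m\<close>, and convergence in \<open>L\<^sub>p\<close> carries the bounds over to \<open>\<mu>\<close>.
\<close>

section \<open>Powers and the Hoelder inequality on the extended half-line\<close>

lemma ennreal_zero_top_pos_cases:
  fixes x :: ennreal
  obtains "x = 0" | "x = \<infinity>" | r where "0 < r" "x = ennreal r"
  by (cases x; metis ennreal_0 infinity_ennreal_def order_le_less)

lemma epow_0_right [simp]: "epow x 0 = 1"
  by (simp add: epow_def)

lemma epow_0_left: "0 < a \<Longrightarrow> epow 0 a = 0"
  by (simp add: epow_def)

lemma epow_top_left: "0 < a \<Longrightarrow> epow top a = top"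
  by (simp add: epow_def)

lemma epow_top_left_neg: "a < 0 \<Longrightarrow> epow top a = 0"
  by (simp add: epow_def)

lemma epow_ennreal: "0 < r \<Longrightarrow> epow (ennreal r) a = ennreal (r powr a)"
  by (simp add: epow_def)

lemma epow_1_left [simp]: "epow 1 a = 1"
  using epow_ennreal[of 1 a] by simp

lemma epow_1_right [simp]: "epow x 1 = x"
  by (cases x rule: ennreal_zero_top_pos_cases) (auto simp: epow_0_left epow_top_left epow_ennreal)

lemma epow_mult:
  assumes "0 \<le> a"
  shows "epow (x * y) a = epow x a * epow y a"
proof (cases "a = 0")
  case False
  with assms have a: "0 < a" by simp
  show ?thesis
    by (cases x rule: ennreal_zero_top_pos_cases; cases y rule: ennreal_zero_top_pos_cases)
       (use a in \<open>auto simp: epow_0_left epow_top_left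
          epow_ennreal ennreal_mult[symmetric] ennreal_mult_top ennreal_top_mult powr_mult\<close>)
qed simp

lemma epow_add_pos:
  assumes "x \<noteq> 0" "x \<noteq> \<infinity>"
  shows "epow x (a + c) = epow x a * epow x c"
  using assms
  by (cases x rule: ennreal_zero_top_pos_cases) (auto simp: epow_ennreal ennreal_mult[symmetric] powr_add)

lemma epow_add:
  assumes "0 \<le> a" "0 \<le> c"
  shows "epow x (a + c) = epow x a * epow x c"
proof (cases "a = 0 \<or> c = 0")
  case False
  with assms have a: "0 < a" "0 < c" by auto
  then have "0 < a + c" by simp
  with a show ?thesis
    by (cases "x = 0 \<or> x = \<infinity>")
      (auto simp: epow_0_left epow_top_left ennreal_top_mult epow_add_pos)
qed auto

lemma epow_epow:
  assumes "0 \<le> a" "0 \<le> c"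
  shows "epow (epow x a) c = epow x (a * c)"
proof (cases "a = 0 \<or> c = 0")
  case False
  with assms have a: "0 < a" "0 < c" by auto
  then have "0 < a * c" by simp
  with a show ?thesis
    by (cases x rule: ennreal_zero_top_pos_cases)
      (auto simp: epow_0_left epow_top_left epow_ennreal powr_powr)
qed auto

lemma epow_eq_0_iff: "epow x a = 0 \<longleftrightarrow> (x = 0 \<and> 0 < a) \<or> (x = top \<and> a < 0)"
  by (cases x rule: ennreal_zero_top_pos_cases) (auto simp: epow_def)

lemma epow_eq_top_iff: "epow x a = top \<longleftrightarrow> (x = top \<and> 0 < a) \<or> (x = 0 \<and> a < 0)"
  by (cases x rule: ennreal_zero_top_pos_cases) (auto simp: epow_def)

lemma epow_mono:
  assumes "0 \<le> a" "x \<le> y"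
  shows "epow x a \<le> epow y a"
proof (cases "a = 0")
  case False
  with assms have a: "0 < a" by simp
  show ?thesis
    using assms(2)
    by (cases x rule: ennreal_zero_top_pos_cases; cases y rule: ennreal_zero_top_pos_cases)
       (use a in \<open>auto simp: epow_0_left epow_top_left top_unique
          epow_ennreal intro!: powr_mono2 ennreal_leI\<close>)
qed simp

lemma epow_prod:
  assumes "0 \<le> a"
  shows "epow (\<Prod>i\<in>I. f i) a = (\<Prod>i\<in>I. epow (f i) a)"
  by (induction I rule: infinite_finite_induct) (auto simp: epow_mult[OF assms])

lemma epow_sum_right:
  assumes "finite I" "\<And>i. i \<in> I \<Longrightarrow> 0 \<le> a i"
  shows "(\<Prod>i\<in>I. epow x (a i)) = epow x (\<Sum>i\<in>I. a i)"
  using assms by (induction I rule: finite_induct) (auto simp: epow_add sum_nonneg)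

lemma epow_2: "epow x 2 = x * x"
  using epow_add[of 1 1 x] by simp

lemma measurable_epow [measurable]: "(\<lambda>x. epow x a) \<in> borel_measurable borel"
  unfolding epow_def by measurable

lemma epow_cancel:
  assumes "x \<noteq> 0" "x \<noteq> \<infinity>"
  shows "epow x a * epow x (- a) = 1"
  using epow_add_pos[OF assms, of a "- a"] by simp

lemma weighted_am_gm:
  fixes u v a :: real
  assumes "0 \<le> u" "0 \<le> v" "0 < a" "a < 1"
  shows "u powr a * v powr (1 - a) \<le> a * u + (1 - a) * v"
  using Youngs_inequality_0[of a "1 - a" u v] assms by (cases "u = 0 \<or> v = 0") auto

text \<open>Normalise \<open>u\<close> and \<open>v\<close> to have integral one and integrate the weighted inequality between
  the geometric and the arithmetic mean.\<close>

lemma nn_integral_Holder: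
  assumes [measurable]: "u \<in> borel_measurable N" "v \<in> borel_measurable N"
    and a: "0 \<le> a" "a \<le> 1"
  shows "(\<integral>\<^sup>+x. epow (u x) a * epow (v x) (1 - a) \<partial>N)
           \<le> epow (\<integral>\<^sup>+x. u x \<partial>N) a * epow (\<integral>\<^sup>+x. v x \<partial>N) (1 - a)"
proof (cases "a = 0 \<or> a = 1")
  case False
  with a have a: "0 < a" "a < 1" by auto
  define U V where "U = (\<integral>\<^sup>+x. u x \<partial>N)" and "V = (\<integral>\<^sup>+x. v x \<partial>N)"
  show ?thesis
  proof (cases "U = 0 \<or> V = 0")
    case True
    then have "AE x in N. u x = 0 \<or> v x = 0"
      unfolding U_def V_def by (auto simp: nn_integral_0_iff_AE)
    then have "AE x in N. epow (u x) a * epow (v x) (1 - a) = 0"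
      by eventually_elim (use a in \<open>auto simp: epow_0_left\<close>)
    then have "(\<integral>\<^sup>+x. epow (u x) a * epow (v x) (1 - a) \<partial>N) = 0"
      by (subst nn_integral_0_iff_AE) auto
    then show ?thesis by simp
  next
    case nz: False
    show ?thesis
    proof (cases "U = \<infinity> \<or> V = \<infinity>")
      case True
      have "epow U a * epow V (1 - a) = \<infinity>"
        using True nz a by (auto simp: ennreal_mult_eq_top_iff epow_eq_0_iff epow_eq_top_iff)
      then show ?thesis unfolding U_def V_def by simp
    next
      case False
      obtain U' where U': "U = ennreal U'" "0 < U'"
        using nz False by (cases U rule: ennreal_zero_top_pos_cases) auto
      obtain V' where V': "V = ennreal V'" "0 < V'"
        using nz False by (cases V rule: ennreal_zero_top_pos_cases) auto
      define K where "K = U' powr a * V' powr (1 - a)"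
      have K: "0 \<le> K" by (simp add: K_def)
      have pw: "epow (u x) a * epow (v x) (1 - a)
          \<le> ennreal (K * a / U') * u x + ennreal (K * (1 - a) / V') * v x" (is "?l \<le> ?r") for x
      proof (cases "u x = \<infinity> \<or> v x = \<infinity>")
        case True
        have "?r = \<infinity>"
          using True a U' V' by (auto simp: ennreal_mult_eq_top_iff K_def)
        then show ?thesis by (simp only: infinity_ennreal_def top_greatest)
      next
        case False
        then obtain r s where rs: "u x = ennreal r" "v x = ennreal s" "0 \<le> r" "0 \<le> s"
          by (metis ennreal_cases infinity_ennreal_def)
        have "r powr a * s powr (1 - a) = K * ((r / U') powr a * (s / V') powr (1 - a))"
          using U' V' rs by (simp add: K_def powr_divide)
        also have "\<dots> \<le> K * (a * (r / U') + (1 - a) * (s / V'))"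
          using U' V' rs a by (intro mult_left_mono K weighted_am_gm) auto
        also have "\<dots> = (K * a / U') * r + (K * (1 - a) / V') * s"
          by (simp add: algebra_simps)
        finally have le: "r powr a * s powr (1 - a) \<le> (K * a / U') * r + (K * (1 - a) / V') * s" .
        have "?l = ennreal (r powr a * s powr (1 - a))"
        proof (cases "r = 0 \<or> s = 0")
          case True
          then show ?thesis using rs a by (auto simp: epow_0_left)
        next
          case False
          then show ?thesis using rs a by (simp add: epow_ennreal ennreal_mult)
        qed
        also have "\<dots> \<le> ?r"
          using le rs U' V' a K
          by (simp add: ennreal_mult[symmetric] ennreal_plus[symmetric] del: ennreal_plus)
        finally show ?thesis .
      qed
      have "(\<integral>\<^sup>+x. epow (u x) a * epow (v x) (1 - a) \<partial>N)
          \<le> (\<integral>\<^sup>+x. ennreal (K * a / U') * u x + ennreal (K * (1 - a) / V') * v x \<partial>N)"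
        by (intro nn_integral_mono pw)
      also have "\<dots> = ennreal (K * a / U') * U + ennreal (K * (1 - a) / V') * V"
        by (simp add: nn_integral_add nn_integral_cmult U_def V_def)
      also have "\<dots> = ennreal K"
      proof -
        have "K * a / U' * U' + K * (1 - a) / V' * V' = K"
          using U' V' by (simp add: field_simps)
        moreover have "ennreal (K * a / U') * ennreal U' + ennreal (K * (1 - a) / V') * ennreal V'
            = ennreal (K * a / U' * U' + K * (1 - a) / V' * V')"
          using U'(2) V'(2) a K
          by (subst ennreal_plus, simp_all del: times_divide_eq_left)
             (subst ennreal_mult[symmetric], auto)+
        ultimately show ?thesis by (simp add: U' V')
      qed
      also have "\<dots> = epow U a * epow V (1 - a)"
        using U' V' by (simp add: K_def epow_ennreal ennreal_mult)
      finally show ?thesis by (simp add: U_def V_def)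
    qed
  qed
qed auto

text \<open>Jensen's inequality for \<open>x\<^sup>q\<close> and the probability density proportional to \<open>g\<close>.\<close>

lemma nn_integral_epow_Jensen:
  assumes [measurable]: "f \<in> borel_measurable N" "g \<in> borel_measurable N" and q: "1 \<le> q"
    and fin: "\<And>x. x \<in> space N \<Longrightarrow> g x < \<infinity>"
  shows "epow (\<integral>\<^sup>+x. f x * g x \<partial>N) q
           \<le> epow (\<integral>\<^sup>+x. g x \<partial>N) (q - 1) * (\<integral>\<^sup>+x. epow (f x) q * g x \<partial>N)"
proof -
  have "f x * g x = epow (epow (f x) q * g x) (1 / q) * epow (g x) (1 - 1 / q)" for x
    using q epow_add[of "1 / q" "1 - 1 / q" "g x"]
    by (simp add: epow_mult epow_epow mult.assoc)
  then have "(\<integral>\<^sup>+x. f x * g x \<partial>N)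
      \<le> epow (\<integral>\<^sup>+x. epow (f x) q * g x \<partial>N) (1 / q) * epow (\<integral>\<^sup>+x. g x \<partial>N) (1 - 1 / q)"
    using q by (simp add: nn_integral_Holder)
  from epow_mono[OF _ this, of q] show ?thesis
    using q by (simp add: epow_mult epow_epow algebra_simps diff_divide_distrib)
qed

text \<open>For \<open>q < 1\<close> the inequality is reversed; the factor \<open>(\<integral> g)\<^sup>q\<^sup>-\<^sup>1\<close>
  is infinite when \<open>\<integral> g\<close> vanishes, but then both sides are zero.\<close>

lemma nn_integral_epow_reverse_Jensen:
  assumes [measurable]: "f \<in> borel_measurable N" "g \<in> borel_measurable N" and q: "0 < q" "q < 1"
  shows "epow (\<integral>\<^sup>+x. g x \<partial>N) (q - 1) * (\<integral>\<^sup>+x. epow (f x) q * g x \<partial>N)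
           \<le> epow (\<integral>\<^sup>+x. f x * g x \<partial>N) q"
proof -
  define X where "X = (\<integral>\<^sup>+x. g x \<partial>N)"
  consider "X = 0" | "X = \<infinity>" | "X \<noteq> 0" "X \<noteq> \<infinity>" by auto
  then show ?thesis
  proof cases
    case 1
    then have "AE x in N. g x = 0" by (simp add: X_def nn_integral_0_iff_AE)
    then have "AE x in N. epow (f x) q * g x = 0" by eventually_elim simp
    then have "(\<integral>\<^sup>+x. epow (f x) q * g x \<partial>N) = 0" by (subst nn_integral_0_iff_AE) auto
    then show ?thesis by simp
  next
    case 2
    then show ?thesis using q by (simp add: X_def epow_top_left_neg)
  next
    case 3
    have "epow (f x) q * g x = epow (f x * g x) q * epow (g x) (1 - q)" for x
      using q epow_add[of q "1 - q" "g x"] by (simp add: epow_mult mult.assoc)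
    then have "(\<integral>\<^sup>+x. epow (f x) q * g x \<partial>N) \<le> epow (\<integral>\<^sup>+x. f x * g x \<partial>N) q * epow X (1 - q)"
      using q unfolding X_def by (simp add: nn_integral_Holder)
    then have "epow X (q - 1) * (\<integral>\<^sup>+x. epow (f x) q * g x \<partial>N)
        \<le> epow X (q - 1) * (epow (\<integral>\<^sup>+x. f x * g x \<partial>N) q * epow X (1 - q))"
      by (intro mult_left_mono) auto
    also have "\<dots> = epow (\<integral>\<^sup>+x. f x * g x \<partial>N) q * (epow X (q - 1) * epow X (- (q - 1)))"
      by (simp add: ac_simps)
    also have "\<dots> = epow (\<integral>\<^sup>+x. f x * g x \<partial>N) q"
      by (simp only: epow_cancel[OF 3] mult_1_right)
    finally show ?thesis by (simp add: X_def)
  qed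
qed

lemma (in prob_space) nn_integral_epow_Lyapunov:
  assumes [measurable]: "X \<in> borel_measurable M" and q: "0 \<le> q" "q \<le> p" "0 < p"
  shows "(\<integral>\<^sup>+\<omega>. epow (X \<omega>) q \<partial>M) \<le> epow (\<integral>\<^sup>+\<omega>. epow (X \<omega>) p \<partial>M) (q / p)"
proof -
  have "(\<integral>\<^sup>+\<omega>. epow (X \<omega>) q \<partial>M) = (\<integral>\<^sup>+\<omega>. epow (epow (X \<omega>) p) (q / p) * epow 1 (1 - q / p) \<partial>M)"
    using q by (simp add: epow_epow)
  also have "\<dots> \<le> epow (\<integral>\<^sup>+\<omega>. epow (X \<omega>) p \<partial>M) (q / p) * epow (\<integral>\<^sup>+\<omega>. 1 \<partial>M) (1 - q / p)"
    using q by (intro nn_integral_Holder) auto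
  finally show ?thesis by (simp add: emeasure_space_1)
qed

section \<open>Caps of the sphere\<close>

lemma inner_sphere_bounds:
  fixes x y :: "'a::euclidean_space"
  assumes "norm x = 1" "norm y = 1"
  shows "- 1 \<le> x \<bullet> y" "x \<bullet> y \<le> 1"
  using Cauchy_Schwarz_ineq2[of x y] assms by auto

lemma ang_dist_commute: "ang_dist x y = ang_dist y x"
  by (simp add: ang_dist_def inner_commute)

lemma ang_dist_self:
  fixes x :: "'a::euclidean_space"
  shows "norm x = 1 \<Longrightarrow> ang_dist x x = 0"
  by (simp add: ang_dist_def norm_eq_1)

lemma ang_dist_nonneg:
  fixes x y :: "'a::euclidean_space"
  shows "norm x = 1 \<Longrightarrow> norm y = 1 \<Longrightarrow> 0 \<le> ang_dist x y"
  using inner_sphere_bounds[of x y] by (simp add: ang_dist_def arccos_lbound)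

lemma ang_dist_le_pi:
  fixes x y :: "'a::euclidean_space"
  shows "norm x = 1 \<Longrightarrow> norm y = 1 \<Longrightarrow> ang_dist x y \<le> pi"
  using inner_sphere_bounds[of x y] by (simp add: ang_dist_def arccos_ubound)

lemma norm_diff_sphere:
  fixes x y :: "'a::euclidean_space"
  assumes "norm x = 1" "norm y = 1"
  shows "(norm (x - y))\<^sup>2 = 2 - 2 * (x \<bullet> y)"
proof -
  have "x \<bullet> x = 1" "y \<bullet> y = 1"
    using assms by (simp_all add: norm_eq_1)
  then show ?thesis
    by (simp add: power2_norm_eq_inner inner_diff_left inner_diff_right inner_commute)
qed

lemma chord_le_ang_dist:
  fixes x y :: "'a::euclidean_space"
  assumes "norm x = 1" "norm y = 1"
  shows "norm (x - y) \<le> ang_dist x y"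
proof -
  define a where "a = ang_dist x y"
  have a: "0 \<le> a" "a \<le> pi" "cos a = x \<bullet> y"
    using assms inner_sphere_bounds[OF assms]
    by (auto simp: a_def ang_dist_nonneg ang_dist_le_pi) (simp add: ang_dist_def)
  have "(norm (x - y))\<^sup>2 = (2 * sin (a / 2))\<^sup>2"
    using norm_diff_sphere[OF assms] cos_double_sin[of "a / 2"] a by (simp add: power_mult_distrib)
  moreover have "0 \<le> sin (a / 2)" using a by (intro sin_ge_zero) auto
  ultimately have "norm (x - y) = 2 * sin (a / 2)"
    by (metis mult_nonneg_nonneg norm_ge_zero power2_eq_imp_eq zero_le_numeral)
  also have "\<dots> \<le> a" using sin_x_le_x[of "a / 2"] a by simp
  finally show ?thesis by (simp add: a_def)
qed

lemma half_le_sin: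
  fixes v :: real
  assumes "0 \<le> v" "v \<le> 1"
  shows "v / 2 \<le> sin v"
proof (cases "v = 0")
  case False
  then have v: "0 < v" using assms by simp
  have pi: "1 \<le> pi / 3" using pi_gt3 by simp
  obtain z where z: "0 < z" "z < v" "sin v - sin 0 = (v - 0) * cos z"
    using MVT2[of 0 v sin cos] v by (auto intro: DERIV_sin)
  have "cos (pi / 3) \<le> cos z"
    using z assms pi by (intro cos_monotone_0_pi_le) auto
  then have "1 / 2 \<le> cos z" by (simp add: cos_60)
  then have "v * (1 / 2) \<le> v * cos z" using v by (intro mult_left_mono) auto
  with z show ?thesis by simp
qed simp

lemma ang_dist_le_of_chord:
  fixes x y :: "'a::euclidean_space"
  assumes "norm x = 1" "norm y = 1" and u: "0 \<le> u" "u \<le> 1" and c: "norm (x - y) \<le> u / 2"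
  shows "ang_dist x y \<le> u"
proof -
  have "(norm (x - y))\<^sup>2 \<le> (u / 2)\<^sup>2"
    using c by (intro power_mono) auto
  also have "\<dots> = 4 * (u / 2 / 2)\<^sup>2" by (simp add: power2_eq_square)
  also have "\<dots> \<le> 4 * (sin (u / 2))\<^sup>2"
    using half_le_sin[of "u / 2"] u by (intro mult_left_mono power_mono) auto
  also have "\<dots> = 2 - 2 * cos u"
    using cos_double_sin[of "u / 2"] by simp
  finally have "cos u \<le> x \<bullet> y"
    using norm_diff_sphere[OF assms(1,2)] by simp
  then have "arccos (x \<bullet> y) \<le> arccos (cos u)"
    using inner_sphere_bounds[OF assms(1,2)] by (intro arccos_le_arccos) auto
  also have "\<dots> = u" using u pi_gt3 by (intro arccos_cos) auto
  finally show ?thesis by (simp add: ang_dist_def)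
qed

lemma borel_measurable_ang_dist [measurable (raw)]:
  fixes f g :: "'b \<Rightarrow> 'a::euclidean_space"
  assumes [measurable]: "f \<in> measurable N sphere_borel" "g \<in> measurable N sphere_borel"
  shows "(\<lambda>x. ang_dist (f x) (g x)) \<in> borel_measurable N"
proof -
  have meas: "f \<in> borel_measurable N" "g \<in> borel_measurable N"
    using assms by (auto simp: measurable_restrict_space2_iff)
  have "continuous_on UNIV (\<lambda>t::real. arccos (max (- 1) (min 1 t)))"
    by (intro continuous_intros) auto
  then have [measurable]: "(\<lambda>t::real. arccos (max (- 1) (min 1 t))) \<in> borel_measurable borel"
    by (rule borel_measurable_continuous_onI)
  have "(\<lambda>x. arccos (max (- 1) (min 1 (f x \<bullet> g x)))) \<in> borel_measurable N"
    using meas by measurable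
  also have "?this \<longleftrightarrow> ?thesis"
  proof (intro measurable_cong)
    fix x assume "x \<in> space N"
    then have "norm (f x) = 1" "norm (g x) = 1"
      using assms[THEN measurable_space] by (auto simp: space_restrict_space)
    from inner_sphere_bounds[OF this]
    show "arccos (max (- 1) (min 1 (f x \<bullet> g x))) = ang_dist (f x) (g x)"
      by (simp add: ang_dist_def)
  qed
  finally show ?thesis .
qed

lemma cap_subset_sphere: "cap u \<theta> \<subseteq> sphere 0 1"
  by (auto simp: cap_def)

lemma sets_cap:
  fixes \<theta> :: "'a::euclidean_space"
  assumes "\<theta> \<in> sphere 0 1"
  shows "cap u \<theta> \<in> sets sphere_borel"
proof -
  have [measurable]: "(\<lambda>_. \<theta>) \<in> measurable sphere_borel sphere_borel"
    using assms by (intro measurable_const) (simp add: space_restrict_space)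
  have "{x \<in> space sphere_borel. ang_dist x \<theta> \<le> u} \<in> sets sphere_borel"
    by measurable
  also have "{x \<in> space sphere_borel. ang_dist x \<theta> \<le> u} = cap u \<theta>"
    by (auto simp: cap_def space_restrict_space)
  finally show ?thesis .
qed

lemma sets_borel_cone:
  fixes B :: "'a::euclidean_space set"
  assumes "B \<in> sets sphere_borel"
  shows "{r *\<^sub>R \<theta> | r \<theta>. 0 < r \<and> r \<le> 1 \<and> \<theta> \<in> B} \<in> sets borel"
proof -
  obtain B' where B': "B' \<in> sets borel" "B = sphere 0 1 \<inter> B'"
    using assms by (auto simp: sets_restrict_space)
  note B'(1)[measurable]
  have "{x \<in> space borel. 0 < norm x \<and> norm x \<le> 1 \<and> x /\<^sub>R norm x \<in> B'} \<in> sets borel"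
    by measurable
  also have "{x \<in> space borel. 0 < norm x \<and> norm x \<le> 1 \<and> x /\<^sub>R norm x \<in> B'}
      = {r *\<^sub>R \<theta> | r \<theta>. 0 < r \<and> r \<le> 1 \<and> \<theta> \<in> B}"
  proof (intro set_eqI iffI)
    fix x assume "x \<in> {x \<in> space borel. 0 < norm x \<and> norm x \<le> 1 \<and> x /\<^sub>R norm x \<in> B'}"
    then have "x = norm x *\<^sub>R (x /\<^sub>R norm x)" "0 < norm x" "norm x \<le> 1" "x /\<^sub>R norm x \<in> B"
      by (auto simp: B'(2))
    then show "x \<in> {r *\<^sub>R \<theta> | r \<theta>. 0 < r \<and> r \<le> 1 \<and> \<theta> \<in> B}" by blast
  qed (auto simp: B'(2))
  finally show ?thesis .
qed

lemma emeasure_surface_measure_sphere_le: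
  "emeasure surface_measure (sphere 0 1 :: 'a::euclidean_space set)
     \<le> ennreal (real DIM('a) * unit_ball_vol DIM('a))"
proof -
  have "sphere 0 1 \<in> sets (sphere_borel :: 'a measure)"
    using sets.top[of "sphere_borel :: 'a measure"] by (simp add: space_restrict_space)
  then have "emeasure surface_measure (sphere 0 1 :: 'a set)
      \<le> of_nat DIM('a) * emeasure lborel (cball 0 1 :: 'a set)"
    by (simp only: emeasure_surface_measure) (intro mult_left_mono emeasure_mono, auto)
  also have "\<dots> = ennreal (real DIM('a) * unit_ball_vol DIM('a))"
    by (simp add: emeasure_cball ennreal_mult ennreal_of_nat_eq_real_of_nat)
  finally show ?thesis .
qed

lemma finite_measure_surface_measure: "finite_measure (surface_measure :: 'a::euclidean_space measure)"
proof
  show "emeasure (surface_measure :: 'a measure) (space surface_measure) \<noteq> \<infinity>"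
    using emeasure_surface_measure_sphere_le[where 'a='a] by (auto simp: top_unique)
qed

text \<open>The cone over a cap of angle \<open>u\<close> lies within distance \<open>u\<close> of a radius of the unit ball, and
  about \<open>1 / u\<close> balls of radius \<open>2 u\<close> cover such a neighbourhood.\<close>

lemma emeasure_cap_le:
  fixes \<theta> :: "'a::euclidean_space"
  assumes dim: "DIM('a) = Suc d" and \<theta>: "\<theta> \<in> sphere 0 1" and u: "0 < u"
  shows "emeasure surface_measure (cap u \<theta>)
           \<le> ennreal (3 * real DIM('a) * unit_ball_vol DIM('a) * 2 ^ Suc d * u ^ d)"
proof (cases "u \<le> 1")
  case False
  have "emeasure surface_measure (cap u \<theta>) \<le> emeasure surface_measure (sphere 0 1 :: 'a set)"
    using sets.top[of "surface_measure :: 'a measure"]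
    by (intro emeasure_mono) (auto simp: cap_subset_sphere)
  also have "\<dots> \<le> ennreal (real DIM('a) * unit_ball_vol DIM('a))"
    by (rule emeasure_surface_measure_sphere_le)
  also have "\<dots> \<le> ennreal (3 * real DIM('a) * unit_ball_vol DIM('a) * 2 ^ Suc d * u ^ d)"
  proof (rule ennreal_leI)
    have "1 \<le> 3 * (2::real) ^ Suc d * u ^ d"
      using False one_le_power[of "2::real" "Suc d"] one_le_power[of u d]
      by (intro mult_ge1_I) (auto simp del: power_Suc)
    then have "real DIM('a) * unit_ball_vol DIM('a) * 1
        \<le> real DIM('a) * unit_ball_vol DIM('a) * (3 * 2 ^ Suc d * u ^ d)"
      by (intro mult_left_mono) (auto intro: order.strict_implies_order)
    then show "real DIM('a) * unit_ball_vol DIM('a)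
        \<le> 3 * real DIM('a) * unit_ball_vol DIM('a) * 2 ^ Suc d * u ^ d"
      by (simp add: mult_ac)
  qed
  finally show ?thesis .
next
  case True
  define K where "K = nat \<lceil>1 / u\<rceil>"
  have K: "1 / u \<le> real K" "real K \<le> 1 / u + 1"
    unfolding K_def using u by (auto simp: le_of_int_ceiling)
  have K0: "0 < K"
  proof -
    have "0 < 1 / u" using u by simp
    then show ?thesis using K(1) by linarith
  qed
  let ?b = "\<lambda>i. cball ((real i / real K) *\<^sub>R \<theta>) (2 * u)"
  have nth: "norm \<theta> = 1" using \<theta> by simp
  let ?cone = "{r *\<^sub>R \<theta>' | r \<theta>'. 0 < r \<and> r \<le> 1 \<and> \<theta>' \<in> cap u \<theta>}"
  have sub: "?cone \<subseteq> (\<Union>i\<in>{..K}. ?b i)"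
  proof clarify
    fix r \<theta>' assume r: "(0::real) < r" "r \<le> 1" and "\<theta>' \<in> cap u \<theta>"
    then have t: "norm \<theta>' = 1" "ang_dist \<theta>' \<theta> \<le> u" by (auto simp: cap_def)
    have "norm (\<theta>' - \<theta>) \<le> u"
      using chord_le_ang_dist[OF t(1) nth] t(2) by simp
    then have 1: "norm (r *\<^sub>R \<theta>' - r *\<^sub>R \<theta>) \<le> u"
      using r mult_mono[of r 1 "norm (\<theta>' - \<theta>)" u] by (simp add: scaleR_diff_right[symmetric])
    define i where "i = nat \<lfloor>r * K\<rfloor>"
    have i: "real i \<le> r * K" "r * K < real i + 1"
      unfolding i_def using r by (auto simp: of_nat_nat)
    have "r * K \<le> 1 * real K" using r by (intro mult_right_mono) auto
    then have "i \<le> K" using i by linarith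
    have "\<bar>r - real i / real K\<bar> \<le> 1 / real K"
    proof -
      have "r - real i / real K = (r * K - real i) / real K" using K0 by (simp add: field_simps)
      moreover have "\<bar>(r * K - real i) / real K\<bar> \<le> 1 / real K"
        using i K0 by (simp add: divide_right_mono)
      ultimately show ?thesis by simp
    qed
    also have "\<dots> \<le> u" using K(1) K0 u by (simp add: field_simps)
    finally have 2: "norm (r *\<^sub>R \<theta> - (real i / real K) *\<^sub>R \<theta>) \<le> u"
      using nth by (simp add: scaleR_diff_left[symmetric] del: scaleR_diff_left)
    have "norm (r *\<^sub>R \<theta>' - (real i / real K) *\<^sub>R \<theta>) \<le> 2 * u"
      using norm_triangle_ineq[of "r *\<^sub>R \<theta>' - r *\<^sub>R \<theta>" "r *\<^sub>R \<theta> - (real i / real K) *\<^sub>R \<theta>"] 1 2 by simp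
    then have "r *\<^sub>R \<theta>' \<in> ?b i" by (simp add: dist_norm norm_minus_commute)
    with \<open>i \<le> K\<close> show "r *\<^sub>R \<theta>' \<in> (\<Union>i\<in>{..K}. ?b i)" by blast
  qed
  have "emeasure lborel ?cone
      \<le> emeasure lborel (\<Union>i\<in>{..K}. ?b i)"
    by (intro emeasure_mono sub) auto
  also have "\<dots> \<le> (\<Sum>i\<in>{..K}. emeasure lborel (?b i))"
    by (intro emeasure_subadditive_finite) auto
  also have "\<dots> = ennreal (real (Suc K) * (unit_ball_vol DIM('a) * (2 * u) ^ Suc d))"
    using u by (simp add: emeasure_cball dim ennreal_mult ennreal_of_nat_eq_real_of_nat del: power_Suc of_nat_Suc)
  also have "\<dots> \<le> ennreal (3 / u * (unit_ball_vol DIM('a) * (2 * u) ^ Suc d))"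
  proof (intro ennreal_leI mult_right_mono)
    show "real (Suc K) \<le> 3 / u"
      using K u True by (simp add: field_simps)
  qed (use u in auto)
  finally have "emeasure lborel ?cone
      \<le> ennreal (3 / u * (unit_ball_vol DIM('a) * (2 * u) ^ Suc d))" .
  then have "emeasure surface_measure (cap u \<theta>)
      \<le> of_nat DIM('a) * ennreal (3 / u * (unit_ball_vol DIM('a) * (2 * u) ^ Suc d))"
    by (simp only: emeasure_surface_measure[OF sets_cap[OF \<theta>]]) (intro mult_left_mono, auto)
  also have "\<dots> = ennreal (real DIM('a) * (3 / u * (unit_ball_vol DIM('a) * (2 * u) ^ Suc d)))"
    using u by (simp add: ennreal_mult ennreal_of_nat_eq_real_of_nat)
  also have "real DIM('a) * (3 / u * (unit_ball_vol DIM('a) * (2 * u) ^ Suc d))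
      = 3 * real DIM('a) * unit_ball_vol DIM('a) * 2 ^ Suc d * u ^ d"
    using u by (simp add: power_mult_distrib field_simps)
  finally show ?thesis .
qed

text \<open>Conversely the cone contains about \<open>1 / u\<close> disjoint balls of radius \<open>u / 8\<close> centred on the
  radius through \<open>\<theta>\<close>; they stay away from the apex, where the cone is thin.\<close>

lemma emeasure_cap_ge:
  fixes \<theta> :: "'a::euclidean_space"
  assumes dim: "DIM('a) = Suc d" and \<theta>: "\<theta> \<in> sphere 0 1" and u: "0 < u" "u \<le> 1"
  shows "ennreal (real DIM('a) * unit_ball_vol DIM('a) / (4 * 8 ^ Suc d) * u ^ d)
           \<le> emeasure surface_measure (cap u \<theta>)"
proof -
  define k where "k = Suc (nat \<lfloor>1 / (4 * u)\<rfloor>)"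
  have k: "1 / (4 * u) \<le> real k" "real (k - 1) \<le> 1 / (4 * u)"
    unfolding k_def using u by (auto simp: of_nat_nat) linarith
  define t where "t = (\<lambda>i::nat. 1 / 2 + u / 4 * real i)"
  let ?b = "\<lambda>i. ball (t i *\<^sub>R \<theta>) (u / 8)"
  have nth: "norm \<theta> = 1" using \<theta> by simp
  have t: "1 / 2 \<le> t i" "t i \<le> 7 / 8" if "i < k" for i
  proof -
    show "1 / 2 \<le> t i" using u by (simp add: t_def)
    have "real i \<le> 1 / (4 * u)" using k(2) that by linarith
    then have "u / 4 * real i \<le> u / 4 * (1 / (4 * u))"
      using u by (intro mult_left_mono) auto
    also have "\<dots> = 1 / 16" using u by simp
    finally show "t i \<le> 7 / 8" by (simp add: t_def)
  qed
  let ?cone = "{r *\<^sub>R \<theta>' | r \<theta>'. 0 < r \<and> r \<le> 1 \<and> \<theta>' \<in> cap u \<theta>}"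
  have sub: "(\<Union>i<k. ?b i) \<subseteq> ?cone"
  proof clarify
    fix i x assume i: "i < k" and "x \<in> ?b i"
    then have x: "norm (x - t i *\<^sub>R \<theta>) < u / 8" by (simp add: dist_norm norm_minus_commute)
    have nt: "norm (t i *\<^sub>R \<theta>) = t i" using t[OF i] nth by simp
    have d: "\<bar>norm x - t i\<bar> < u / 8"
      using norm_triangle_ineq3[of x "t i *\<^sub>R \<theta>"] x nt by simp
    have nx: "0 < norm x" "norm x \<le> 1" using d t[OF i] u by linarith+
    define y where "y = x /\<^sub>R norm x"
    have y1: "norm y = 1" using nx by (simp add: y_def)
    have "t i * norm (y - \<theta>) = norm ((t i *\<^sub>R y - x) + (x - t i *\<^sub>R \<theta>))"
      using t[OF i] by (simp add: scaleR_diff_right[symmetric])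
    also have "\<dots> \<le> norm (t i *\<^sub>R y - x) + norm (x - t i *\<^sub>R \<theta>)"
      by (rule norm_triangle_ineq)
    also have "t i *\<^sub>R y - x = (t i - norm x) *\<^sub>R y"
      using nx by (simp only: scaleR_diff_left) (simp add: y_def)
    also have "norm \<dots> + norm (x - t i *\<^sub>R \<theta>) \<le> u / 4"
      using d x y1 abs_minus_commute[of "norm x" "t i"] by simp
    finally have "t i * norm (y - \<theta>) \<le> u / 4" .
    moreover have "1 / 2 * norm (y - \<theta>) \<le> t i * norm (y - \<theta>)"
      using t[OF i] by (intro mult_right_mono) auto
    ultimately have "norm (y - \<theta>) \<le> u / 2" by simp
    then have "y \<in> cap u \<theta>"
      using ang_dist_le_of_chord[OF y1 nth] u y1 by (simp add: cap_def)
    moreover have "x = norm x *\<^sub>R y" using nx by (simp add: y_def)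
    ultimately show "\<exists>r \<theta>'. x = r *\<^sub>R \<theta>' \<and> 0 < r \<and> r \<le> 1 \<and> \<theta>' \<in> cap u \<theta>"
      using nx by blast
  qed
  have disj: "disjoint_family_on ?b {..<k}"
    unfolding disjoint_family_on_def
  proof (intro ballI impI)
    fix i j :: nat assume "i \<noteq> j"
    then have "1 \<le> \<bar>real i - real j\<bar>" by linarith
    then have "u / 4 * 1 \<le> u / 4 * \<bar>real i - real j\<bar>"
      using u by (intro mult_left_mono) auto
    also have "\<dots> = \<bar>t i - t j\<bar>"
    proof -
      have "t i - t j = u / 4 * (real i - real j)" by (simp add: t_def algebra_simps)
      then show ?thesis using u by (simp only: abs_mult)
    qed
    also have "\<dots> = dist (t i *\<^sub>R \<theta>) (t j *\<^sub>R \<theta>)"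
      using nth by (simp add: dist_norm scaleR_diff_left[symmetric])
    finally have far: "u / 4 \<le> dist (t i *\<^sub>R \<theta>) (t j *\<^sub>R \<theta>)" by simp
    show "?b i \<inter> ?b j = {}"
    proof (rule ccontr)
      assume "?b i \<inter> ?b j \<noteq> {}"
      then obtain x where "dist (t i *\<^sub>R \<theta>) x < u / 8" "dist (t j *\<^sub>R \<theta>) x < u / 8" by auto
      then have "dist (t i *\<^sub>R \<theta>) (t j *\<^sub>R \<theta>) < u / 8 + u / 8"
        using dist_triangle2[of "t i *\<^sub>R \<theta>" "t j *\<^sub>R \<theta>" x] by linarith
      with far show False by simp
    qed
  qed
  have "real DIM('a) * unit_ball_vol DIM('a) / (4 * 8 ^ Suc d) * u ^ d
      = real DIM('a) * (1 / (4 * u) * (unit_ball_vol DIM('a) * (u / 8) ^ Suc d))"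
    using u by (simp add: power_divide field_simps)
  also have "\<dots> \<le> real DIM('a) * (real k * (unit_ball_vol DIM('a) * (u / 8) ^ Suc d))"
    using k(1) u by (intro mult_left_mono mult_right_mono) auto
  finally have "ennreal (real DIM('a) * unit_ball_vol DIM('a) / (4 * 8 ^ Suc d) * u ^ d)
      \<le> ennreal (real DIM('a) * (real k * (unit_ball_vol DIM('a) * (u / 8) ^ Suc d)))"
    by (rule ennreal_leI)
  also have "\<dots> = of_nat DIM('a) * ennreal (real k * (unit_ball_vol DIM('a) * (u / 8) ^ Suc d))"
    by (simp only: ennreal_mult' of_nat_0_le_iff ennreal_of_nat_eq_real_of_nat)
  also have "ennreal (real k * (unit_ball_vol DIM('a) * (u / 8) ^ Suc d))
      = (\<Sum>i<k. emeasure lborel (?b i))"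
    using u by (simp add: emeasure_ball dim ennreal_mult ennreal_of_nat_eq_real_of_nat del: power_Suc)
  also have "\<dots> = emeasure lborel (\<Union>i<k. ?b i)"
    by (intro sum_emeasure disj) auto
  also have "\<dots> \<le> emeasure lborel ?cone"
    using sets_borel_cone[OF sets_cap[OF \<theta>]] by (intro emeasure_mono sub) simp
  finally show ?thesis
    by (simp add: emeasure_surface_measure[OF sets_cap[OF \<theta>]] mult_left_mono)
qed

section \<open>Independence and conditioning\<close>

text \<open>Stated for functions that are measurable with respect to the generated algebras, rather than
  for functions of \<open>U\<close> and of \<open>V\<close>, because conditional expectations come in this form.\<close>

lemma (in prob_space) indep_var_nn_integral_mult:
  assumes indep: "indep_var S U T V"
    and h: "h \<in> borel_measurable (vimage_algebra (space M) U S)"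
    and k: "k \<in> borel_measurable (vimage_algebra (space M) V T)"
  shows "(\<integral>\<^sup>+\<omega>. h \<omega> * k \<omega> \<partial>M) = (\<integral>\<^sup>+\<omega>. h \<omega> \<partial>M) * (\<integral>\<^sup>+\<omega>. k \<omega> \<partial>M)"
proof -
  have UV: "U \<in> measurable M S" "V \<in> measurable M T"
    using indep by (auto simp: indep_var_eq)
  have fs: "U \<in> space M \<rightarrow> space S" "V \<in> space M \<rightarrow> space T"
    using UV by (auto dest: measurable_space)
  have mU: "measurable (vimage_algebra (space M) U S) N \<subseteq> measurable M N" for N :: "ennreal measure"
    using UV(1) by (intro measurable_mono) (auto simp: sets_vimage_algebra2[OF fs(1)])
  have mV: "measurable (vimage_algebra (space M) V T) N \<subseteq> measurable M N" for N :: "ennreal measure"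
    using UV(2) by (intro measurable_mono) (auto simp: sets_vimage_algebra2[OF fs(2)])
  have hM: "h \<in> borel_measurable M" and kM: "k \<in> borel_measurable M"
    using h k mU mV by auto
  let ?A = "sigma_sets (space M) {U -` A \<inter> space M |A. A \<in> sets S}"
  let ?B = "sigma_sets (space M) {V -` A \<inter> space M |A. A \<in> sets T}"
  have "sigma_sets (space M) {h -` A \<inter> space M |A. A \<in> sets borel} \<subseteq> ?A"
    using measurable_sets[OF h] by (intro sigma_sets_subseteq) (auto simp: sets_vimage_algebra2[OF fs(1)])
  moreover have "sigma_sets (space M) {k -` A \<inter> space M |A. A \<in> sets borel} \<subseteq> ?B"
    using measurable_sets[OF k] by (intro sigma_sets_subseteq) (auto simp: sets_vimage_algebra2[OF fs(2)])
  moreover have "indep_set ?A ?B"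
    using indep by (auto simp: indep_var_eq)
  ultimately have "indep_set (sigma_sets (space M) {h -` A \<inter> space M |A. A \<in> sets borel})
      (sigma_sets (space M) {k -` A \<inter> space M |A. A \<in> sets borel})"
    unfolding indep_sets2_eq by blast
  then have "indep_var borel h borel k"
    using hM kM by (auto simp: indep_var_eq)
  moreover have "case_bool borel borel = (\<lambda>_. borel :: ennreal measure)"
    by (auto split: bool.split)
  ultimately have "indep_vars (\<lambda>_. borel) (case_bool h k) (UNIV :: bool set)"
    by (simp add: indep_var_def)
  from indep_vars_nn_integral[OF _ this] show ?thesis
    by (simp add: UNIV_bool mult.commute)
qed

text \<open>A section-wise \<open>G\<close>-measurable field need not be jointly measurable with respect to \<open>G\<close>, so it is not
  obvious that its integral \<open>X\<close> is \<open>G\<close>-measurable. It is, up to a null set: the conditional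
  expectation \<open>V\<close> of \<open>X\<close> satisfies \<open>E X\<^sup>2 = E X V = E V\<^sup>2\<close>, where the first equation holds section by
  section, hence \<open>E (X - V)\<^sup>2 = 0\<close>.\<close>

lemma (in prob_space) AE_nn_integral_eq_nn_cond_exp:
  fixes g :: "'b \<Rightarrow> 'a \<Rightarrow> ennreal"
  assumes G: "subalgebra M G" and \<nu>: "finite_measure \<nu>"
    and [measurable]: "case_prod g \<in> borel_measurable (\<nu> \<Otimes>\<^sub>M M)"
    and sec: "\<And>\<theta>. \<theta> \<in> space \<nu> \<Longrightarrow> g \<theta> \<in> borel_measurable G"
    and X: "X = (\<lambda>\<omega>. \<integral>\<^sup>+\<theta>. g \<theta> \<omega> \<partial>\<nu>)"
    and fin: "(\<integral>\<^sup>+\<omega>. X \<omega> * X \<omega> \<partial>M) < \<infinity>"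
  shows "AE \<omega> in M. X \<omega> = nn_cond_exp M G X \<omega>"
proof -
  interpret \<nu>: finite_measure \<nu> by fact
  interpret G: finite_measure_subalgebra M G by unfold_locales fact
  interpret pair_sigma_finite \<nu> M ..
  define V where "V = nn_cond_exp M G X"
  have [measurable]: "X \<in> borel_measurable M"
    unfolding X by measurable
  have VG: "V \<in> borel_measurable G" unfolding V_def by simp
  then have [measurable]: "V \<in> borel_measurable M"
    by (rule measurable_from_subalg[OF G])
  have swap: "(\<integral>\<^sup>+\<omega>. X \<omega> * Y \<omega> \<partial>M) = (\<integral>\<^sup>+\<theta>. \<integral>\<^sup>+\<omega>. g \<theta> \<omega> * Y \<omega> \<partial>M \<partial>\<nu>)"
    if [measurable]: "Y \<in> borel_measurable M" for Y
  proof -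
    have "(\<integral>\<^sup>+\<omega>. X \<omega> * Y \<omega> \<partial>M) = (\<integral>\<^sup>+\<omega>. \<integral>\<^sup>+\<theta>. g \<theta> \<omega> * Y \<omega> \<partial>\<nu> \<partial>M)"
      unfolding X by (intro nn_integral_cong) (simp add: nn_integral_multc)
    also have "\<dots> = (\<integral>\<^sup>+\<theta>. \<integral>\<^sup>+\<omega>. g \<theta> \<omega> * Y \<omega> \<partial>M \<partial>\<nu>)"
      by (rule Fubini') measurable
    finally show ?thesis .
  qed
  define e where "e = (\<integral>\<^sup>+\<omega>. X \<omega> * X \<omega> \<partial>M)"
  have "(\<integral>\<^sup>+\<omega>. X \<omega> * V \<omega> \<partial>M) = e"
    unfolding swap[OF \<open>V \<in> borel_measurable M\<close>] e_def swap[OF \<open>X \<in> borel_measurable M\<close>]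
    by (rule nn_integral_cong) (simp add: V_def G.nn_cond_exp_intg sec)
  moreover have "(\<integral>\<^sup>+\<omega>. V \<omega> * V \<omega> \<partial>M) = (\<integral>\<^sup>+\<omega>. V \<omega> * X \<omega> \<partial>M)"
    using G.nn_cond_exp_intg[OF VG, of X] by (simp add: V_def)
  ultimately have XV: "(\<integral>\<^sup>+\<omega>. X \<omega> * V \<omega> \<partial>M) = e" and VV: "(\<integral>\<^sup>+\<omega>. V \<omega> * V \<omega> \<partial>M) = e"
    by (simp_all add: mult.commute)
  define D where "D \<omega> = (X \<omega> - V \<omega>) + (V \<omega> - X \<omega>)" for \<omega>
  have [measurable]: "D \<in> borel_measurable M" unfolding D_def by measurable
  have e: "e < \<infinity>" using fin by (simp add: e_def)
  have "(\<integral>\<^sup>+\<omega>. X \<omega> * X \<omega> \<partial>M) \<noteq> \<infinity>" "(\<integral>\<^sup>+\<omega>. V \<omega> * V \<omega> \<partial>M) \<noteq> \<infinity>"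
    using e unfolding VV e_def[symmetric] by auto
  then have "AE \<omega> in M. X \<omega> * X \<omega> \<noteq> \<infinity>" "AE \<omega> in M. V \<omega> * V \<omega> \<noteq> \<infinity>"
    by - (rule nn_integral_PInf_AE; measurable)+
  then have AEf: "AE \<omega> in M. X \<omega> < \<infinity> \<and> V \<omega> < \<infinity>"
    by eventually_elim (auto simp: ennreal_mult_eq_top_iff less_top[symmetric])
  then have "AE \<omega> in M. X \<omega> * X \<omega> + V \<omega> * V \<omega> = 2 * (X \<omega> * V \<omega>) + D \<omega> * D \<omega>"
  proof eventually_elim
    case (elim \<omega>)
    then obtain x v where xv: "X \<omega> = ennreal x" "V \<omega> = ennreal v" "0 \<le> x" "0 \<le> v"
      by (metis ennreal_cases infinity_ennreal_def less_irrefl)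
    have D: "D \<omega> = ennreal \<bar>x - v\<bar>"
      using xv by (cases "x \<le> v") (auto simp: D_def ennreal_minus ennreal_neg)
    have "ennreal x * ennreal x + ennreal v * ennreal v
        = 2 * (ennreal x * ennreal v) + ennreal \<bar>x - v\<bar> * ennreal \<bar>x - v\<bar>"
    proof -
      have "x * x + v * v = 2 * (x * v) + \<bar>x - v\<bar> * \<bar>x - v\<bar>"
        by (simp only: abs_mult_self_eq) (simp add: algebra_simps)
      then have "ennreal (x * x + v * v) = ennreal (2 * (x * v) + \<bar>x - v\<bar> * \<bar>x - v\<bar>)"
        by (rule arg_cong)
      also have "\<dots> = ennreal (2 * (x * v)) + ennreal (\<bar>x - v\<bar> * \<bar>x - v\<bar>)"
        using xv(3,4) by (intro ennreal_plus) auto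
      also have "ennreal (\<bar>x - v\<bar> * \<bar>x - v\<bar>) = ennreal \<bar>x - v\<bar> * ennreal \<bar>x - v\<bar>"
        by (rule ennreal_mult) auto
      also have "ennreal (2 * (x * v)) = 2 * (ennreal x * ennreal v)"
        using xv(3,4) by (simp add: ennreal_mult)
      finally show ?thesis
        using xv(3,4) by (simp add: ennreal_mult del: abs_mult_self_eq)
    qed
    then show ?case
      by (simp only: xv(1,2) D)
  qed
  then have "(\<integral>\<^sup>+\<omega>. X \<omega> * X \<omega> + V \<omega> * V \<omega> \<partial>M) = (\<integral>\<^sup>+\<omega>. 2 * (X \<omega> * V \<omega>) + D \<omega> * D \<omega> \<partial>M)"
    by (rule nn_integral_cong_AE)
  also have "(\<integral>\<^sup>+\<omega>. X \<omega> * X \<omega> + V \<omega> * V \<omega> \<partial>M) = e + e"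
    by (subst nn_integral_add) (simp_all add: VV e_def)
  also have "(\<integral>\<^sup>+\<omega>. 2 * (X \<omega> * V \<omega>) + D \<omega> * D \<omega> \<partial>M) = e + e + (\<integral>\<^sup>+\<omega>. D \<omega> * D \<omega> \<partial>M)"
    by (subst nn_integral_add, simp, simp, subst nn_integral_cmult) (simp_all add: XV mult_2[of e])
  finally have "e + e + 0 = e + e + (\<integral>\<^sup>+\<omega>. D \<omega> * D \<omega> \<partial>M)"
    by simp
  then have "(\<integral>\<^sup>+\<omega>. D \<omega> * D \<omega> \<partial>M) = 0"
    using e by (simp only: ennreal_add_left_cancel) auto
  then have "AE \<omega> in M. D \<omega> * D \<omega> = 0"
    by (simp add: nn_integral_0_iff_AE)
  with AEf show ?thesis
  proof eventually_elim
    case (elim \<omega>)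
    then have "X \<omega> \<le> V \<omega>" "V \<omega> \<le> X \<omega>"
      by (auto simp: D_def ennreal_minus_eq_0)
    then show ?case by (simp add: V_def)
  qed
qed


section \<open>Products of independent fields\<close>

locale random_cascade = prob_space M for M :: "'w measure" +
  fixes \<Lambda> :: "nat \<Rightarrow> 'a::euclidean_space \<Rightarrow> 'w \<Rightarrow> real"
  assumes independent: "independent_fields M \<Lambda>"
    and joint: "\<And>i. (\<lambda>(\<theta>, \<omega>). \<Lambda> i \<theta> \<omega>) \<in> borel_measurable (sphere_borel \<Otimes>\<^sub>M M)"
begin

abbreviation expect :: "('w \<Rightarrow> ennreal) \<Rightarrow> ennreal"  (binder "\<E>" 10) where
  "expect f \<equiv> integral\<^sup>N M f"

abbreviation field :: "nat \<Rightarrow> 'w \<Rightarrow> 'a \<Rightarrow> real" where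
  "field i \<omega> \<equiv> (\<lambda>\<theta>\<in>sphere 0 1. \<Lambda> i \<theta> \<omega>)"

abbreviation field_algebra :: "('a \<Rightarrow> real) measure" where
  "field_algebra \<equiv> PiM (sphere 0 1) (\<lambda>_. borel)"

text \<open>Values in \<open>[0, \<infinity>]\<close> spare all integrability conditions; for almost surely nonnegative fields the
  truncation of negative values concerns a null set only.\<close>

definition cascade :: "nat set \<Rightarrow> 'a \<Rightarrow> 'w \<Rightarrow> ennreal" where
  "cascade I \<theta> \<omega> = (\<Prod>i\<in>I. ennreal (\<Lambda> i \<theta> \<omega>))"

lemma measurable_\<Lambda> [measurable (raw)]:
  assumes "f \<in> measurable N sphere_borel" "g \<in> measurable N M"
  shows "(\<lambda>x. \<Lambda> i (f x) (g x)) \<in> borel_measurable N"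
  using measurable_compose[OF measurable_Pair[OF assms] joint[of i]] by simp

lemma measurable_\<Lambda>_section [measurable]:
  assumes "\<theta> \<in> sphere 0 1"
  shows "\<Lambda> i \<theta> \<in> borel_measurable M"
  using assms by (intro measurable_\<Lambda>) (auto intro!: measurable_const simp: space_restrict_space)

lemma measurable_cascade [measurable (raw)]:
  assumes [measurable]: "f \<in> measurable N sphere_borel" "g \<in> measurable N M"
  shows "(\<lambda>x. cascade I (f x) (g x)) \<in> borel_measurable N"
  unfolding cascade_def by measurable

lemma measurable_cascade_section [measurable]:
  assumes [measurable (raw)]: "\<theta> \<in> sphere 0 1"
  shows "cascade I \<theta> \<in> borel_measurable M"
  unfolding cascade_def by measurable

lemma cascade_Un:
  "finite I \<Longrightarrow> finite J \<Longrightarrow> I \<inter> J = {} \<Longrightarrow> cascade (I \<union> J) \<theta> \<omega> = cascade I \<theta> \<omega> * cascade J \<theta> \<omega>"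
  by (simp add: cascade_def prod.union_disjoint)

lemma cascade_less_top: "cascade I \<theta> \<omega> < \<infinity>"
  by (induction I rule: infinite_finite_induct) (auto simp: cascade_def ennreal_mult_less_top)

lemma nn_integral_prod_fields:
  assumes "finite I" and F: "\<And>i. i \<in> I \<Longrightarrow> F i \<in> borel_measurable field_algebra"
  shows "(\<E> \<omega>. (\<Prod>i\<in>I. F i (field i \<omega>))) = (\<Prod>i\<in>I. (\<E> \<omega>. F i (field i \<omega>)))"
proof -
  have "indep_vars (\<lambda>_. field_algebra) field I"
    using independent unfolding independent_fields_def by (rule indep_vars_subset) simp
  then have "indep_vars (\<lambda>_. borel) (\<lambda>i \<omega>. F i (field i \<omega>)) I"
    by (rule indep_vars_compose2) (rule F)
  from indep_vars_nn_integral[OF assms(1) this] show ?thesis by simp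
qed

lemma moment_cascade:
  assumes "finite I" "\<theta> \<in> sphere 0 1" "0 \<le> q"
  shows "(\<E> \<omega>. epow (cascade I \<theta> \<omega>) q) = (\<Prod>i\<in>I. moment M (\<Lambda> i \<theta>) q)"
proof -
  have "(\<E> \<omega>. (\<Prod>i\<in>I. (\<lambda>x. epow (ennreal (x \<theta>)) q) (field i \<omega>)))
      = (\<Prod>i\<in>I. (\<E> \<omega>. (\<lambda>x. epow (ennreal (x \<theta>)) q) (field i \<omega>)))"
    using assms(2) by (intro nn_integral_prod_fields assms(1)) simp
  then show ?thesis
    using assms by (simp add: cascade_def epow_prod moment_def)
qed

lemma nn_integral_swap:
  assumes \<nu>: "finite_measure \<nu>" and [measurable_cong]: "sets \<nu> = sets sphere_borel"
    and [measurable]: "case_prod f \<in> borel_measurable (\<nu> \<Otimes>\<^sub>M M)"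
  shows "(\<E> \<omega>. \<integral>\<^sup>+\<theta>. f \<theta> \<omega> \<partial>\<nu>) = (\<integral>\<^sup>+\<theta>. (\<E> \<omega>. f \<theta> \<omega>) \<partial>\<nu>)"
proof -
  interpret \<nu>: finite_measure \<nu> by fact
  interpret pair_sigma_finite \<nu> M ..
  show ?thesis by (rule Fubini') measurable
qed

text \<open>The mass \<open>X\<close> involves uncountably many values of the fields with indices in \<open>J\<close>, but up to a null
  set it is measurable with respect to these fields, so it is independent of the fields with indices in \<open>I\<close>.\<close>

lemma decoupling:
  assumes I: "finite I" "finite J" "I \<inter> J = {}"
    and \<nu>: "finite_measure \<nu>" and sets[measurable_cong]: "sets \<nu> = sets sphere_borel"
    and X: "X = (\<lambda>\<omega>. \<integral>\<^sup>+\<theta>. cascade J \<theta> \<omega> \<partial>\<nu>)"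
    and fin: "(\<E> \<omega>. X \<omega> * X \<omega>) < \<infinity>"
    and q: "0 \<le> q" and m: "\<And>i \<theta>. i \<in> I \<Longrightarrow> \<theta> \<in> sphere 0 1 \<Longrightarrow> moment M (\<Lambda> i \<theta>) q = m"
    and \<phi>[measurable]: "\<phi> \<in> borel_measurable borel"
  shows "(\<E> \<omega>. \<phi> (X \<omega>) * (\<integral>\<^sup>+\<theta>. epow (cascade I \<theta> \<omega>) q * cascade J \<theta> \<omega> \<partial>\<nu>))
           = m ^ card I * (\<E> \<omega>. \<phi> (X \<omega>) * X \<omega>)"
proof -
  have sp: "space \<nu> = sphere 0 1"
    using sets_eq_imp_space_eq[OF sets] by (simp add: space_restrict_space)
  interpret \<nu>: finite_measure \<nu> by fact
  interpret pair_sigma_finite \<nu> M ..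
  have [measurable]: "X \<in> borel_measurable M"
    unfolding X by measurable
  let ?P = "\<lambda>K. PiM K (\<lambda>_::nat. field_algebra)"
  let ?Y = "\<lambda>K \<omega>. \<lambda>i\<in>K. field i \<omega>"
  let ?G = "\<lambda>K. vimage_algebra (space M) (?Y K) (?P K)"
  have indep: "indep_var (?P I) (?Y I) (?P J) (?Y J)"
    using independent I(3) unfolding independent_fields_def
    by (intro indep_var_restrict[where I=UNIV]) auto
  then have Y: "?Y I \<in> measurable M (?P I)" "?Y J \<in> measurable M (?P J)"
    by (auto simp: indep_var_eq)
  have casc: "cascade K \<theta> \<in> borel_measurable (?G K)"
    if K: "?Y K \<in> measurable M (?P K)" and \<theta>: "\<theta> \<in> sphere 0 1" for K \<theta>
  proof -
    have "?Y K \<in> measurable (?G K) (?P K)"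
      by (intro measurable_vimage_algebra1 Pi_I measurable_space[OF K])
    moreover have "(\<lambda>x. \<Prod>i\<in>K. ennreal (x i \<theta>)) \<in> borel_measurable (?P K)"
    proof (rule borel_measurable_prod_ennreal)
      fix i assume "i \<in> K"
      then have "(\<lambda>x. x i) \<in> measurable (?P K) field_algebra"
        by (rule measurable_component_singleton)
      moreover have "(\<lambda>y. y \<theta>) \<in> borel_measurable field_algebra"
        using \<theta> by (rule measurable_component_singleton)
      ultimately have "(\<lambda>x. x i \<theta>) \<in> borel_measurable (?P K)"
        by (rule measurable_compose)
      then show "(\<lambda>x. ennreal (x i \<theta>)) \<in> borel_measurable (?P K)"
        by (rule measurable_compose) simp
    qed
    ultimately have "(\<lambda>\<omega>. \<Prod>i\<in>K. ennreal (?Y K \<omega> i \<theta>)) \<in> borel_measurable (?G K)"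
      by (rule measurable_compose)
    then show ?thesis using \<theta> by (simp add: cascade_def[abs_def] cong: prod.cong)
  qed
  have G: "subalgebra M (?G J)"
    using Y(2) by (simp add: subalgebra_def measurable_iff_sets)
  define V where "V = nn_cond_exp M (?G J) X"
  have VG[measurable]: "V \<in> borel_measurable (?G J)"
    by (simp add: V_def)
  have XV: "AE \<omega> in M. X \<omega> = V \<omega>"
    unfolding V_def
    by (rule AE_nn_integral_eq_nn_cond_exp[OF G \<nu> _ _ X fin]) (auto simp: sp intro!: casc Y)
  have point: "(\<E> \<omega>. epow (cascade I \<theta> \<omega>) q * (\<phi> (X \<omega>) * cascade J \<theta> \<omega>))
      = m ^ card I * (\<E> \<omega>. \<phi> (X \<omega>) * cascade J \<theta> \<omega>)" if \<theta>: "\<theta> \<in> sphere 0 1" for \<theta>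
  proof -
    have "(\<E> \<omega>. epow (cascade I \<theta> \<omega>) q * (\<phi> (X \<omega>) * cascade J \<theta> \<omega>))
        = (\<E> \<omega>. epow (cascade I \<theta> \<omega>) q * (\<phi> (V \<omega>) * cascade J \<theta> \<omega>))"
      using XV by (intro nn_integral_cong_AE) auto
    also have "\<dots> = (\<E> \<omega>. epow (cascade I \<theta> \<omega>) q) * (\<E> \<omega>. \<phi> (V \<omega>) * cascade J \<theta> \<omega>)"
    proof (rule indep_var_nn_integral_mult[OF indep])
      note casc[OF Y(1) \<theta>, measurable] casc[OF Y(2) \<theta>, measurable]
      show "(\<lambda>\<omega>. epow (cascade I \<theta> \<omega>) q) \<in> borel_measurable (?G I)" by measurable
      show "(\<lambda>\<omega>. \<phi> (V \<omega>) * cascade J \<theta> \<omega>) \<in> borel_measurable (?G J)" by measurable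
    qed
    also have "(\<E> \<omega>. \<phi> (V \<omega>) * cascade J \<theta> \<omega>) = (\<E> \<omega>. \<phi> (X \<omega>) * cascade J \<theta> \<omega>)"
      using XV by (intro nn_integral_cong_AE) auto
    also have "(\<E> \<omega>. epow (cascade I \<theta> \<omega>) q) = m ^ card I"
      using moment_cascade[OF I(1) \<theta> q] m \<theta> by (simp cong: prod.cong)
    finally show ?thesis .
  qed
  have "(\<E> \<omega>. \<phi> (X \<omega>) * (\<integral>\<^sup>+\<theta>. epow (cascade I \<theta> \<omega>) q * cascade J \<theta> \<omega> \<partial>\<nu>))
      = (\<E> \<omega>. \<integral>\<^sup>+\<theta>. epow (cascade I \<theta> \<omega>) q * (\<phi> (X \<omega>) * cascade J \<theta> \<omega>) \<partial>\<nu>)"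
    by (intro nn_integral_cong) (simp add: nn_integral_cmult[symmetric] mult_ac)
  also have "\<dots> = (\<integral>\<^sup>+\<theta>. (\<E> \<omega>. epow (cascade I \<theta> \<omega>) q * (\<phi> (X \<omega>) * cascade J \<theta> \<omega>)) \<partial>\<nu>)"
    by (rule nn_integral_swap[OF \<nu> sets]) measurable
  also have "\<dots> = (\<integral>\<^sup>+\<theta>. m ^ card I * (\<E> \<omega>. \<phi> (X \<omega>) * cascade J \<theta> \<omega>) \<partial>\<nu>)"
    by (intro nn_integral_cong point) (simp add: sp)
  also have "\<dots> = m ^ card I * (\<integral>\<^sup>+\<theta>. (\<E> \<omega>. \<phi> (X \<omega>) * cascade J \<theta> \<omega>) \<partial>\<nu>)"
    by (intro nn_integral_cmult) measurable
  also have "(\<integral>\<^sup>+\<theta>. (\<E> \<omega>. \<phi> (X \<omega>) * cascade J \<theta> \<omega>) \<partial>\<nu>)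
      = (\<E> \<omega>. \<integral>\<^sup>+\<theta>. \<phi> (X \<omega>) * cascade J \<theta> \<omega> \<partial>\<nu>)"
    by (rule nn_integral_swap[OF \<nu> sets, symmetric]) measurable
  also have "\<dots> = (\<E> \<omega>. \<phi> (X \<omega>) * X \<omega>)"
    unfolding X by (intro nn_integral_cong) (simp add: nn_integral_cmult)
  finally show ?thesis .
qed

end

section \<open>Moments of the tail of the cascade\<close>

lemma epow_real_of_nat: "epow x (real n) = x ^ n"
proof (induction n)
  case (Suc n)
  then show ?case
    using epow_add[of "real n" 1 x] by (simp add: mult.commute add.commute)
qed simp

lemma emeasure_space_PiM_power:
  assumes "finite_measure \<nu>" "finite A"
  shows "emeasure (PiM A (\<lambda>_. \<nu>)) (space (PiM A (\<lambda>_. \<nu>))) = emeasure \<nu> (space \<nu>) ^ card A"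
proof -
  interpret \<nu>: finite_measure \<nu> by fact
  interpret product_sigma_finite "\<lambda>_. \<nu>" ..
  show ?thesis
    unfolding space_PiM using assms(2) by (subst emeasure_PiM) simp_all
qed

lemma le_suminf_ennreal: "f s \<le> (\<Sum>s. f s)" for f :: "nat \<Rightarrow> ennreal"
  using sum_le_suminf[of f "{s}"] by simp

text \<open>The logarithms decrease to zero.\<close>

lemma summable_decseq_ln_imp_ge_1:
  fixes r :: "nat \<Rightarrow> real"
  assumes "decseq r" "\<And>i. 0 < r i" "summable (\<lambda>i. ln (r i))"
  shows "1 \<le> r i"
proof -
  have "decseq (\<lambda>i. ln (r i))"
    using assms(1,2) by (auto simp: decseq_def)
  then have "0 \<le> ln (r i)"
    using summable_LIMSEQ_zero[OF assms(3)] by (rule decseq_ge)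
  then show ?thesis using assms(2)[of i] by simp
qed

lemma prod_le_exp_suminf_ln:
  fixes f :: "nat \<Rightarrow> real"
  assumes "\<And>i. 1 \<le> f i" "summable (\<lambda>i. ln (f i))" "finite A"
  shows "(\<Prod>i\<in>A. f i) \<le> exp (\<Sum>i. ln (f i))"
proof -
  have pos: "0 < f i" for i using assms(1)[of i] by simp
  have "(\<Prod>i\<in>A. f i) = exp (\<Sum>i\<in>A. ln (f i))"
    using assms(3) pos by (simp add: exp_sum)
  also have "\<dots> \<le> exp (\<Sum>i. ln (f i))"
    using assms by (auto intro!: sum_le_suminf)
  finally show ?thesis .
qed

lemma min_ang_dist_attained:
  assumes "2 \<le> k"
  obtains m h where "m < k" "h < k" "m \<noteq> h" "min_ang_dist k \<theta> = ang_dist (\<theta> m) (\<theta> h)"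
proof -
  let ?A = "{ang_dist (\<theta> m) (\<theta> h) | m h. m < k \<and> h < k \<and> m \<noteq> h}"
  have "?A \<subseteq> (\<lambda>(m, h). ang_dist (\<theta> m) (\<theta> h)) ` ({..<k} \<times> {..<k})" by auto
  then have "finite ?A" by (rule finite_subset) auto
  moreover have "ang_dist (\<theta> 0) (\<theta> 1) \<in> ?A"
    using assms by (intro CollectI exI[of _ 0] exI[of _ 1]) auto
  ultimately have "min_ang_dist k \<theta> \<in> ?A"
    unfolding min_ang_dist_def by (intro Min_in) auto
  then show thesis using that by auto
qed

lemma min_ang_dist_nonneg:
  fixes \<theta> :: "nat \<Rightarrow> 'a::euclidean_space"
  assumes "2 \<le> k" "\<And>j. j < k \<Longrightarrow> \<theta> j \<in> sphere 0 1"
  shows "0 \<le> min_ang_dist k \<theta>"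
  using min_ang_dist_attained[OF assms(1), of \<theta>] assms(2) by (metis ang_dist_nonneg mem_sphere_0)

locale convergent_cascade = random_cascade M \<Lambda>
  for M :: "'w measure" and \<Lambda> :: "nat \<Rightarrow> 'a::euclidean_space \<Rightarrow> 'w \<Rightarrow> real" +
  fixes d :: nat and p b :: real and k :: nat and ps :: "nat \<Rightarrow> real" and \<rho> :: "real \<Rightarrow> real"
  assumes b: "1 < b" and k: "2 \<le> k" and ps: "\<And>j. j < k \<Longrightarrow> 1 \<le> ps j" "(\<Sum>j<k. ps j) = p"
    and \<rho>_mono: "antimono_on {0..} \<rho>" and \<rho>_pos: "\<And>t. 0 \<le> t \<Longrightarrow> 0 < \<rho> t"
    and k_point: "\<And>i \<theta>. (\<And>j. j < k \<Longrightarrow> \<theta> j \<in> sphere 0 1) \<Longrightarrow>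
           (\<E> \<omega>. (\<Prod>j<k. epow (ennreal (\<Lambda> i (\<theta> j) \<omega>)) (ps j)))
             \<le> ennreal (\<rho> (b ^ i * min_ang_dist k \<theta>))"
    and \<rho>_0: "\<rho> 0 < b ^ d"
    and \<rho>_sum: "summable (\<lambda>i. ln (\<rho> (b ^ i)))"
begin

lemma \<rho>_le: "0 \<le> s \<Longrightarrow> s \<le> t \<Longrightarrow> \<rho> t \<le> \<rho> s"
  using \<rho>_mono by (auto simp: monotone_on_def)

lemma \<rho>_ge_1: "1 \<le> \<rho> (b ^ i)"
proof (rule summable_decseq_ln_imp_ge_1[OF _ _ \<rho>_sum])
  show "decseq (\<lambda>i. \<rho> (b ^ i))"
    using b by (auto simp: decseq_def intro!: \<rho>_le power_increasing)
  show "0 < \<rho> (b ^ i)" for i using b by (intro \<rho>_pos) auto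
qed

lemma \<rho>_0_ge_1: "1 \<le> \<rho> 0"
  using \<rho>_ge_1[of 0] \<rho>_le[of 0 1] by simp

definition R :: real where "R = exp (\<Sum>i. ln (\<rho> (b ^ i)))"

lemma R_ge_1: "1 \<le> R"
  unfolding R_def using \<rho>_ge_1 by (auto intro!: suminf_nonneg \<rho>_sum)

lemma prod_\<rho>_le_R: "finite A \<Longrightarrow> (\<Prod>i\<in>A. \<rho> (b ^ i)) \<le> R"
  unfolding R_def by (intro prod_le_exp_suminf_ln \<rho>_ge_1 \<rho>_sum)

text \<open>Once \<open>b\<^sup>i y\<close> exceeds \<open>1\<close> the factors are dominated by the convergent product \<open>R\<close>; each of
  the earlier ones costs a factor \<open>\<rho> 0\<close>.\<close>

lemma prod_\<rho>_le:
  assumes y: "0 \<le> y" and s: "1 \<le> b ^ (n + s) * y"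
  shows "(\<Prod>i\<in>{n..<m}. \<rho> (b ^ i * y)) \<le> \<rho> 0 ^ s * R"
proof -
  let ?A = "{n..<m} \<inter> {..<n + s}" and ?B = "{n..<m} - {..<n + s}"
  have nn: "0 \<le> \<rho> (b ^ i * y)" for i
    using b y by (intro less_imp_le[OF \<rho>_pos] mult_nonneg_nonneg zero_le_power) auto
  have "(\<Prod>i\<in>{n..<m}. \<rho> (b ^ i * y)) = (\<Prod>i\<in>?A. \<rho> (b ^ i * y)) * (\<Prod>i\<in>?B. \<rho> (b ^ i * y))"
    by (subst prod.union_disjoint[symmetric]) (auto intro!: prod.cong)
  also have "\<dots> \<le> \<rho> 0 ^ s * R"
  proof (intro mult_mono prod_nonneg)
    have "(\<Prod>i\<in>?A. \<rho> (b ^ i * y)) \<le> (\<Prod>i\<in>?A. \<rho> 0)"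
      using b y nn by (intro prod_mono) (auto intro!: \<rho>_le)
    also have "\<dots> = \<rho> 0 ^ card ?A" by simp
    also have "\<dots> \<le> \<rho> 0 ^ s"
    proof (rule power_increasing[OF _ \<rho>_0_ge_1])
      have "card ?A \<le> card {n..<n + s}" by (intro card_mono) auto
      then show "card ?A \<le> s" by simp
    qed
    finally show "(\<Prod>i\<in>?A. \<rho> (b ^ i * y)) \<le> \<rho> 0 ^ s" .
    have "(\<Prod>i\<in>?B. \<rho> (b ^ i * y)) \<le> (\<Prod>i\<in>?B. \<rho> (b ^ (i - (n + s))))"
    proof (intro prod_mono conjI nn \<rho>_le)
      fix i assume "i \<in> ?B"
      then have "b ^ i = b ^ (i - (n + s)) * b ^ (n + s)"
        unfolding power_add[symmetric] by (intro arg_cong[where f="\<lambda>i. b ^ i"]) auto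
      then have "b ^ i * y = b ^ (i - (n + s)) * (b ^ (n + s) * y)"
        by (simp only: mult.assoc)
      moreover have "b ^ (i - (n + s)) * 1 \<le> b ^ (i - (n + s)) * (b ^ (n + s) * y)"
        using s b by (intro mult_left_mono) auto
      ultimately show "b ^ (i - (n + s)) \<le> b ^ i * y" by (simp only: mult_1_right)
    qed (use b in auto)
    also have "\<dots> = (\<Prod>i\<in>(\<lambda>i. i - (n + s)) ` ?B. \<rho> (b ^ i))"
      by (subst prod.reindex) (auto simp: inj_on_def)
    also have "\<dots> \<le> R" by (rule prod_\<rho>_le_R) auto
    finally show "(\<Prod>i\<in>?B. \<rho> (b ^ i * y)) \<le> R" .
  qed (use nn \<rho>_0_ge_1 in auto)
  finally show ?thesis .
qed

text \<open>Summing over the scales \<open>s\<close> replaces the unknown scale of \<open>y\<close> and gives a bound that can be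
  integrated term by term.\<close>

lemma prod_\<rho>_le_layers:
  assumes y: "0 \<le> y"
  shows "ennreal (\<Prod>i\<in>{n..<m}. \<rho> (b ^ i * y))
    \<le> ennreal R * (1 + (\<Sum>s. ennreal (\<rho> 0 ^ Suc s) * indicator {t. b ^ (n + s) * t < 1} y))"
    (is "_ \<le> ennreal R * (1 + (\<Sum>s. ?f s))")
proof -
  have layer: "ennreal R * ennreal (\<rho> 0 ^ Suc s) \<le> ennreal R * (1 + (\<Sum>s. ?f s))"
    if "b ^ (n + s) * y < 1" for s
  proof -
    have "ennreal (\<rho> 0 ^ Suc s) = ?f s" using that by simp
    also have "\<dots> \<le> (\<Sum>s. ?f s)"
      by (rule le_suminf_ennreal)
    also have "\<dots> \<le> 1 + (\<Sum>s. ?f s)"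
      using add_right_mono[of 0 1 "\<Sum>s. ?f s"] by simp
    finally show ?thesis by (intro mult_left_mono) auto
  qed
  show ?thesis
  proof (cases "\<exists>s. 1 \<le> b ^ (n + s) * y")
    case False
    \<comment> \<open>Here \<open>y = 0\<close>, and the product has only \<open>m - n\<close> factors.\<close>
    let ?s = "m - n"
    have "(\<Prod>i\<in>{n..<m}. \<rho> (b ^ i * y)) \<le> (\<Prod>i\<in>{n..<m}. \<rho> 0)"
      using b y by (intro prod_mono) (auto intro!: \<rho>_le less_imp_le[OF \<rho>_pos])
    also have "\<dots> = 1 * \<rho> 0 ^ ?s" by simp
    also have "\<dots> \<le> R * \<rho> 0 ^ Suc ?s"
      using R_ge_1 \<rho>_0_ge_1 by (intro mult_mono power_increasing) auto
    finally have "ennreal (\<Prod>i\<in>{n..<m}. \<rho> (b ^ i * y)) \<le> ennreal R * ennreal (\<rho> 0 ^ Suc ?s)"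
      using R_ge_1 \<rho>_0_ge_1 by (subst ennreal_mult[symmetric]) (auto intro!: ennreal_leI)
    also have "\<dots> \<le> ennreal R * (1 + (\<Sum>s. ?f s))"
      using False by (intro layer) (auto simp: not_le)
    finally show ?thesis .
  next
    case True
    define s where "s = (LEAST s. 1 \<le> b ^ (n + s) * y)"
    have s: "1 \<le> b ^ (n + s) * y"
      unfolding s_def using True by (rule LeastI_ex)
    have "ennreal (\<Prod>i\<in>{n..<m}. \<rho> (b ^ i * y)) \<le> ennreal R * ennreal (\<rho> 0 ^ s)"
      using prod_\<rho>_le[OF y s, of m] R_ge_1 \<rho>_0_ge_1
      by (subst ennreal_mult[symmetric]) (auto intro!: ennreal_leI simp: mult.commute)
    also have "\<dots> \<le> ennreal R * (1 + (\<Sum>s. ?f s))"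
    proof (cases s)
      case 0
      then show ?thesis
        using mult_left_mono[of 1 "1 + (\<Sum>s. ?f s)" "ennreal R"] by simp
    next
      case (Suc r)
      then have "\<not> 1 \<le> b ^ (n + r) * y"
        unfolding s_def by (intro not_less_Least) (simp add: s_def)
      then show ?thesis using layer[of r] Suc by simp
    qed
    finally show ?thesis .
  qed
qed

lemma k_point_cascade:
  assumes \<theta>: "\<And>j. j < k \<Longrightarrow> \<theta> j \<in> sphere 0 1"
  shows "(\<E> \<omega>. (\<Prod>j<k. epow (cascade {n..<m} (\<theta> j) \<omega>) (ps j)))
           \<le> ennreal (\<Prod>i\<in>{n..<m}. \<rho> (b ^ i * min_ang_dist k \<theta>))"
proof -
  define F where "F x = (\<Prod>j<k. epow (ennreal (x (\<theta> j))) (ps j))" for x :: "'a \<Rightarrow> real"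
  have F: "F \<in> borel_measurable field_algebra"
    unfolding F_def[abs_def] using \<theta>
    by (intro borel_measurable_prod_ennreal measurable_compose[OF _ measurable_epow]
        measurable_compose[OF _ measurable_ennreal] measurable_component_singleton) simp
  have Ff: "F (field i \<omega>) = (\<Prod>j<k. epow (ennreal (\<Lambda> i (\<theta> j) \<omega>)) (ps j))" for i \<omega>
    unfolding F_def using \<theta> by (intro prod.cong) auto
  have "(\<Prod>j<k. epow (cascade {n..<m} (\<theta> j) \<omega>) (ps j)) = (\<Prod>i\<in>{n..<m}. F (field i \<omega>))" for \<omega>
  proof -
    have "(\<Prod>j<k. epow (cascade {n..<m} (\<theta> j) \<omega>) (ps j))
        = (\<Prod>j<k. \<Prod>i\<in>{n..<m}. epow (ennreal (\<Lambda> i (\<theta> j) \<omega>)) (ps j))"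
      using ps(1) by (intro prod.cong refl) (force simp: cascade_def intro!: epow_prod)
    then show ?thesis unfolding Ff by (subst prod.swap) simp
  qed
  then have "(\<E> \<omega>. \<Prod>j<k. epow (cascade {n..<m} (\<theta> j) \<omega>) (ps j)) = (\<Prod>i\<in>{n..<m}. \<E> \<omega>. F (field i \<omega>))"
    by (simp only: nn_integral_prod_fields[OF finite_atLeastLessThan F])
  also have "\<dots> \<le> (\<Prod>i\<in>{n..<m}. ennreal (\<rho> (b ^ i * min_ang_dist k \<theta>)))"
    unfolding Ff using k_point[OF \<theta>] by (intro prod_mono_ennreal) simp
  also have "\<dots> = ennreal (\<Prod>i\<in>{n..<m}. \<rho> (b ^ i * min_ang_dist k \<theta>))"
  proof (rule prod_ennreal)
    fix i assume "i \<in> {n..<m}"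
    have "0 \<le> min_ang_dist k \<theta>"
      using min_ang_dist_nonneg[OF k] \<theta> by auto
    then show "0 \<le> \<rho> (b ^ i * min_ang_dist k \<theta>)"
      using b by (intro less_imp_le[OF \<rho>_pos]) auto
  qed
  finally show ?thesis .
qed

text \<open>Fix all points except the \<open>m\<close>-th one, which has to lie in a cap around the \<open>h\<close>-th one.\<close>

lemma emeasure_close_pair_le:
  assumes \<nu>: "finite_measure \<nu>" and sets[measurable_cong]: "sets \<nu> = sets sphere_borel"
    and cap: "\<And>\<theta>. \<theta> \<in> sphere 0 1 \<Longrightarrow> emeasure \<nu> (cap r \<theta>) \<le> c"
    and mh: "m < k" "h < k" "m \<noteq> h"
  shows "(\<integral>\<^sup>+x. indicator {t. t < r} (ang_dist (x m) (x h)) \<partial>PiM {..<k} (\<lambda>_. \<nu>))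
           \<le> c * emeasure \<nu> (space \<nu>) ^ (k - 1)"
proof -
  interpret \<nu>: finite_measure \<nu> by fact
  interpret product_sigma_finite "\<lambda>_::nat. \<nu>" ..
  have sp: "space \<nu> = sphere 0 1"
    using sets_eq_imp_space_eq[OF sets] by (simp add: space_restrict_space)
  let ?I = "{..<k} - {m}"
  have I: "{..<k} = insert m ?I" using mh by auto
  have comp: "(\<lambda>x. x j) \<in> measurable (PiM {..<k} (\<lambda>_. \<nu>)) sphere_borel" if "j < k" for j
    using measurable_component_singleton[of j "{..<k}" "\<lambda>_. \<nu>"] that
    by (simp cong: measurable_cong_sets add: sets)
  have [measurable]: "(\<lambda>x. ang_dist (x m) (x h)) \<in> borel_measurable (PiM {..<k} (\<lambda>_. \<nu>))"
    by (intro borel_measurable_ang_dist comp mh)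
  have "(\<integral>\<^sup>+x. indicator {t. t < r} (ang_dist (x m) (x h)) \<partial>PiM {..<k} (\<lambda>_. \<nu>))
      = (\<integral>\<^sup>+x. \<integral>\<^sup>+y. indicator {t. t < r} (ang_dist y (x h)) \<partial>\<nu> \<partial>PiM ?I (\<lambda>_. \<nu>))"
  proof -
    have "(\<lambda>x. indicator {t. t < r} (ang_dist (x m) (x h)) :: ennreal) \<in> borel_measurable (PiM (insert m ?I) (\<lambda>_. \<nu>))"
      unfolding I[symmetric] by measurable
    note meas = this
    have fin: "finite ?I" "m \<notin> ?I" by auto
    note product_nn_integral_insert[OF fin meas, unfolded I[symmetric]]
    then show ?thesis
      using mh(3) by (simp only: fun_upd_same fun_upd_other[OF not_sym[OF mh(3)]])
  qed
  also have "\<dots> \<le> (\<integral>\<^sup>+x. c \<partial>PiM ?I (\<lambda>_. \<nu>))"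
  proof (rule nn_integral_mono)
    fix x assume "x \<in> space (PiM ?I (\<lambda>_. \<nu>))"
    moreover have "h \<in> ?I" using mh by auto
    ultimately have xh: "x h \<in> sphere 0 1"
      unfolding space_PiM sp by (rule PiE_mem)
    have "(\<integral>\<^sup>+y. indicator {t. t < r} (ang_dist y (x h)) \<partial>\<nu>) \<le> (\<integral>\<^sup>+y. indicator (cap r (x h)) y \<partial>\<nu>)"
      using sp by (intro nn_integral_mono) (auto simp: indicator_def cap_def)
    also have "\<dots> = emeasure \<nu> (cap r (x h))"
      using sets_cap[OF xh] by (intro nn_integral_indicator) (simp add: sets)
    also have "\<dots> \<le> c" by (rule cap[OF xh])
    finally show "(\<integral>\<^sup>+y. indicator {t. t < r} (ang_dist y (x h)) \<partial>\<nu>) \<le> c" .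
  qed
  also have "\<dots> = c * emeasure \<nu> (space \<nu>) ^ (k - 1)"
  proof -
    have "card ?I = k - 1" using mh(1) by simp
    then show ?thesis
      by (simp only: nn_integral_const emeasure_space_PiM_power[OF \<nu>] finite_Diff finite_lessThan)
  qed
  finally show ?thesis .
qed

text \<open>The moment of order \<open>p\<close> of the mass of \<open>\<nu>\<close> under the factors from \<open>n\<close> on is comparable with the
  \<open>p\<close>-th power of its mean, as soon as the mass of \<open>\<nu>\<close> is at least of the order of that of a cap of radius \<open>b\<^sup>-\<^sup>n\<close>. Split
  \<open>X\<^sup>p\<close> into \<open>k\<close> powers, apply Jensen's inequality to each and compute the expectation under the
  \<open>k\<close>-fold integral. Configurations with two points about \<open>b\<^sup>-\<^sup>n\<^sup>-\<^sup>s\<close> apart cost a factor \<open>\<rho> 0 ^ s\<close>,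
  but their proportion is of order \<open>b\<^sup>-\<^sup>d\<^sup>s\<close>, and \<open>\<rho> 0 < b ^ d\<close> makes the sum over \<open>s\<close> converge.\<close>

lemma tail_moment_le:
  fixes K C :: real
  assumes \<nu>: "finite_measure \<nu>" and sets[measurable_cong]: "sets \<nu> = sets sphere_borel"
    and K: "0 \<le> K" "\<And>r \<theta>. 0 < r \<Longrightarrow> \<theta> \<in> sphere 0 1 \<Longrightarrow> emeasure \<nu> (cap r \<theta>) \<le> ennreal (K * r ^ d)"
    and C: "0 \<le> C" "ennreal ((1 / b ^ n) ^ d) \<le> ennreal C * emeasure \<nu> (space \<nu>)"
  shows "(\<E> \<omega>. epow (\<integral>\<^sup>+\<theta>. cascade {n..<m} \<theta> \<omega> \<partial>\<nu>) p)
           \<le> ennreal (R * (1 + k\<^sup>2 * K * C * \<rho> 0 / (1 - \<rho> 0 / b ^ d))) * epow (emeasure \<nu> (space \<nu>)) p"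
proof -
  let ?Pi = "PiM {..<k} (\<lambda>_. \<nu>)"
  let ?near = "\<lambda>r x i j. indicator {t. t < r} (ang_dist (x i) (x j)) :: ennreal"
  interpret \<nu>: finite_measure \<nu> by fact
  interpret product_sigma_finite "\<lambda>_::nat. \<nu>" ..
  interpret Prod: sigma_finite_measure "?Pi"
    by (rule sigma_finite) simp
  interpret PM: pair_sigma_finite "?Pi" M ..
  have sp: "space \<nu> = sphere 0 1"
    using sets_eq_imp_space_eq[OF sets] by (simp add: space_restrict_space)
  define T where "T = emeasure \<nu> (space \<nu>)"
  define J where "J = {n..<m}"
  let ?G = "\<lambda>x \<omega>. \<Prod>j<k. epow (cascade J (x j) \<omega>) (ps j)"
  define P where "P = {(i, j). i < k \<and> j < k \<and> i \<noteq> j}"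
  have P: "finite P" "card P \<le> k\<^sup>2"
  proof -
    have "P \<subseteq> {..<k} \<times> {..<k}" by (auto simp: P_def)
    then show "finite P" "card P \<le> k\<^sup>2"
      using card_mono[of "{..<k} \<times> {..<k}" P] by (auto intro: finite_subset simp: power2_eq_square)
  qed
  have kp: "real k \<le> p"
    using sum_mono[of "{..<k}" "\<lambda>_. 1" ps] ps by simp
  have b0: "0 < b" using b by simp
  have comp: "(\<lambda>x. x j) \<in> measurable (?Pi) sphere_borel" if "j < k" for j
    using measurable_component_singleton[of j "{..<k}" "\<lambda>_. \<nu>"] that
    by (simp cong: measurable_cong_sets add: sets)
  have ang[measurable]: "(\<lambda>x. ang_dist (x i) (x j)) \<in> borel_measurable (?Pi)"
    if "i < k" "j < k" for i j
    using that by (intro borel_measurable_ang_dist comp)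
  have casc: "(\<lambda>z. cascade J (fst z j) (snd z)) \<in> borel_measurable (?Pi \<Otimes>\<^sub>M M)"
    if "j < k" for j
    using measurable_compose[OF measurable_fst comp[OF that]] by (intro measurable_cascade) auto
  have pow: "epow (\<integral>\<^sup>+\<theta>. cascade J \<theta> \<omega> \<partial>\<nu>) p
      \<le> epow T (p - k) * (\<integral>\<^sup>+x. ?G x \<omega> \<partial>?Pi)"
    if \<omega>[measurable (raw)]: "\<omega> \<in> space M" for \<omega>
  proof -
    have "epow (\<integral>\<^sup>+\<theta>. cascade J \<theta> \<omega> \<partial>\<nu>) p = (\<Prod>j<k. epow (\<integral>\<^sup>+\<theta>. cascade J \<theta> \<omega> \<partial>\<nu>) (ps j))"
      using ps by (subst epow_sum_right) (force simp: ps(2))+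
    also have "\<dots> \<le> (\<Prod>j<k. epow T (ps j - 1) * (\<integral>\<^sup>+\<theta>. epow (cascade J \<theta> \<omega>) (ps j) \<partial>\<nu>))"
    proof (intro prod_mono_ennreal)
      fix j assume "j \<in> {..<k}"
      then show "epow (\<integral>\<^sup>+\<theta>. cascade J \<theta> \<omega> \<partial>\<nu>) (ps j)
          \<le> epow T (ps j - 1) * (\<integral>\<^sup>+\<theta>. epow (cascade J \<theta> \<omega>) (ps j) \<partial>\<nu>)"
        using nn_integral_epow_Jensen[of "\<lambda>\<theta>. cascade J \<theta> \<omega>" \<nu> "\<lambda>_. 1" "ps j"] ps(1)
        by (simp add: T_def)
    qed
    also have "\<dots> = epow T (p - k) * (\<Prod>j<k. \<integral>\<^sup>+\<theta>. epow (cascade J \<theta> \<omega>) (ps j) \<partial>\<nu>)"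
    proof -
      have "(\<Prod>j<k. epow T (ps j - 1)) = epow T (\<Sum>j<k. ps j - 1)"
        using ps(1) by (intro epow_sum_right) auto
      also have "(\<Sum>j<k. ps j - 1) = p - k"
        using ps(2) by (simp add: sum_subtractf)
      finally show ?thesis by (simp only: prod.distrib)
    qed
    also have "(\<Prod>j<k. \<integral>\<^sup>+\<theta>. epow (cascade J \<theta> \<omega>) (ps j) \<partial>\<nu>)
        = (\<integral>\<^sup>+x. ?G x \<omega> \<partial>?Pi)"
      by (subst product_nn_integral_prod) auto
    finally show ?thesis .
  qed
  have point: "(\<E> \<omega>. ?G x \<omega>)
      \<le> ennreal R * (1 + (\<Sum>s. ennreal (\<rho> 0 ^ Suc s) *
            (\<Sum>(i, j)\<in>P. ?near (1 / b ^ (n + s)) x i j)))"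
    if "x \<in> space (?Pi)" for x
  proof -
    have "x \<in> PiE {..<k} (\<lambda>_. sphere 0 1)"
      using that by (simp only: space_PiM sp)
    then have x: "x j \<in> sphere 0 1" if "j < k" for j
      using that by (intro PiE_mem[of x "{..<k}" "\<lambda>_. sphere 0 1"]) (simp_all only: lessThan_iff)
    have "(\<E> \<omega>. ?G x \<omega>)
        \<le> ennreal (\<Prod>i\<in>{n..<m}. \<rho> (b ^ i * min_ang_dist k x))"
      unfolding J_def by (rule k_point_cascade[OF x])
    also have "\<dots> \<le> ennreal R * (1 + (\<Sum>s. ennreal (\<rho> 0 ^ Suc s) *
        indicator {t. b ^ (n + s) * t < 1} (min_ang_dist k x)))"
      by (rule prod_\<rho>_le_layers[OF min_ang_dist_nonneg[OF k x]])
    also have "\<dots> \<le> ennreal R * (1 + (\<Sum>s. ennreal (\<rho> 0 ^ Suc s) *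
            (\<Sum>(i, j)\<in>P. ?near (1 / b ^ (n + s)) x i j)))"
    proof (intro mult_left_mono add_left_mono suminf_le)
      fix s
      obtain i j where ij: "i < k" "j < k" "i \<noteq> j" "min_ang_dist k x = ang_dist (x i) (x j)"
        using min_ang_dist_attained[OF k] by metis
      have "indicator {t. b ^ (n + s) * t < 1} (min_ang_dist k x)
          = (?near (1 / b ^ (n + s)) x i j :: ennreal)"
        using b0 ij(4) by (simp add: indicator_def field_simps)
      also have "\<dots> = (\<Sum>(i, j)\<in>{(i, j)}. ?near (1 / b ^ (n + s)) x i j)"
        by simp
      also have "\<dots> \<le> (\<Sum>(i, j)\<in>P. ?near (1 / b ^ (n + s)) x i j)"
        using ij P(1) by (intro sum_mono2) (auto simp: P_def)
      finally show "indicator {t. b ^ (n + s) * t < 1} (min_ang_dist k x)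
          \<le> (\<Sum>(i, j)\<in>P. ?near (1 / b ^ (n + s)) x i j :: ennreal)" .
    qed auto
    finally show ?thesis .
  qed
  define x where "x = \<rho> 0 / b ^ d"
  have x: "0 \<le> x" "x < 1"
    using \<rho>_0 \<rho>_0_ge_1 b0 by (auto simp: x_def)
  have layer: "ennreal (\<rho> 0 ^ Suc s) * (\<Sum>(i, j)\<in>P. \<integral>\<^sup>+x. ?near (1 / b ^ (n + s)) x i j
        \<partial>?Pi)
      \<le> ennreal (x ^ s) * (ennreal (k\<^sup>2 * K * \<rho> 0) * (ennreal C * T) * T ^ (k - 1))" for s
  proof -
    let ?r = "1 / b ^ (n + s)"
    have "(\<Sum>(i, j)\<in>P. \<integral>\<^sup>+x. ?near ?r x i j \<partial>?Pi)
        \<le> (\<Sum>(i, j)\<in>P. ennreal (K * ?r ^ d) * T ^ (k - 1))"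
    proof (rule sum_mono, clarify)
      fix i j assume "(i, j) \<in> P"
      then show "(\<integral>\<^sup>+x. ?near ?r x i j \<partial>?Pi)
          \<le> ennreal (K * ?r ^ d) * T ^ (k - 1)"
        unfolding T_def P_def using b0 K(2)[of ?r]
        by (intro emeasure_close_pair_le[OF \<nu> sets]) auto
    qed
    also have "\<dots> = of_nat (card P) * (ennreal (K * ?r ^ d) * T ^ (k - 1))"
      by simp
    also have "\<dots> \<le> of_nat (k\<^sup>2) * (ennreal (K * ?r ^ d) * T ^ (k - 1))"
      using P(2) by (intro mult_right_mono of_nat_mono) auto
    finally have "ennreal (\<rho> 0 ^ Suc s) * (\<Sum>(i, j)\<in>P. \<integral>\<^sup>+x. ?near ?r x i j
        \<partial>?Pi)
      \<le> ennreal (\<rho> 0 ^ Suc s) * (of_nat (k\<^sup>2) * (ennreal (K * ?r ^ d) * T ^ (k - 1)))"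
      by (intro mult_left_mono) auto
    also have "\<dots> = ennreal (\<rho> 0 ^ Suc s * (k\<^sup>2 * (K * ?r ^ d))) * T ^ (k - 1)"
      using K(1) \<rho>_0_ge_1 b0
      by (simp add: ennreal_mult ennreal_of_nat_eq_real_of_nat mult.assoc del: power_Suc)
    also have "\<rho> 0 ^ Suc s * (k\<^sup>2 * (K * ?r ^ d)) = x ^ s * (k\<^sup>2 * K * \<rho> 0 * (1 / b ^ n) ^ d)"
    proof -
      have "?r ^ d = (1 / b ^ n) ^ d * (1 / b ^ d) ^ s"
        by (simp add: power_add power_divide power_mult_distrib power_mult[symmetric] mult.commute[of d])
      moreover have "x ^ s = \<rho> 0 ^ s * (1 / b ^ d) ^ s"
        by (simp add: x_def power_divide)
      ultimately show ?thesis
        by (simp only: power_Suc) (simp only: ac_simps)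
    qed
    also have "ennreal \<dots> = ennreal (x ^ s) * (ennreal (k\<^sup>2 * K * \<rho> 0) * ennreal ((1 / b ^ n) ^ d))"
      using x K(1) \<rho>_0_ge_1 b0 by (simp add: ennreal_mult)
    also have "\<dots> * T ^ (k - 1) \<le> ennreal (x ^ s) * (ennreal (k\<^sup>2 * K * \<rho> 0) * (ennreal C * T)) * T ^ (k - 1)"
      using C(2) by (intro mult_right_mono mult_left_mono) (auto simp: T_def)
    finally show ?thesis by (simp add: mult.assoc)
  qed
  have geo: "(\<Sum>s. ennreal (x ^ s)) = ennreal (1 / (1 - x))"
    using x geometric_sums[of x] by (intro suminf_ennreal_eq) auto
  have Tk: "T * T ^ (k - 1) = T ^ k"
    using k by (cases k) auto
  have "(\<E> \<omega>. epow (\<integral>\<^sup>+\<theta>. cascade J \<theta> \<omega> \<partial>\<nu>) p)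
      \<le> (\<E> \<omega>. epow T (p - k) * (\<integral>\<^sup>+x. ?G x \<omega> \<partial>?Pi))"
    by (intro nn_integral_mono pow)
  also have "\<dots> = epow T (p - k) * (\<E> \<omega>. \<integral>\<^sup>+x. ?G x \<omega> \<partial>?Pi)"
    using casc by (intro nn_integral_cmult) measurable
  also have "(\<E> \<omega>. \<integral>\<^sup>+x. ?G x \<omega> \<partial>?Pi)
      = (\<integral>\<^sup>+x. (\<E> \<omega>. ?G x \<omega>) \<partial>?Pi)"
    using casc by (intro PM.Fubini') measurable
  also have "\<dots> \<le> (\<integral>\<^sup>+x. ennreal R * (1 + (\<Sum>s. ennreal (\<rho> 0 ^ Suc s) *
            (\<Sum>(i, j)\<in>P. ?near (1 / b ^ (n + s)) x i j))) \<partial>?Pi)"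
    by (intro nn_integral_mono point)
  also have "\<dots> = ennreal R * (T ^ k + (\<Sum>s. ennreal (\<rho> 0 ^ Suc s) *
            (\<Sum>(i, j)\<in>P. \<integral>\<^sup>+x. ?near (1 / b ^ (n + s)) x i j \<partial>?Pi)))"
  proof -
    have ind: "(\<lambda>x. ?near r x i j) \<in> borel_measurable (?Pi)"
      if "(i, j) \<in> P" for i j r
      using that by (auto simp: P_def)
    have S: "(\<lambda>x. \<Sum>(i, j)\<in>P. ?near r x i j)
        \<in> borel_measurable (?Pi)" for r
      using ind by (intro borel_measurable_sum) auto
    have Sint: "(\<integral>\<^sup>+x. (\<Sum>(i, j)\<in>P. ?near r x i j) \<partial>?Pi)
        = (\<Sum>(i, j)\<in>P. \<integral>\<^sup>+x. ?near r x i j \<partial>?Pi)" for r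
      using ind by (subst nn_integral_sum) (auto simp: case_prod_beta intro!: sum.cong)
    note S[measurable]
    have one: "(\<integral>\<^sup>+x. 1 \<partial>?Pi) = T ^ k"
      by (simp add: emeasure_space_PiM_power[OF \<nu>] T_def)
    show ?thesis
      by (subst nn_integral_cmult, measurable)
        (simp add: nn_integral_add nn_integral_suminf nn_integral_cmult Sint one del: nn_integral_const)
  qed
  also have "\<dots> \<le> ennreal R * (T ^ k + (\<Sum>s. ennreal (x ^ s) * (ennreal (k\<^sup>2 * K * \<rho> 0) * (ennreal C * T) * T ^ (k - 1))))"
    by (intro mult_left_mono add_left_mono suminf_le layer) auto
  also have "(\<Sum>s. ennreal (x ^ s) * (ennreal (k\<^sup>2 * K * \<rho> 0) * (ennreal C * T) * T ^ (k - 1)))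
      = ennreal (1 / (1 - x)) * (ennreal (k\<^sup>2 * K * \<rho> 0) * (ennreal C * T) * T ^ (k - 1))"
    by (simp add: ennreal_suminf_multc geo)
  also have "\<dots> = ennreal (k\<^sup>2 * K * C * \<rho> 0 / (1 - x)) * T ^ k"
  proof -
    have "ennreal (k\<^sup>2 * K * C * \<rho> 0 / (1 - x)) = ennreal (1 / (1 - x) * (k\<^sup>2 * K * \<rho> 0 * C))"
      by (simp add: mult_ac)
    also have "\<dots> = ennreal (1 / (1 - x)) * (ennreal (k\<^sup>2 * K * \<rho> 0) * ennreal C)"
      using x K(1) C(1) \<rho>_0_ge_1 by (subst ennreal_mult; simp add: ennreal_mult)
    finally show ?thesis by (simp add: Tk[symmetric] mult_ac)
  qed
  also have "ennreal R * (T ^ k + ennreal (k\<^sup>2 * K * C * \<rho> 0 / (1 - x)) * T ^ k)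
      = ennreal (R * (1 + k\<^sup>2 * K * C * \<rho> 0 / (1 - x))) * T ^ k"
    using x K(1) C(1) \<rho>_0_ge_1 R_ge_1
    by (subst ennreal_mult) (simp_all add: distrib_left distrib_right mult.assoc)
  also have "epow T (p - k) * (ennreal (R * (1 + k\<^sup>2 * K * C * \<rho> 0 / (1 - x))) * T ^ k)
      = ennreal (R * (1 + k\<^sup>2 * K * C * \<rho> 0 / (1 - x))) * epow T p"
    using epow_add[of "p - k" "real k" T] kp by (simp add: epow_real_of_nat mult_ac)
  finally show ?thesis
    by (simp add: J_def T_def x_def mult_left_mono)
qed

end

section \<open>Moments of the mass of a cell\<close>

lemma epow_epow_pos:
  assumes "x \<noteq> 0" "x \<noteq> \<infinity>"
  shows "epow (epow x a) c = epow x (a * c)"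
  using assms by (cases x rule: ennreal_zero_top_pos_cases) (auto simp: epow_ennreal powr_powr)

text \<open>Solves the conclusion of Hoelder's inequality for one of its factors.\<close>

lemma le_of_le_epow_mult:
  assumes le: "x \<le> epow y a * epow z c" and a: "0 < a" "0 \<le> c" and z: "z \<noteq> 0" "z \<noteq> \<infinity>"
  shows "epow x (1 / a) * epow z (- (c / a)) \<le> y"
proof -
  have "epow x (1 / a) \<le> epow (epow y a * epow z c) (1 / a)"
    using a le by (intro epow_mono) auto
  also have "\<dots> = y * epow z (c / a)"
    using a by (simp add: epow_mult epow_epow)
  finally have "epow x (1 / a) * epow z (- (c / a)) \<le> y * epow z (c / a) * epow z (- (c / a))"
    by (rule mult_right_mono) simp
  also have "\<dots> = y"
    by (simp only: mult.assoc epow_cancel[OF z] mult_1_right)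
  finally show ?thesis .
qed

definition correlation :: "'w measure \<Rightarrow> ('a \<Rightarrow> 'w \<Rightarrow> real) \<Rightarrow> real \<Rightarrow> 'a \<Rightarrow> 'a \<Rightarrow> ennreal" where
  "correlation M X e y \<theta> = (\<integral>\<^sup>+\<omega>. epow (ennreal (X y \<omega>)) e * ennreal (X \<theta> \<omega>) \<partial>M)"

context random_cascade
begin

lemma nn_integral_weighted_cascade:
  assumes "n \<le> m" "y \<in> sphere 0 1" "\<theta> \<in> sphere 0 1"
    and mean: "\<And>i. moment M (\<Lambda> i \<theta>) 1 = 1"
  shows "(\<E> \<omega>. (\<Prod>i<n. epow (ennreal (\<Lambda> i y \<omega>)) e) * cascade {..<m} \<theta> \<omega>)
           = (\<Prod>i<n. correlation M (\<Lambda> i) e y \<theta>)"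
proof -
  define F where "F i x = (if i < n then epow (ennreal (x y)) e else 1) * ennreal (x \<theta>)"
    for i :: nat and x :: "'a \<Rightarrow> real"
  have F: "F i \<in> borel_measurable field_algebra" for i
    unfolding F_def using assms(2,3) by (cases "i < n") simp_all
  have Ff: "F i (field i \<omega>) = (if i < n then epow (ennreal (\<Lambda> i y \<omega>)) e else 1) * ennreal (\<Lambda> i \<theta> \<omega>)" for i \<omega>
    using assms(2,3) by (simp add: F_def)
  have split: "{..<m} = {..<n} \<union> {n..<m}" using assms(1) by auto
  have "(\<Prod>i<n. epow (ennreal (\<Lambda> i y \<omega>)) e) * cascade {..<m} \<theta> \<omega> = (\<Prod>i<m. F i (field i \<omega>))" for \<omega>
  proof -
    have "(\<Prod>i<m. if i < n then epow (ennreal (\<Lambda> i y \<omega>)) e else 1) = (\<Prod>i<n. epow (ennreal (\<Lambda> i y \<omega>)) e)"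
      unfolding split by (subst prod.union_disjoint) auto
    then show ?thesis by (simp only: Ff prod.distrib cascade_def)
  qed
  then have "(\<E> \<omega>. (\<Prod>i<n. epow (ennreal (\<Lambda> i y \<omega>)) e) * cascade {..<m} \<theta> \<omega>)
      = (\<Prod>i<m. (\<E> \<omega>. F i (field i \<omega>)))"
    by (simp only: nn_integral_prod_fields[OF finite_lessThan F])
  also have "\<dots> = (\<Prod>i<n. (\<E> \<omega>. F i (field i \<omega>))) * (\<Prod>i\<in>{n..<m}. (\<E> \<omega>. F i (field i \<omega>)))"
    unfolding split by (subst prod.union_disjoint) auto
  also have "(\<Prod>i\<in>{n..<m}. (\<E> \<omega>. F i (field i \<omega>))) = 1"
    using mean by (intro prod.neutral) (auto simp: Ff moment_def)
  also have "(\<Prod>i<n. (\<E> \<omega>. F i (field i \<omega>)))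
      = (\<Prod>i<n. correlation M (\<Lambda> i) e y \<theta>)"
    by (rule prod.cong) (simp_all only: Ff lessThan_iff if_True correlation_def)
  finally show ?thesis by simp
qed

end

text \<open>A measure \<open>\<nu>\<close> on the sphere (later the surface measure on a cell) together with a level \<open>n\<close> at
  which its size matches the scale of the fields: the mass \<open>X\<close> produced by the factors
  from \<open>n\<close> on has a \<open>p\<close>-th moment comparable with the \<open>p\<close>-th power of its mean.\<close>

locale cell = random_cascade M \<Lambda>
  for M :: "'w measure" and \<Lambda> :: "nat \<Rightarrow> 'a::euclidean_space \<Rightarrow> 'w \<Rightarrow> real" +
  fixes \<nu> :: "'a measure" and n m :: nat and p c :: real
  assumes \<nu>: "finite_measure \<nu>" and sets_\<nu>: "sets \<nu> = sets sphere_borel"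
    and mean: "\<And>i \<theta>. \<theta> \<in> sphere 0 1 \<Longrightarrow> moment M (\<Lambda> i \<theta>) 1 = 1"
    and nm: "n \<le> m" and p: "2 \<le> p" and c: "1 \<le> c"
    and tail: "(\<E> \<omega>. epow (\<integral>\<^sup>+\<theta>. cascade {n..<m} \<theta> \<omega> \<partial>\<nu>) p)
                 \<le> ennreal c * epow (emeasure \<nu> (space \<nu>)) p"
begin

declare sets_\<nu> [measurable_cong]

definition T :: ennreal where "T = emeasure \<nu> (space \<nu>)"
definition X :: "'w \<Rightarrow> ennreal" where "X \<omega> = (\<integral>\<^sup>+\<theta>. cascade {n..<m} \<theta> \<omega> \<partial>\<nu>)"
definition Z :: "'w \<Rightarrow> ennreal" where "Z \<omega> = (\<integral>\<^sup>+\<theta>. cascade {..<m} \<theta> \<omega> \<partial>\<nu>)"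

lemma space_\<nu>: "space \<nu> = sphere 0 1"
  using sets_eq_imp_space_eq[OF sets_\<nu>] by (simp add: space_restrict_space)

lemma T_less_top: "T < \<infinity>"
  using finite_measure.emeasure_finite[OF \<nu>] by (simp add: T_def less_top)

sublocale \<nu>: finite_measure \<nu> by (rule \<nu>)

lemma measurable_X [measurable]: "X \<in> borel_measurable M"
  unfolding X_def[abs_def] by measurable

lemma measurable_Z [measurable]: "Z \<in> borel_measurable M"
  unfolding Z_def[abs_def] by measurable

lemma tail_X: "(\<E> \<omega>. epow (X \<omega>) p) \<le> ennreal c * epow T p"
  using tail by (simp add: X_def T_def)

lemma X_moment_le:
  assumes "0 \<le> q" "q \<le> p"
  shows "(\<E> \<omega>. epow (X \<omega>) q) \<le> ennreal (c powr (q / p)) * epow T q"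
proof -
  have "(\<E> \<omega>. epow (X \<omega>) q) \<le> epow (\<E> \<omega>. epow (X \<omega>) p) (q / p)"
    using assms p by (intro nn_integral_epow_Lyapunov) auto
  also have "\<dots> \<le> epow (ennreal c * epow T p) (q / p)"
    using assms p by (intro epow_mono tail_X) auto
  also have "\<dots> = ennreal (c powr (q / p)) * epow T q"
    using assms p c by (simp add: epow_mult epow_epow epow_ennreal)
  finally show ?thesis .
qed

lemma X_square_integral: "(\<E> \<omega>. X \<omega> * X \<omega>) < \<infinity>"
proof -
  have "epow T 2 < \<infinity>"
    using T_less_top by (simp add: epow_2 ennreal_mult_less_top)
  then have "ennreal (c powr (2 / p)) * epow T 2 < \<infinity>"
    by (simp add: ennreal_mult_less_top)
  then show ?thesis
    using X_moment_le[of 2] p by (auto simp: epow_2 intro: le_less_trans)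
qed

lemma Z_split: "Z \<omega> = (\<integral>\<^sup>+\<theta>. cascade {..<n} \<theta> \<omega> * cascade {n..<m} \<theta> \<omega> \<partial>\<nu>)"
proof -
  have "{..<m} = {..<n} \<union> {n..<m}" using nm by auto
  then show ?thesis
    by (simp add: Z_def cascade_Un[symmetric] ivl_disj_int)
qed

lemma decoupled_moment:
  assumes q: "0 \<le> q" and mq: "\<And>i \<theta>. \<theta> \<in> sphere 0 1 \<Longrightarrow> moment M (\<Lambda> i \<theta>) q = ennreal mq"
  shows "(\<E> \<omega>. epow (X \<omega>) (q - 1) * (\<integral>\<^sup>+\<theta>. epow (cascade {..<n} \<theta> \<omega>) q * cascade {n..<m} \<theta> \<omega> \<partial>\<nu>))
           = ennreal mq ^ n * (\<E> \<omega>. epow (X \<omega>) (q - 1) * X \<omega>)"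
  using decoupling[OF _ _ _ \<nu> sets_\<nu> _ X_square_integral q, of "{..<n}" "{n..<m}" "ennreal mq" "\<lambda>x. epow x (q - 1)"] mq
  by (simp add: X_def[abs_def] ivl_disj_int)

lemma upper_bound_ge_1:
  assumes q: "1 \<le> q" "q \<le> p" and mq: "\<And>i \<theta>. \<theta> \<in> sphere 0 1 \<Longrightarrow> moment M (\<Lambda> i \<theta>) q = ennreal mq"
  shows "(\<E> \<omega>. epow (Z \<omega>) q) \<le> ennreal (c powr (q / p)) * ennreal mq ^ n * epow T q"
proof -
  have "(\<E> \<omega>. epow (Z \<omega>) q) \<le> (\<E> \<omega>. epow (X \<omega>) (q - 1) *
      (\<integral>\<^sup>+\<theta>. epow (cascade {..<n} \<theta> \<omega>) q * cascade {n..<m} \<theta> \<omega> \<partial>\<nu>))"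
  proof (rule nn_integral_mono)
    fix \<omega> assume [measurable (raw)]: "\<omega> \<in> space M"
    show "epow (Z \<omega>) q \<le> epow (X \<omega>) (q - 1) * (\<integral>\<^sup>+\<theta>. epow (cascade {..<n} \<theta> \<omega>) q * cascade {n..<m} \<theta> \<omega> \<partial>\<nu>)"
      unfolding Z_split X_def using q cascade_less_top by (intro nn_integral_epow_Jensen) measurable
  qed
  also have "\<dots> = ennreal mq ^ n * (\<E> \<omega>. epow (X \<omega>) (q - 1) * X \<omega>)"
    using q mq by (intro decoupled_moment) auto
  also have "(\<E> \<omega>. epow (X \<omega>) (q - 1) * X \<omega>) = (\<E> \<omega>. epow (X \<omega>) q)"
    using q epow_add[of "q - 1" 1] by simp
  also have "ennreal mq ^ n * \<dots> \<le> ennreal mq ^ n * (ennreal (c powr (q / p)) * epow T q)"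
    using q by (intro mult_left_mono X_moment_le) auto
  finally show ?thesis
    by (simp add: mult_ac)
qed

lemma X_mean: "(\<E> \<omega>. X \<omega>) = T"
proof -
  have "(\<E> \<omega>. X \<omega>) = (\<integral>\<^sup>+\<theta>. (\<E> \<omega>. cascade {n..<m} \<theta> \<omega>) \<partial>\<nu>)"
    unfolding X_def by (rule nn_integral_swap[OF \<nu> sets_\<nu>]) measurable
  also have "\<dots> = (\<integral>\<^sup>+\<theta>. 1 \<partial>\<nu>)"
  proof (rule nn_integral_cong)
    fix \<theta> assume "\<theta> \<in> space \<nu>"
    then have \<theta>: "\<theta> \<in> sphere 0 1" by (simp only: space_\<nu>)
    show "(\<E> \<omega>. cascade {n..<m} \<theta> \<omega>) = 1"
      using moment_cascade[OF _ \<theta>, of "{n..<m}" 1] mean[OF \<theta>] by simp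
  qed
  finally show ?thesis by (simp add: T_def)
qed

text \<open>For \<open>q < 1\<close> the moment of \<open>X\<close> is bounded below by Hoelder interpolation of the first moment
  between the moments of order \<open>q\<close> and \<open>p\<close>.\<close>

lemma X_moment_ge:
  assumes q: "0 < q" "q < 1"
  shows "ennreal (c powr - ((1 - q) / (p - 1))) * epow T q \<le> (\<E> \<omega>. epow (X \<omega>) q)"
proof (cases "T = 0")
  case False
  then obtain t where t: "T = ennreal t" "0 < t"
    using T_less_top by (cases T rule: ennreal_zero_top_pos_cases) auto
  define a where "a = (p - 1) / (p - q)"
  have a: "0 < a" "a < 1" "q * a + p * (1 - a) = 1" "(1 - a) / a = (1 - q) / (p - 1)"
  proof -
    have pq: "0 < p - q" "0 < p - 1" using q p by auto
    have 1: "1 - a = (1 - q) / (p - q)"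
      using pq by (simp add: a_def diff_divide_eq_iff[symmetric] field_simps)
    show "0 < a" using pq by (simp add: a_def)
    show "a < 1" using pq q by (simp add: a_def)
    have "q * a + p * (1 - a) = (q * (p - 1) + p * (1 - q)) / (p - q)"
      unfolding 1 by (simp add: a_def add_divide_distrib)
    also have "q * (p - 1) + p * (1 - q) = p - q" by (simp add: algebra_simps)
    finally show "q * a + p * (1 - a) = 1" using pq by simp
    show "(1 - a) / a = (1 - q) / (p - 1)"
      unfolding 1 using pq by (simp add: a_def)
  qed
  have "T = (\<E> \<omega>. X \<omega>)" by (simp add: X_mean)
  also have "\<dots> = (\<E> \<omega>. epow (epow (X \<omega>) q) a * epow (epow (X \<omega>) p) (1 - a))"
    using a q p by (simp add: epow_epow epow_add[symmetric])
  also have "\<dots> \<le> epow (\<E> \<omega>. epow (X \<omega>) q) a * epow (\<E> \<omega>. epow (X \<omega>) p) (1 - a)"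
    using a by (intro nn_integral_Holder) auto
  also have "\<dots> \<le> epow (\<E> \<omega>. epow (X \<omega>) q) a * epow (ennreal c * epow T p) (1 - a)"
    using a by (intro mult_left_mono epow_mono tail_X) auto
  finally have "epow T (1 / a) * epow (ennreal c * epow T p) (- ((1 - a) / a)) \<le> (\<E> \<omega>. epow (X \<omega>) q)"
    using a c t by (intro le_of_le_epow_mult) (auto simp: epow_ennreal ennreal_mult_eq_top_iff)
  also have "epow T (1 / a) * epow (ennreal c * epow T p) (- ((1 - a) / a))
      = ennreal (c powr - ((1 - q) / (p - 1))) * epow T q"
  proof -
    have "1 / a + p * - ((1 - a) / a) = q"
      using a(1,3) by (simp add: field_simps)
    then have "t powr (1 / a) * (c * t powr p) powr (- ((1 - a) / a)) = c powr (- ((1 - a) / a)) * t powr q"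
      using c t by (simp add: powr_mult powr_powr powr_add[symmetric] mult_ac)
    moreover have "ennreal c * epow T p = ennreal (c * t powr p)"
      using c t by (simp add: epow_ennreal ennreal_mult)
    moreover have "0 < c * t powr p" using c t by simp
    ultimately show ?thesis
      using t by (simp add: epow_ennreal ennreal_mult[symmetric] a(4))
  qed
  finally show ?thesis .
qed (use q in \<open>simp add: epow_0_left\<close>)

lemma lower_bound_less_1:
  assumes q: "0 < q" "q < 1" and mq: "\<And>i \<theta>. \<theta> \<in> sphere 0 1 \<Longrightarrow> moment M (\<Lambda> i \<theta>) q = ennreal mq"
  shows "ennreal (c powr - ((1 - q) / (p - 1))) * ennreal mq ^ n * epow T q \<le> (\<E> \<omega>. epow (Z \<omega>) q)"
proof -
  have "ennreal (c powr - ((1 - q) / (p - 1))) * ennreal mq ^ n * epow T q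
      \<le> ennreal mq ^ n * (\<E> \<omega>. epow (X \<omega>) q)"
    using mult_left_mono[OF X_moment_ge[OF q], of "ennreal mq ^ n"] by (simp add: mult_ac)
  also have "(\<E> \<omega>. epow (X \<omega>) q) = (\<E> \<omega>. epow (X \<omega>) (q - 1) * X \<omega>)"
  proof (rule nn_integral_cong_AE)
    have "AE \<omega> in M. X \<omega> \<noteq> \<infinity>"
      using X_mean T_less_top by (intro nn_integral_PInf_AE) auto
    then show "AE \<omega> in M. epow (X \<omega>) q = epow (X \<omega>) (q - 1) * X \<omega>"
    proof eventually_elim
      case (elim \<omega>)
      then show ?case
        using q epow_add_pos[of "X \<omega>" "q - 1" 1] by (cases "X \<omega> = 0") (auto simp: epow_0_left)
    qed
  qed
  also have "ennreal mq ^ n * \<dots> = (\<E> \<omega>. epow (X \<omega>) (q - 1) *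
      (\<integral>\<^sup>+\<theta>. epow (cascade {..<n} \<theta> \<omega>) q * cascade {n..<m} \<theta> \<omega> \<partial>\<nu>))"
    using q mq by (intro decoupled_moment[symmetric]) auto
  also have "\<dots> \<le> (\<E> \<omega>. epow (Z \<omega>) q)"
  proof (rule nn_integral_mono)
    fix \<omega> assume [measurable (raw)]: "\<omega> \<in> space M"
    show "epow (X \<omega>) (q - 1) * (\<integral>\<^sup>+\<theta>. epow (cascade {..<n} \<theta> \<omega>) q * cascade {n..<m} \<theta> \<omega> \<partial>\<nu>) \<le> epow (Z \<omega>) q"
      unfolding Z_split X_def using q by (intro nn_integral_epow_reverse_Jensen) measurable
  qed
  finally show ?thesis .
qed

text \<open>Weighting with the \<open>(q - 1)\<close>-st power of the first \<open>n\<close> factors at a fixed point \<open>y\<close> turns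
  moments of order \<open>q\<close> into expectations that are linear in \<open>Z\<close>, hence computable from two-point
  correlations. Hoelder's inequality converts them back, from above for \<open>q < 1\<close> and from below
  for \<open>q \<ge> 1\<close>.\<close>

definition W :: "'a \<Rightarrow> real \<Rightarrow> 'w \<Rightarrow> ennreal" where
  "W y e \<omega> = (\<Prod>i<n. epow (ennreal (\<Lambda> i y \<omega>)) e)"

lemma measurable_W [measurable]: "y \<in> sphere 0 1 \<Longrightarrow> W y e \<in> borel_measurable M"
  unfolding W_def[abs_def] by measurable

lemma weighted_mean:
  assumes y: "y \<in> sphere 0 1"
  shows "(\<E> \<omega>. W y e \<omega> * Z \<omega>)
           = (\<integral>\<^sup>+\<theta>. (\<Prod>i<n. correlation M (\<Lambda> i) e y \<theta>) \<partial>\<nu>)"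
proof -
  note measurable_W[OF y, measurable]
  have "(\<E> \<omega>. W y e \<omega> * Z \<omega>) = (\<E> \<omega>. \<integral>\<^sup>+\<theta>. W y e \<omega> * cascade {..<m} \<theta> \<omega> \<partial>\<nu>)"
    unfolding Z_def by (intro nn_integral_cong nn_integral_cmult[symmetric]) measurable
  also have "\<dots> = (\<integral>\<^sup>+\<theta>. (\<E> \<omega>. W y e \<omega> * cascade {..<m} \<theta> \<omega>) \<partial>\<nu>)"
    by (rule nn_integral_swap[OF \<nu> sets_\<nu>]) measurable
  also have "\<dots> = (\<integral>\<^sup>+\<theta>. (\<Prod>i<n. correlation M (\<Lambda> i) e y \<theta>) \<partial>\<nu>)"
  proof (rule nn_integral_cong)
    fix \<theta> assume "\<theta> \<in> space \<nu>"
    then have \<theta>: "\<theta> \<in> sphere 0 1" by (simp only: space_\<nu>)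
    show "(\<E> \<omega>. W y e \<omega> * cascade {..<m} \<theta> \<omega>)
        = (\<Prod>i<n. correlation M (\<Lambda> i) e y \<theta>)"
      unfolding W_def by (rule nn_integral_weighted_cascade[OF nm y \<theta> mean[OF \<theta>]])
  qed
  finally show ?thesis .
qed

lemma upper_bound_less_1:
  assumes q: "0 < q" "q < 1" and mq: "\<And>i \<theta>. \<theta> \<in> sphere 0 1 \<Longrightarrow> moment M (\<Lambda> i \<theta>) q = ennreal mq"
    and mq_pos: "0 < mq" and y: "y \<in> sphere 0 1" and D: "0 \<le> D"
    and r: "AE \<theta> in \<nu>. (\<Prod>i<n. correlation M (\<Lambda> i) (q - 1) y \<theta>)
              \<le> ennreal (D * mq ^ n)"
  shows "(\<E> \<omega>. epow (Z \<omega>) q) \<le> ennreal (D powr q) * ennreal mq ^ n * epow T q"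
proof -
  note measurable_W[OF y, measurable]
  note measurable_cascade_section[OF y, measurable]
  define F where "F \<omega> = epow (cascade {..<n} y \<omega>) q" for \<omega>
  have [measurable]: "F \<in> borel_measurable M" unfolding F_def by measurable
  have F: "(\<E> \<omega>. F \<omega>) = ennreal mq ^ n"
    using moment_cascade[OF _ y, of "{..<n}" q] q mq[OF y] by (simp add: F_def)
  have WZ: "(\<E> \<omega>. W y (q - 1) \<omega> * Z \<omega>) \<le> ennreal (D * mq ^ n) * T"
  proof -
    have "(\<E> \<omega>. W y (q - 1) \<omega> * Z \<omega>) \<le> (\<integral>\<^sup>+\<theta>. ennreal (D * mq ^ n) \<partial>\<nu>)"
      unfolding weighted_mean[OF y] using r by (rule nn_integral_mono_AE)
    then show ?thesis by (simp add: T_def)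
  qed
  have "ennreal (D * mq ^ n) * T < \<infinity>"
    using T_less_top by (simp add: ennreal_mult_less_top)
  with WZ have "(\<E> \<omega>. W y (q - 1) \<omega> * Z \<omega>) \<noteq> \<infinity>"
    by (auto simp: top_unique)
  then have "AE \<omega> in M. W y (q - 1) \<omega> * Z \<omega> \<noteq> \<infinity>"
    by (intro nn_integral_PInf_AE) auto
  then have "AE \<omega> in M. epow (Z \<omega>) q \<le> epow (F \<omega>) (1 - q) * epow (W y (q - 1) \<omega> * Z \<omega>) q"
  proof eventually_elim
    case (elim \<omega>)
    show ?case
    proof (cases "\<exists>i<n. ennreal (\<Lambda> i y \<omega>) = 0")
      case True
      \<comment> \<open>The weight is infinite, so \<open>Z\<close> must vanish.\<close>
      then have "W y (q - 1) \<omega> = \<infinity>"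
        using q by (auto simp: W_def ennreal_prod_eq_top epow_eq_0_iff epow_eq_top_iff)
      with elim have "Z \<omega> = 0" by (auto simp: ennreal_top_mult split: if_splits)
      then show ?thesis using q by (simp add: epow_0_left)
    next
      case False
      have "epow (F \<omega>) (1 - q) * epow (W y (q - 1) \<omega>) q
          = (\<Prod>i<n. epow (epow (ennreal (\<Lambda> i y \<omega>)) q) (1 - q) * epow (epow (ennreal (\<Lambda> i y \<omega>)) (q - 1)) q)"
        using q by (simp add: F_def W_def cascade_def epow_prod prod.distrib)
      also have "\<dots> = 1"
      proof (rule prod.neutral, rule ballI)
        fix i assume "i \<in> {..<n}"
        then have *: "ennreal (\<Lambda> i y \<omega>) \<noteq> 0" "ennreal (\<Lambda> i y \<omega>) \<noteq> \<infinity>" using False by auto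
        have "(q - 1) * q = - (q * (1 - q))" by (simp add: algebra_simps)
        then show "epow (epow (ennreal (\<Lambda> i y \<omega>)) q) (1 - q) * epow (epow (ennreal (\<Lambda> i y \<omega>)) (q - 1)) q = 1"
          by (simp only: epow_epow_pos[OF *] epow_cancel[OF *])
      qed
      finally show ?thesis
        using q by (simp add: epow_mult mult.assoc[symmetric])
    qed
  qed
  then have "(\<E> \<omega>. epow (Z \<omega>) q)
      \<le> (\<E> \<omega>. epow (F \<omega>) (1 - q) * epow (W y (q - 1) \<omega> * Z \<omega>) (1 - (1 - q)))"
    by (auto intro: nn_integral_mono_AE)
  also have "\<dots> \<le> epow (\<E> \<omega>. F \<omega>) (1 - q) * epow (\<E> \<omega>. W y (q - 1) \<omega> * Z \<omega>) (1 - (1 - q))"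
    using q by (intro nn_integral_Holder) auto
  also have "\<dots> \<le> epow (ennreal mq ^ n) (1 - q) * epow (ennreal (D * mq ^ n) * T) q"
    unfolding F using q WZ by (simp add: mult_left_mono epow_mono)
  also have "\<dots> = epow (ennreal D) q * (epow (ennreal mq ^ n) (1 - q) * epow (ennreal mq ^ n) q) * epow T q"
    using q D mq_pos by (simp add: ennreal_mult ennreal_power[symmetric] epow_mult mult_ac)
  also have "epow (ennreal mq ^ n) (1 - q) * epow (ennreal mq ^ n) q = ennreal mq ^ n"
    using q epow_add[of "1 - q" q "ennreal mq ^ n"] by simp
  also have "epow (ennreal D) q = ennreal (D powr q)"
    using q D by (cases "D = 0") (auto simp: epow_0_left epow_ennreal)
  finally show ?thesis .
qed

lemma lower_bound_ge_1:
  assumes q: "1 \<le> q" and mq: "\<And>i \<theta>. \<theta> \<in> sphere 0 1 \<Longrightarrow> moment M (\<Lambda> i \<theta>) q = ennreal mq"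
    and mq_pos: "0 < mq" and y: "y \<in> sphere 0 1" and D: "0 < D"
    and r: "AE \<theta> in \<nu>. ennreal (D * mq ^ n)
              \<le> (\<Prod>i<n. correlation M (\<Lambda> i) (q - 1) y \<theta>)"
  shows "ennreal (D powr q) * ennreal mq ^ n * epow T q \<le> (\<E> \<omega>. epow (Z \<omega>) q)"
proof -
  note measurable_cascade_section[OF y, measurable]
  have W: "W y (q - 1) \<omega> = epow (cascade {..<n} y \<omega>) (q - 1)" for \<omega>
    using q by (simp add: W_def cascade_def epow_prod)
  have "ennreal (D * mq ^ n) * T = (\<integral>\<^sup>+\<theta>. ennreal (D * mq ^ n) \<partial>\<nu>)"
    by (simp add: T_def)
  also have "\<dots> \<le> (\<E> \<omega>. W y (q - 1) \<omega> * Z \<omega>)"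
    unfolding weighted_mean[OF y] using r by (rule nn_integral_mono_AE)
  also have "\<dots> = (\<E> \<omega>. epow (epow (Z \<omega>) q) (1 / q) * epow (epow (cascade {..<n} y \<omega>) q) (1 - 1 / q))"
    using q by (simp add: W epow_epow algebra_simps)
  also have "\<dots> \<le> epow (\<E> \<omega>. epow (Z \<omega>) q) (1 / q)
      * epow (\<E> \<omega>. epow (cascade {..<n} y \<omega>) q) (1 - 1 / q)"
    using q by (intro nn_integral_Holder) auto
  also have "(\<E> \<omega>. epow (cascade {..<n} y \<omega>) q) = ennreal (mq ^ n)"
    using moment_cascade[OF _ y, of "{..<n}" q] q mq[OF y] mq_pos by (simp add: ennreal_power)
  finally have "epow (ennreal (D * mq ^ n) * T) (1 / (1 / q)) * epow (ennreal (mq ^ n)) (- ((1 - 1 / q) / (1 / q)))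
      \<le> (\<E> \<omega>. epow (Z \<omega>) q)"
    using q mq_pos by (intro le_of_le_epow_mult) auto
  moreover have "(1 - 1 / q) / (1 / q) = q - 1" "1 / (1 / q) = q"
    using q by (auto simp: field_simps)
  ultimately have "epow (ennreal (D * mq ^ n) * T) q * epow (ennreal (mq ^ n)) (- (q - 1)) \<le> (\<E> \<omega>. epow (Z \<omega>) q)"
    by (simp only:)
  moreover have "epow (ennreal (D * mq ^ n) * T) q * epow (ennreal (mq ^ n)) (- (q - 1))
      = ennreal (D powr q) * (epow (ennreal (mq ^ n)) q * epow (ennreal (mq ^ n)) (- (q - 1))) * epow T q"
    using q D mq_pos by (simp add: ennreal_mult epow_mult epow_ennreal mult_ac)
  moreover have "epow (ennreal (mq ^ n)) q * epow (ennreal (mq ^ n)) (- (q - 1)) = ennreal mq ^ n"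
    using epow_add_pos[of "ennreal (mq ^ n)" q "- (q - 1)"] mq_pos by (simp add: ennreal_power)
  ultimately show ?thesis by (simp only:)
qed

end

section \<open>Products of two-point correlations\<close>

text \<open>At distance \<open>b\<^sup>-\<^sup>n\<close> the first \<open>n\<close> factors see the distances \<open>b\<^sup>-\<^sup>n, \<dots>, b\<^sup>-\<^sup>1\<close>; this turns the series over
  \<open>b\<^sup>-\<^sup>i\<close> in the correlation hypotheses into bounds for products that are uniform in \<open>n\<close>.\<close>

lemma prod_reverse_powers:
  fixes g :: "real \<Rightarrow> real"
  assumes "0 < b"
  shows "(\<Prod>i<n. g (b ^ i * (1 / b ^ n))) = (\<Prod>j\<in>{1..n}. g (1 / b ^ j))"
proof -
  have "(\<Prod>j\<in>{1..n}. g (1 / b ^ j)) = (\<Prod>i<n. g (1 / b ^ (n - i)))"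
    by (rule prod.reindex_bij_witness[of _ "\<lambda>i. n - i" "\<lambda>j. n - j"]) auto
  also have "\<dots> = (\<Prod>i<n. g (b ^ i * (1 / b ^ n)))"
  proof (rule prod.cong)
    fix i assume "i \<in> {..<n}"
    then have "b ^ n = b ^ i * b ^ (n - i)" by (simp add: power_add[symmetric])
    then show "g (1 / b ^ (n - i)) = g (b ^ i * (1 / b ^ n))" using assms by simp
  qed simp
  finally show ?thesis by simp
qed

text \<open>The quotients \<open>\<rho>(b\<^sup>-\<^sup>i) / mq\<close> are at least \<open>1\<close>, as the correlation at distance \<open>0\<close> is \<open>mq\<close>. Their partial
  products are therefore bounded by the infinite product.\<close>

lemma correlation_product_le:
  fixes \<Lambda> :: "nat \<Rightarrow> 'a::euclidean_space \<Rightarrow> 'w \<Rightarrow> real" and \<rho> :: "real \<Rightarrow> real"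
  assumes b: "1 < b" and mq: "0 < mq" "\<And>i \<theta>. \<theta> \<in> sphere 0 1 \<Longrightarrow> moment M (\<Lambda> i \<theta>) q = ennreal mq"
    and q: "0 < q" "q < 1" and mono: "mono_on {0..} \<rho>"
    and two_point: "\<And>i y \<theta>. y \<in> sphere 0 1 \<Longrightarrow> \<theta> \<in> sphere 0 1 \<Longrightarrow>
           correlation M (\<Lambda> i) (q - 1) y \<theta>
             \<le> ennreal (\<rho> (b ^ i * ang_dist y \<theta>))"
    and summable: "summable (\<lambda>i. ln (\<rho> (1 / b ^ i) / mq))"
  obtains D where "0 < D"
    "\<And>n y \<theta>. y \<in> sphere 0 1 \<Longrightarrow> \<theta> \<in> cap (1 / b ^ n) y \<Longrightarrow>
       (\<Prod>i<n. correlation M (\<Lambda> i) (q - 1) y \<theta>)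
         \<le> ennreal (D * mq ^ n)"
proof -
  define f where "f i = \<rho> (1 / b ^ i) / mq" for i :: nat
  have \<rho>_le: "\<rho> s \<le> \<rho> t" if "0 \<le> s" "s \<le> t" for s t
    using mono that by (auto simp: monotone_on_def)
  obtain e :: 'a where e: "e \<in> sphere 0 1"
    by (metis norm_Basis mem_sphere_0 nonempty_Basis ex_in_conv)
  have "ennreal mq = correlation M (\<Lambda> 0) (q - 1) e e"
  proof -
    have "epow x q = epow x (q - 1) * x" if "x \<noteq> \<infinity>" for x
      using q epow_add_pos[of x "q - 1" 1] that by (cases "x = 0") (auto simp: epow_0_left)
    then show ?thesis
      using mq(2)[OF e, of 0] by (simp add: moment_def correlation_def)
  qed
  also have "\<dots> \<le> ennreal (\<rho> 0)"
    using two_point[OF e e, of 0] e by (simp add: ang_dist_self)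
  finally have "mq \<le> \<rho> 0"
    using mq(1) by (cases "0 \<le> \<rho> 0") (auto simp: ennreal_neg)
  then have \<rho>_ge: "mq \<le> \<rho> t" if "0 \<le> t" for t
    using \<rho>_le[of 0 t] that by simp
  have f1: "1 \<le> f i" for i
    using \<rho>_ge[of "1 / b ^ i"] b mq(1) by (simp add: f_def)
  define D where "D = exp (\<Sum>i. ln (f i))"
  show thesis
  proof
    show "0 < D" by (simp add: D_def)
    fix n and y \<theta> :: 'a assume y: "y \<in> sphere 0 1" and \<theta>: "\<theta> \<in> cap (1 / b ^ n) y"
    then have \<theta>S: "\<theta> \<in> sphere 0 1" and ang: "ang_dist y \<theta> \<le> 1 / b ^ n"
      by (auto simp: cap_def ang_dist_commute)
    have "(\<Prod>i<n. correlation M (\<Lambda> i) (q - 1) y \<theta>)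
        \<le> (\<Prod>i<n. ennreal (\<rho> (b ^ i * (1 / b ^ n))))"
    proof (rule prod_mono_ennreal)
      fix i
      have "0 \<le> ang_dist y \<theta>" using y \<theta>S by (intro ang_dist_nonneg) auto
      then have "\<rho> (b ^ i * ang_dist y \<theta>) \<le> \<rho> (b ^ i * (1 / b ^ n))"
        using b ang by (intro \<rho>_le mult_left_mono mult_nonneg_nonneg) auto
      then show "correlation M (\<Lambda> i) (q - 1) y \<theta>
          \<le> ennreal (\<rho> (b ^ i * (1 / b ^ n)))"
        using order_trans[OF two_point[OF y \<theta>S] ennreal_leI] by blast
    qed
    also have "\<dots> = ennreal (\<Prod>i<n. \<rho> (b ^ i * (1 / b ^ n)))"
    proof (rule prod_ennreal)
      fix i
      show "0 \<le> \<rho> (b ^ i * (1 / b ^ n))"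
        using \<rho>_ge[of "b ^ i * (1 / b ^ n)"] mq(1) b by simp
    qed
    also have "(\<Prod>i<n. \<rho> (b ^ i * (1 / b ^ n))) = (\<Prod>j\<in>{1..n}. f j * mq)"
      using b mq(1) by (subst prod_reverse_powers) (auto simp: f_def)
    also have "\<dots> = (\<Prod>j\<in>{1..n}. f j) * mq ^ n" by (simp add: prod.distrib)
    also have "\<dots> \<le> D * mq ^ n"
      unfolding D_def using f1 summable mq(1)
      by (intro mult_right_mono prod_le_exp_suminf_ln) (auto simp: f_def)
    finally show "(\<Prod>i<n. correlation M (\<Lambda> i) (q - 1) y \<theta>)
         \<le> ennreal (D * mq ^ n)"
      by (simp add: ennreal_leI)
  qed
qed

text \<open>A lower bound for the correlation of the powers \<open>a\<close> and \<open>q - a\<close> implies one for the powers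
  \<open>1\<close> and \<open>q - 1\<close>: if \<open>a \<le> 1\<close> the pair \<open>(a, q - a)\<close> lies between \<open>(1, q - 1)\<close> and \<open>(0, q)\<close>,
  otherwise between \<open>(1, q - 1)\<close> and \<open>(q, 0)\<close>.\<close>

definition interpolation_weight :: "real \<Rightarrow> real \<Rightarrow> real" where
  "interpolation_weight q a = (if a \<le> 1 then a else (q - a) / (q - 1))"

lemma interpolation_weight_bounds:
  assumes "0 < a" "2 * a \<le> q"
  shows "0 < interpolation_weight q a" "interpolation_weight q a \<le> 1"
  using assms by (auto simp: interpolation_weight_def field_simps)

lemma correlation_interpolation:
  assumes a: "0 < a" "2 * a \<le> q" and q: "1 \<le> q"
    and [measurable]: "U \<in> borel_measurable N" "V \<in> borel_measurable N"
    and B: "(\<integral>\<^sup>+x. epow (U x) q \<partial>N) = B" "(\<integral>\<^sup>+x. epow (V x) q \<partial>N) = B"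
  shows "(\<integral>\<^sup>+x. epow (U x) a * epow (V x) (q - a) \<partial>N)
           \<le> epow (\<integral>\<^sup>+x. epow (V x) (q - 1) * U x \<partial>N) (interpolation_weight q a)
               * epow B (1 - interpolation_weight q a)"
proof (cases "a \<le> 1")
  case True
  have "epow (U x) a * epow (V x) (q - a) = epow (epow (V x) (q - 1) * U x) a * epow (epow (V x) q) (1 - a)" for x
  proof -
    have "q - a = (q - 1) * a + q * (1 - a)" by (simp add: algebra_simps)
    moreover have "epow (V x) ((q - 1) * a + q * (1 - a)) = epow (V x) ((q - 1) * a) * epow (V x) (q * (1 - a))"
      using True a q by (intro epow_add) auto
    ultimately show ?thesis
      using True a q by (simp add: epow_mult epow_epow mult_ac)
  qed
  then have "(\<integral>\<^sup>+x. epow (U x) a * epow (V x) (q - a) \<partial>N)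
      \<le> epow (\<integral>\<^sup>+x. epow (V x) (q - 1) * U x \<partial>N) a * epow (\<integral>\<^sup>+x. epow (V x) q \<partial>N) (1 - a)"
    using True a by (simp add: nn_integral_Holder)
  then show ?thesis
    using True by (simp add: B interpolation_weight_def)
next
  case False
  then have q1: "1 < q" "a \<le> q" using a by auto
  define w where "w = interpolation_weight q a"
  have w01: "0 < w" "w \<le> 1" using interpolation_weight_bounds[OF a] by (auto simp: w_def)
  have "(q - 1) * w = q - a" using q1 False by (simp add: w_def interpolation_weight_def)
  then have w: "(q - 1) * w = q - a" "w + q * (1 - w) = a" by (auto simp: algebra_simps)
  have "epow (U x) a * epow (V x) (q - a) = epow (epow (V x) (q - 1) * U x) w * epow (epow (U x) q) (1 - w)" for x
  proof -
    have "epow (U x) a = epow (U x) w * epow (U x) (q * (1 - w))"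
      using w01 q1 epow_add[of w "q * (1 - w)" "U x"] by (simp add: w(2))
    then show ?thesis
      using w w01 q1 by (simp add: epow_mult epow_epow mult_ac)
  qed
  then have "(\<integral>\<^sup>+x. epow (U x) a * epow (V x) (q - a) \<partial>N)
      \<le> epow (\<integral>\<^sup>+x. epow (V x) (q - 1) * U x \<partial>N) w * epow (\<integral>\<^sup>+x. epow (U x) q \<partial>N) (1 - w)"
    using w01 by (simp add: nn_integral_Holder)
  then show ?thesis by (simp add: B w_def)
qed

lemma strongly_isotropic_correlation:
  fixes \<Lambda> :: "real ^ 'n \<Rightarrow> 'w \<Rightarrow> real"
  assumes iso: "strongly_isotropic M \<Lambda>" and Q: "rotation_matrix Q"
    and meas: "\<And>\<theta>. \<theta> \<in> sphere 0 1 \<Longrightarrow> \<Lambda> \<theta> \<in> borel_measurable M"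
    and y: "y \<in> sphere 0 1" and \<theta>: "\<theta> \<in> sphere 0 1"
  shows "correlation M \<Lambda> e (Q *v y) (Q *v \<theta>) = correlation M \<Lambda> e y \<theta>"
proof -
  define t where "t j = (if j = 0 then y else \<theta>)" for j :: nat
  have t: "t j \<in> sphere 0 1" for j using y \<theta> by (simp add: t_def)
  have orth: "orthogonal_matrix Q" using Q by (simp add: rotation_matrix_def)
  have Qs: "Q *v x \<in> sphere 0 1" if "x \<in> sphere 0 1" for x
  proof -
    have "orthogonal_transformation ((*v) Q)"
      using orth by (simp add: orthogonal_transformation_matrix)
    then show ?thesis using that by (simp add: orthogonal_transformation)
  qed
  define F where "F x = epow (ennreal (x 0)) e * ennreal (x (1::nat))" for x :: "nat \<Rightarrow> real"
  have F: "F \<in> borel_measurable (PiM {..<2} (\<lambda>_. borel))"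
    unfolding F_def[abs_def] by measurable
  have m: "(\<lambda>\<omega>. \<lambda>j\<in>{..<2}. \<Lambda> (s j) \<omega>) \<in> measurable M (PiM {..<2::nat} (\<lambda>_. borel))"
    if "\<And>j. s j \<in> sphere 0 1" for s
    by (intro measurable_restrict meas that)
  have int: "(\<integral>\<^sup>+x. F x \<partial>distr M (PiM {..<2} (\<lambda>_. borel)) (\<lambda>\<omega>. \<lambda>j\<in>{..<2}. \<Lambda> (s j) \<omega>))
      = correlation M \<Lambda> e (s 0) (s 1)"
    if "\<And>j. s j \<in> sphere 0 1" for s
    using F by (subst nn_integral_distr[OF m[OF that]]) (simp_all add: F_def correlation_def)
  have "distr M (PiM {..<2} (\<lambda>_. borel)) (\<lambda>\<omega>. \<lambda>j\<in>{..<2}. \<Lambda> (Q *v t j) \<omega>)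
      = distr M (PiM {..<2} (\<lambda>_. borel)) (\<lambda>\<omega>. \<lambda>j\<in>{..<2}. \<Lambda> (t j) \<omega>)"
    using iso Q t unfolding strongly_isotropic_def by blast
  then have "correlation M \<Lambda> e (Q *v t 0) (Q *v t 1) = correlation M \<Lambda> e (t 0) (t 1)"
    using int[of t, OF t] int[of "\<lambda>j. Q *v t j", OF Qs[OF t]] by simp
  then show ?thesis by (simp add: t_def)
qed

text \<open>The hypothesis concerns the vicinity of the point \<open>\<theta>'\<close>; a rotation brings \<open>y\<close> there. Placing one of the
  \<open>k\<close> points at the image of \<open>\<theta>\<close> and all others at \<open>\<theta>'\<close> leaves a correlation of the powers \<open>q / k\<close> and
  \<open>q - q / k\<close>, to which interpolation applies. Here the quotients \<open>mq / \<upsilon>(b\<^sup>-\<^sup>i)\<close> are at least \<open>1\<close>.\<close>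

lemma correlation_product_ge:
  fixes \<Lambda> :: "nat \<Rightarrow> real ^ 'n \<Rightarrow> 'w \<Rightarrow> real" and \<upsilon> :: "real \<Rightarrow> real"
  assumes dim: "2 \<le> CARD('n)" and b: "1 < b"
    and mq: "0 < mq" "\<And>i \<theta>. \<theta> \<in> sphere 0 1 \<Longrightarrow> moment M (\<Lambda> i \<theta>) q = ennreal mq"
    and q: "1 \<le> q" and iso: "\<And>i. strongly_isotropic M (\<Lambda> i)"
    and meas: "\<And>i \<theta>. \<theta> \<in> sphere 0 1 \<Longrightarrow> \<Lambda> i \<theta> \<in> borel_measurable M"
    and \<theta>': "\<theta>' \<in> sphere 0 1" and k: "2 \<le> k"
    and mono: "antimono_on {0..} \<upsilon>" and pos: "\<And>t. 0 \<le> t \<Longrightarrow> 0 < \<upsilon> t"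
    and k_point: "\<And>i x \<theta>. 0 \<le> x \<Longrightarrow> x \<le> pi \<Longrightarrow> (\<And>j. j < k \<Longrightarrow> \<theta> j \<in> cap x \<theta>') \<Longrightarrow>
           ennreal (\<upsilon> (b ^ i * x)) \<le> (\<integral>\<^sup>+\<omega>. (\<Prod>j<k. epow (ennreal (\<Lambda> i (\<theta> j) \<omega>)) (q / real k)) \<partial>M)"
    and summable: "summable (\<lambda>i. ln (mq / \<upsilon> (1 / b ^ i)))"
  obtains D where "0 < D"
    "\<And>n y \<theta>. y \<in> sphere 0 1 \<Longrightarrow> \<theta> \<in> cap (1 / b ^ n) y \<Longrightarrow>
       ennreal (D * mq ^ n)
         \<le> (\<Prod>i<n. correlation M (\<Lambda> i) (q - 1) y \<theta>)"
proof -
  define f where "f i = mq / \<upsilon> (1 / b ^ i)" for i :: nat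
  define a where "a = q / real k"
  have a: "0 < a" "2 * a \<le> q" "real k * a = q"
    using q k by (auto simp: a_def field_simps)
  define w where "w = interpolation_weight q a"
  have w: "0 < w" "w \<le> 1"
    using interpolation_weight_bounds[OF a(1,2)] by (auto simp: w_def)
  have self: "\<theta>' \<in> cap x \<theta>'" if "0 \<le> x" for x
    using \<theta>' that by (simp add: cap_def ang_dist_self)
  have \<upsilon>_le: "\<upsilon> t \<le> mq" if "0 \<le> t" for t
  proof -
    have "ennreal (\<upsilon> 0) \<le> (\<integral>\<^sup>+\<omega>. (\<Prod>j<k. epow (ennreal (\<Lambda> 0 \<theta>' \<omega>)) (q / real k)) \<partial>M)"
      using k_point[of 0 "\<lambda>_. \<theta>'" 0] self[of 0] by simp
    also have "\<dots> = moment M (\<Lambda> 0 \<theta>') q"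
    proof -
      have "(\<Prod>j<k. epow x (q / real k)) = epow x q" for x
        using q k epow_sum_right[of "{..<k}" "\<lambda>_. q / real k" x] by simp
      then show ?thesis by (simp only: moment_def)
    qed
    finally have "\<upsilon> 0 \<le> mq" using mq \<theta>' by (simp add: ennreal_le_iff)
    moreover have "\<upsilon> t \<le> \<upsilon> 0" using mono that by (auto simp: monotone_on_def)
    ultimately show ?thesis by simp
  qed
  have f1: "1 \<le> f i" for i
    using \<upsilon>_le[of "1 / b ^ i"] pos[of "1 / b ^ i"] b by (simp add: f_def)
  define E where "E = exp (\<Sum>i. ln (f i))"
  have E: "0 < E" by (simp add: E_def)
  show thesis
  proof (rule that[of "(1 / E) powr (1 / w)"])
    show "0 < (1 / E) powr (1 / w)" using E by simp
    fix n and y \<theta> :: "real ^ 'n" assume y: "y \<in> sphere 0 1" and \<theta>: "\<theta> \<in> cap (1 / b ^ n) y"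
    then have \<theta>S: "\<theta> \<in> sphere 0 1" and ang: "ang_dist \<theta> y \<le> 1 / b ^ n"
      by (auto simp: cap_def)
    obtain h where h: "orthogonal_transformation h" "det (matrix h) = 1" "h y = \<theta>'"
      using rotation_exists[OF dim, of y \<theta>'] y \<theta>' by auto
    define Q where "Q = matrix h"
    have Qh: "Q *v x = h x" for x
      using h(1) by (simp add: Q_def orthogonal_transformation matrix_works)
    have Q: "rotation_matrix Q"
      using h(1,2) by (simp add: rotation_matrix_def Q_def orthogonal_transformation_matrix)
    have hs: "h \<theta> \<in> sphere 0 1"
      using h(1) \<theta>S by (simp add: orthogonal_transformation)
    have "ang_dist (h \<theta>) (h y) = ang_dist \<theta> y"
      using h(1) by (simp add: ang_dist_def orthogonal_transformation_def)
    then have hcap: "h \<theta> \<in> cap (1 / b ^ n) \<theta>'"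
      using ang hs h(3) by (simp add: cap_def)
    have n1: "0 \<le> 1 / b ^ n" "1 / b ^ n \<le> pi"
    proof -
      have "1 / b ^ n \<le> 1" using b by simp
      then show "1 / b ^ n \<le> pi" using pi_gt3 by linarith
    qed (use b in simp)
    have factor: "ennreal (mq * (\<upsilon> (b ^ i * (1 / b ^ n)) / mq) powr (1 / w))
        \<le> correlation M (\<Lambda> i) (q - 1) y \<theta>" for i
    proof -
      let ?u = "\<upsilon> (b ^ i * (1 / b ^ n))"
      have u: "0 < ?u" using b by (intro pos) auto
      define t where "t j = (if j = 0 then h \<theta> else \<theta>')" for j :: nat
      have "ennreal ?u \<le> (\<integral>\<^sup>+\<omega>. (\<Prod>j<k. epow (ennreal (\<Lambda> i (t j) \<omega>)) (q / real k)) \<partial>M)"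
        using n1 hcap self by (intro k_point) (auto simp: t_def)
      also have "\<dots> = (\<integral>\<^sup>+\<omega>. epow (ennreal (\<Lambda> i (h \<theta>) \<omega>)) a * epow (ennreal (\<Lambda> i \<theta>' \<omega>)) (q - a) \<partial>M)"
      proof (rule nn_integral_cong)
        fix \<omega>
        obtain k' where k': "k = Suc k'" using k by (cases k) auto
        have "(\<Prod>j<k. epow (ennreal (\<Lambda> i (t j) \<omega>)) (q / real k))
            = epow (ennreal (\<Lambda> i (h \<theta>) \<omega>)) a * (\<Prod>j<k'. epow (ennreal (\<Lambda> i \<theta>' \<omega>)) a)"
          unfolding k' by (simp add: prod.lessThan_Suc_shift t_def a_def k' del: prod.lessThan_Suc)
        also have "(\<Prod>j<k'. epow (ennreal (\<Lambda> i \<theta>' \<omega>)) a) = epow (ennreal (\<Lambda> i \<theta>' \<omega>)) (\<Sum>j<k'. a)"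
          using a(1) by (intro epow_sum_right) auto
        also have "(\<Sum>j<k'. a) = q - a" using a(3) by (simp add: k' algebra_simps)
        finally show "(\<Prod>j<k. epow (ennreal (\<Lambda> i (t j) \<omega>)) (q / real k))
            = epow (ennreal (\<Lambda> i (h \<theta>) \<omega>)) a * epow (ennreal (\<Lambda> i \<theta>' \<omega>)) (q - a)" .
      qed
      also have "\<dots> \<le> epow (correlation M (\<Lambda> i) (q - 1) \<theta>' (h \<theta>)) w
          * epow (ennreal mq) (1 - w)"
        unfolding w_def correlation_def using mq(2) \<theta>' hs meas
        by (intro correlation_interpolation a(1,2) q)
          (simp_all only: moment_def[symmetric] measurable_compose[OF _ measurable_ennreal])
      also have "correlation M (\<Lambda> i) (q - 1) \<theta>' (h \<theta>)
          = correlation M (\<Lambda> i) (q - 1) y \<theta>"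
        using strongly_isotropic_correlation[OF iso Q meas y \<theta>S] h(3) by (simp add: Qh)
      finally have "epow (ennreal ?u) (1 / w) * epow (ennreal mq) (- ((1 - w) / w))
          \<le> correlation M (\<Lambda> i) (q - 1) y \<theta>"
        using w mq(1) by (intro le_of_le_epow_mult) auto
      moreover have "epow (ennreal ?u) (1 / w) * epow (ennreal mq) (- ((1 - w) / w))
          = ennreal (?u powr (1 / w) * mq powr (- ((1 - w) / w)))"
        using u mq(1) by (simp add: epow_ennreal ennreal_mult)
      moreover have "?u powr (1 / w) * mq powr (- ((1 - w) / w)) = mq * (?u / mq) powr (1 / w)"
      proof -
        have "- ((1 - w) / w) = 1 + - (1 / w)" using w by (simp add: field_simps)
        then have "mq powr (- ((1 - w) / w)) = mq * mq powr (- (1 / w))"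
          using mq(1) by (simp only: powr_add) simp
        then show ?thesis
          using u mq(1) by (simp add: powr_divide powr_minus_divide)
      qed
      ultimately show ?thesis by simp
    qed
    have "(\<Prod>i<n. \<upsilon> (b ^ i * (1 / b ^ n)) / mq) = 1 / (\<Prod>j\<in>{1..n}. f j)"
      using b by (subst prod_reverse_powers[of b "\<lambda>x. \<upsilon> x / mq"])
        (simp_all add: f_def prod_dividef)
    moreover have "(\<Prod>j\<in>{1..n}. f j) \<le> E"
      unfolding E_def using f1 summable by (intro prod_le_exp_suminf_ln) (auto simp: f_def)
    moreover have "1 \<le> (\<Prod>j\<in>{1..n}. f j)"
      using f1 by (intro prod_ge_1) auto
    ultimately have "1 / E \<le> (\<Prod>i<n. \<upsilon> (b ^ i * (1 / b ^ n)) / mq)"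
      by (auto intro!: divide_left_mono mult_pos_pos)
    then have "(1 / E) powr (1 / w) \<le> (\<Prod>i<n. \<upsilon> (b ^ i * (1 / b ^ n)) / mq) powr (1 / w)"
      using w E by (intro powr_mono2) auto
    also have "\<dots> = (\<Prod>i<n. (\<upsilon> (b ^ i * (1 / b ^ n)) / mq) powr (1 / w))"
      by (rule prod_powr_distrib)
    finally have "(1 / E) powr (1 / w) * mq ^ n
        \<le> (\<Prod>i<n. (\<upsilon> (b ^ i * (1 / b ^ n)) / mq) powr (1 / w)) * mq ^ n"
      using mq(1) by (intro mult_right_mono) auto
    also have "\<dots> = (\<Prod>i<n. mq * (\<upsilon> (b ^ i * (1 / b ^ n)) / mq) powr (1 / w))"
      by (simp add: prod.distrib)
    finally have "ennreal ((1 / E) powr (1 / w) * mq ^ n)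
        \<le> ennreal (\<Prod>i<n. mq * (\<upsilon> (b ^ i * (1 / b ^ n)) / mq) powr (1 / w))"
      by (rule ennreal_leI)
    also have "\<dots> = (\<Prod>i<n. ennreal (mq * (\<upsilon> (b ^ i * (1 / b ^ n)) / mq) powr (1 / w)))"
      using mq(1) by (intro prod_ennreal[symmetric]) auto
    also have "\<dots> \<le> (\<Prod>i<n. correlation M (\<Lambda> i) (q - 1) y \<theta>)"
      by (intro prod_mono_ennreal factor)
    finally show "ennreal ((1 / E) powr (1 / w) * mq ^ n)
        \<le> (\<Prod>i<n. correlation M (\<Lambda> i) (q - 1) y \<theta>)" .
  qed
qed


section \<open>Passage to the limiting measure\<close>

lemma powr_le_powr_add_powr_diff:
  fixes x y q :: real
  assumes "0 \<le> x" "0 \<le> y" "0 < q"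
  shows "x powr q \<le> 2 powr q * (y powr q + \<bar>x - y\<bar> powr q)"
proof -
  define z where "z = max y \<bar>x - y\<bar>"
  have "x \<le> 2 * z" unfolding z_def by (simp add: max_def abs_if)
  then have "x powr q \<le> (2 * z) powr q"
    using assms by (intro powr_mono2) auto
  also have "\<dots> = 2 powr q * z powr q"
    using assms by (simp add: powr_mult z_def)
  also have "z powr q \<le> y powr q + \<bar>x - y\<bar> powr q"
    by (auto simp: z_def max_def)
  finally show ?thesis by simp
qed

text \<open>Moments of order \<open>q \<le> p\<close> of an \<open>L\<^sub>p\<close>-limit are comparable with the moments of the
  approximants; the factor \<open>2 powr q\<close> disappears on the logarithmic scale.\<close>

lemma (in prob_space) Lp_limit_moment:
  fixes Y :: "nat \<Rightarrow> 'a \<Rightarrow> real"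
  assumes [measurable]: "\<And>n. Y n \<in> borel_measurable M" "Y0 \<in> borel_measurable M"
    and nonneg: "\<And>n \<omega>. 0 \<le> Y n \<omega>" "\<And>\<omega>. 0 \<le> Y0 \<omega>"
    and lim: "(\<lambda>n. \<integral>\<^sup>+\<omega>. ennreal (\<bar>Y n \<omega> - Y0 \<omega>\<bar> powr p) \<partial>M) \<longlonglongrightarrow> 0"
    and q: "0 < q" "q \<le> p"
  shows Lp_limit_moment_le: "(\<And>n. N \<le> n \<Longrightarrow> (\<integral>\<^sup>+\<omega>. ennreal (Y n \<omega> powr q) \<partial>M) \<le> K) \<Longrightarrow>
           (\<integral>\<^sup>+\<omega>. ennreal (Y0 \<omega> powr q) \<partial>M) \<le> ennreal (2 powr q) * K"
    and Lp_limit_moment_ge: "(\<And>n. N \<le> n \<Longrightarrow> K \<le> (\<integral>\<^sup>+\<omega>. ennreal (Y n \<omega> powr q) \<partial>M)) \<Longrightarrow>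
           K \<le> ennreal (2 powr q) * (\<integral>\<^sup>+\<omega>. ennreal (Y0 \<omega> powr q) \<partial>M)"
proof -
  let ?d = "\<lambda>n. \<integral>\<^sup>+\<omega>. ennreal (\<bar>Y n \<omega> - Y0 \<omega>\<bar> powr q) \<partial>M"
  have powr_epow: "ennreal (x powr r) = epow (ennreal x) r" if "0 \<le> x" "0 < r" for x r
    using that by (cases "x = 0") (auto simp: epow_0_left epow_ennreal)
  have close: "\<exists>n\<ge>N. ?d n \<le> ennreal e" if e: "0 < e" for e
  proof -
    have "eventually (\<lambda>n. (\<integral>\<^sup>+\<omega>. ennreal (\<bar>Y n \<omega> - Y0 \<omega>\<bar> powr p) \<partial>M) < ennreal (e powr (p / q))) sequentially"
      using e by (intro order_tendstoD(2)[OF lim]) simp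
    then have "eventually (\<lambda>n. N \<le> n \<and> (\<integral>\<^sup>+\<omega>. ennreal (\<bar>Y n \<omega> - Y0 \<omega>\<bar> powr p) \<partial>M) < ennreal (e powr (p / q))) sequentially"
      using eventually_ge_at_top[of N] by (rule eventually_conj[rotated])
    then obtain n where n: "N \<le> n"
      "(\<integral>\<^sup>+\<omega>. ennreal (\<bar>Y n \<omega> - Y0 \<omega>\<bar> powr p) \<partial>M) < ennreal (e powr (p / q))"
      by (auto simp: eventually_sequentially)
    have "?d n = (\<integral>\<^sup>+\<omega>. epow (ennreal \<bar>Y n \<omega> - Y0 \<omega>\<bar>) q \<partial>M)"
      using q by (simp add: powr_epow)
    also have "\<dots> \<le> epow (\<integral>\<^sup>+\<omega>. epow (ennreal \<bar>Y n \<omega> - Y0 \<omega>\<bar>) p \<partial>M) (q / p)"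
      using q by (intro nn_integral_epow_Lyapunov) auto
    also have "\<dots> \<le> epow (ennreal (e powr (p / q))) (q / p)"
      using n(2) q by (intro epow_mono) (auto simp: powr_epow)
    also have "\<dots> = ennreal e"
      using e q by (simp add: epow_ennreal powr_powr)
    finally show ?thesis using n(1) by blast
  qed
  have dom: "(\<integral>\<^sup>+\<omega>. ennreal (U \<omega> powr q) \<partial>M)
      \<le> ennreal (2 powr q) * ((\<integral>\<^sup>+\<omega>. ennreal (V \<omega> powr q) \<partial>M) + (\<integral>\<^sup>+\<omega>. ennreal (\<bar>U \<omega> - V \<omega>\<bar> powr q) \<partial>M))"
    if [measurable]: "U \<in> borel_measurable M" "V \<in> borel_measurable M"
      and "\<And>\<omega>. 0 \<le> U \<omega>" "\<And>\<omega>. 0 \<le> V \<omega>" for U V :: "'a \<Rightarrow> real"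
  proof -
    have "(\<integral>\<^sup>+\<omega>. ennreal (U \<omega> powr q) \<partial>M)
        \<le> (\<integral>\<^sup>+\<omega>. ennreal (2 powr q) * (ennreal (V \<omega> powr q) + ennreal (\<bar>U \<omega> - V \<omega>\<bar> powr q)) \<partial>M)"
    proof (rule nn_integral_mono)
      fix \<omega>
      show "ennreal (U \<omega> powr q) \<le> ennreal (2 powr q) * (ennreal (V \<omega> powr q) + ennreal (\<bar>U \<omega> - V \<omega>\<bar> powr q))"
        using powr_le_powr_add_powr_diff[of "U \<omega>" "V \<omega>" q] that(3,4) q
        by (simp add: ennreal_plus[symmetric] ennreal_mult[symmetric] ennreal_leI del: ennreal_plus)
    qed
    then show ?thesis
      by (simp add: nn_integral_cmult nn_integral_add)
  qed
  have limit: "a \<le> ennreal (2 powr q) * c" if a: "\<And>n. N \<le> n \<Longrightarrow> a \<le> ennreal (2 powr q) * (c + ?d n)" for a c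
  proof (rule ennreal_le_epsilon)
    fix e :: real assume e: "0 < e"
    then obtain n where n: "N \<le> n" "?d n \<le> ennreal (e / 2 powr q)"
      using close[of "e / 2 powr q"] by auto
    have "a \<le> ennreal (2 powr q) * (c + ennreal (e / 2 powr q))"
      using order_trans[OF a[OF n(1)] mult_left_mono[OF add_left_mono[OF n(2)]]] by simp
    also have "\<dots> = ennreal (2 powr q) * c + ennreal e"
      using e by (simp add: distrib_left ennreal_mult[symmetric])
    finally show "a \<le> ennreal (2 powr q) * c + ennreal e" .
  qed
  show "(\<integral>\<^sup>+\<omega>. ennreal (Y0 \<omega> powr q) \<partial>M) \<le> ennreal (2 powr q) * K"
    if K: "\<And>n. N \<le> n \<Longrightarrow> (\<integral>\<^sup>+\<omega>. ennreal (Y n \<omega> powr q) \<partial>M) \<le> K"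
  proof (rule limit)
    fix n assume "N \<le> n"
    have "(\<integral>\<^sup>+\<omega>. ennreal (Y0 \<omega> powr q) \<partial>M) \<le> ennreal (2 powr q) * ((\<integral>\<^sup>+\<omega>. ennreal (Y n \<omega> powr q) \<partial>M) + ?d n)"
      using dom[of Y0 "Y n"] nonneg by (simp add: abs_minus_commute)
    also have "\<dots> \<le> ennreal (2 powr q) * (K + ?d n)"
      using K[OF \<open>N \<le> n\<close>] by (intro mult_left_mono add_right_mono) auto
    finally show "(\<integral>\<^sup>+\<omega>. ennreal (Y0 \<omega> powr q) \<partial>M) \<le> ennreal (2 powr q) * (K + ?d n)" .
  qed
  show "K \<le> ennreal (2 powr q) * (\<integral>\<^sup>+\<omega>. ennreal (Y0 \<omega> powr q) \<partial>M)"
    if K: "\<And>n. N \<le> n \<Longrightarrow> K \<le> (\<integral>\<^sup>+\<omega>. ennreal (Y n \<omega> powr q) \<partial>M)"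
  proof (rule limit)
    fix n assume "N \<le> n"
    then show "K \<le> ennreal (2 powr q) * ((\<integral>\<^sup>+\<omega>. ennreal (Y0 \<omega> powr q) \<partial>M) + ?d n)"
      using order_trans[OF K dom[of "Y n" Y0]] nonneg by simp
  qed
qed

lemma emeasure_surface_measure_finite: "emeasure surface_measure (B :: 'a::euclidean_space set) < \<infinity>"
proof -
  interpret finite_measure "surface_measure :: 'a measure" by (rule finite_measure_surface_measure)
  show ?thesis by (simp add: less_top[symmetric])
qed

context random_cascade
begin

definition cell_measure :: "'a set \<Rightarrow> 'a measure" where
  "cell_measure B = density surface_measure (indicator B)"

lemma sets_cell_measure [simp, measurable_cong]: "sets (cell_measure B) = sets sphere_borel"
  by (simp add: cell_measure_def)

lemma emeasure_cell_measure:
  "A \<in> sets sphere_borel \<Longrightarrow> B \<in> sets sphere_borel \<Longrightarrow>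
     emeasure (cell_measure B) A = emeasure surface_measure (B \<inter> A)"
  by (simp add: cell_measure_def emeasure_restricted)

lemma emeasure_cell_measure_space:
  assumes "B \<in> sets sphere_borel"
  shows "emeasure (cell_measure B) (space (cell_measure B)) = emeasure surface_measure B"
proof -
  have "B \<subseteq> space sphere_borel" using assms by (rule sets.sets_into_space)
  then have "B \<inter> space (cell_measure B) = B"
    by (auto simp: cell_measure_def space_restrict_space)
  then show ?thesis
    using emeasure_cell_measure[of "space (cell_measure B)" B] assms sets.top[of "cell_measure B"] by simp
qed

lemma finite_measure_cell_measure: "B \<in> sets sphere_borel \<Longrightarrow> finite_measure (cell_measure B)"
  using emeasure_surface_measure_finite[of B]
  by (intro finite_measureI) (simp add: emeasure_cell_measure_space)

lemma limiting_mass_moment: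
  assumes mean: "\<And>i \<theta>. \<theta> \<in> sphere 0 1 \<Longrightarrow> moment M (\<Lambda> i \<theta>) 1 = 1"
    and nonneg: "\<And>i. AE \<omega> in M. \<forall>\<theta>\<in>sphere 0 1. 0 \<le> \<Lambda> i \<theta> \<omega>"
    and limit: "limiting_measure M \<Lambda> p \<mu>"
    and B: "B \<in> sets sphere_borel" and q: "0 < q" "q \<le> p"
  shows limiting_mass_moment_le:
      "(\<And>m. n \<le> m \<Longrightarrow> (\<E> \<omega>. epow (\<integral>\<^sup>+\<theta>. cascade {..<m} \<theta> \<omega> \<partial>cell_measure B) q) \<le> K) \<Longrightarrow>
         (\<E> \<omega>. epow (emeasure (\<mu> \<omega>) B) q) \<le> ennreal (2 powr q) * K"
    and limiting_mass_moment_ge: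
      "(\<And>m. n \<le> m \<Longrightarrow> K \<le> (\<E> \<omega>. epow (\<integral>\<^sup>+\<theta>. cascade {..<m} \<theta> \<omega> \<partial>cell_measure B) q)) \<Longrightarrow>
         K \<le> ennreal (2 powr q) * (\<E> \<omega>. epow (emeasure (\<mu> \<omega>) B) q)"
proof -
  note B[measurable]
  interpret \<sigma>: finite_measure "surface_measure :: 'a measure" by (rule finite_measure_surface_measure)
  interpret \<nu>: finite_measure "cell_measure B" by (rule finite_measure_cell_measure[OF B])
  define Z where "Z m \<omega> = (\<integral>\<^sup>+\<theta>. cascade {..<m} \<theta> \<omega> \<partial>cell_measure B)" for m \<omega>
  define Y where "Y m \<omega> = measure (product_measure \<Lambda> m \<omega>) B" for m \<omega>
  define Y0 where "Y0 \<omega> = measure (\<mu> \<omega>) B" for \<omega>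
  have powr_epow: "ennreal (x powr q) = epow (ennreal x) q" if "0 \<le> x" for x
    using that q by (cases "x = 0") (auto simp: epow_0_left epow_ennreal)
  have [measurable]: "Z m \<in> borel_measurable M" for m
    unfolding Z_def[abs_def] by measurable
  have mass: "emeasure (product_measure \<Lambda> m \<omega>) B
      = (\<integral>\<^sup>+\<theta>. ennreal (\<Prod>i\<le>m. \<Lambda> i \<theta> \<omega>) * indicator B \<theta> \<partial>surface_measure)"
    if [measurable (raw)]: "\<omega> \<in> space M" for m \<omega>
    unfolding product_measure_def by (rule emeasure_density) measurable
  have Y_meas[measurable]: "Y m \<in> borel_measurable M" for m
  proof -
    have "(\<lambda>\<omega>. enn2real (\<integral>\<^sup>+\<theta>. ennreal (\<Prod>i\<le>m. \<Lambda> i \<theta> \<omega>) * indicator B \<theta> \<partial>surface_measure)) \<in> borel_measurable M"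
      by measurable
    also have "?this \<longleftrightarrow> ?thesis"
      by (intro measurable_cong) (simp add: Y_def measure_def mass)
    finally show ?thesis .
  qed
  have \<mu>: "random_measure M \<mu>" using limit by (simp add: limiting_measure_def)
  have Y0_meas[measurable]: "Y0 \<in> borel_measurable M"
  proof -
    have [measurable]: "(\<lambda>\<omega>. emeasure (\<mu> \<omega>) B) \<in> borel_measurable M"
      using \<mu> B by (simp add: random_measure_def)
    show ?thesis unfolding Y0_def[abs_def] measure_def by measurable
  qed
  have Y0: "(\<E> \<omega>. ennreal (Y0 \<omega> powr q)) = (\<E> \<omega>. epow (emeasure (\<mu> \<omega>) B) q)"
  proof (rule nn_integral_cong)
    fix \<omega> assume "\<omega> \<in> space M"
    then have "finite_measure (\<mu> \<omega>)" using \<mu> by (simp add: random_measure_def)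
    then show "ennreal (Y0 \<omega> powr q) = epow (emeasure (\<mu> \<omega>) B) q"
      by (simp add: powr_epow Y0_def finite_measure.emeasure_eq_measure)
  qed
  \<comment> \<open>The \<open>m\<close>-th product measure contains the \<open>m + 1\<close> factors \<open>0, \<dots>, m\<close>.\<close>
  have Y: "(\<E> \<omega>. ennreal (Y m \<omega> powr q)) = (\<E> \<omega>. epow (Z (Suc m) \<omega>) q)" for m
  proof (rule nn_integral_cong_AE)
    have "(\<E> \<omega>. Z (Suc m) \<omega>) = (\<integral>\<^sup>+\<theta>. (\<E> \<omega>. cascade {..<Suc m} \<theta> \<omega>) \<partial>cell_measure B)"
      unfolding Z_def by (rule nn_integral_swap) (simp_all add: \<nu>.finite_measure_axioms)
    also have "\<dots> = (\<integral>\<^sup>+\<theta>. 1 \<partial>cell_measure B)"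
    proof (rule nn_integral_cong)
      fix \<theta> assume "\<theta> \<in> space (cell_measure B)"
      then have \<theta>: "\<theta> \<in> sphere 0 1" by (simp add: cell_measure_def)
      show "(\<E> \<omega>. cascade {..<Suc m} \<theta> \<omega>) = 1"
        using moment_cascade[OF _ \<theta>, of "{..<Suc m}" 1] mean[OF \<theta>] by simp
    qed
    finally have "(\<E> \<omega>. Z (Suc m) \<omega>) \<noteq> \<infinity>"
      using emeasure_surface_measure_finite[of B] by (simp add: emeasure_cell_measure_space[OF B] less_top)
    then have fin: "AE \<omega> in M. Z (Suc m) \<omega> \<noteq> \<infinity>"
      by (intro nn_integral_PInf_AE) auto
    have nn: "AE \<omega> in M. \<forall>i. \<forall>\<theta>\<in>sphere 0 1. 0 \<le> \<Lambda> i \<theta> \<omega>"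
      using nonneg by (simp add: AE_all_countable)
    have sp: "AE \<omega> in M. \<omega> \<in> space M" by simp
    show "AE \<omega> in M. ennreal (Y m \<omega> powr q) = epow (Z (Suc m) \<omega>) q"
      using fin nn sp
    proof eventually_elim
      case (elim \<omega>)
      note elim(3)[measurable (raw)]
      have "Z (Suc m) \<omega> = (\<integral>\<^sup>+\<theta>. indicator B \<theta> * cascade {..<Suc m} \<theta> \<omega> \<partial>surface_measure)"
        unfolding Z_def cell_measure_def by (subst nn_integral_density) measurable
      also have "\<dots> = emeasure (product_measure \<Lambda> m \<omega>) B"
        unfolding mass[OF elim(3)]
      proof (rule nn_integral_cong)
        fix \<theta> :: 'a assume "\<theta> \<in> space surface_measure"
        then have "cascade {..<Suc m} \<theta> \<omega> = ennreal (\<Prod>i\<le>m. \<Lambda> i \<theta> \<omega>)"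
          using elim(2) by (simp add: cascade_def prod_ennreal lessThan_Suc_atMost)
        then show "indicator B \<theta> * cascade {..<Suc m} \<theta> \<omega> = ennreal (\<Prod>i\<le>m. \<Lambda> i \<theta> \<omega>) * indicator B \<theta>"
          by (simp add: mult.commute)
      qed
      finally have "Z (Suc m) \<omega> = emeasure (product_measure \<Lambda> m \<omega>) B" .
      then have "Z (Suc m) \<omega> = ennreal (Y m \<omega>)"
        using elim(1) by (simp add: Y_def emeasure_eq_ennreal_measure)
      then show ?case by (simp add: powr_epow Y_def)
    qed
  qed
  have lim: "(\<lambda>n. (\<E> \<omega>. ennreal (\<bar>Y n \<omega> - Y0 \<omega>\<bar> powr p))) \<longlonglongrightarrow> 0"
    using limit B by (simp add: limiting_measure_def Y_def Y0_def)
  show "(\<E> \<omega>. epow (emeasure (\<mu> \<omega>) B) q) \<le> ennreal (2 powr q) * K"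
    if K: "\<And>m. n \<le> m \<Longrightarrow> (\<E> \<omega>. epow (\<integral>\<^sup>+\<theta>. cascade {..<m} \<theta> \<omega> \<partial>cell_measure B) q) \<le> K"
    unfolding Y0[symmetric]
  proof (rule Lp_limit_moment_le[OF Y_meas Y0_meas _ _ lim q])
    show "(\<E> \<omega>. ennreal (Y m \<omega> powr q)) \<le> K" if "n \<le> m" for m
      using that K[of "Suc m"] unfolding Y Z_def by simp
  qed (simp_all add: Y_def Y0_def)
  show "K \<le> ennreal (2 powr q) * (\<E> \<omega>. epow (emeasure (\<mu> \<omega>) B) q)"
    if K: "\<And>m. n \<le> m \<Longrightarrow> K \<le> (\<E> \<omega>. epow (\<integral>\<^sup>+\<theta>. cascade {..<m} \<theta> \<omega> \<partial>cell_measure B) q)"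
    unfolding Y0[symmetric]
  proof (rule Lp_limit_moment_ge[OF Y_meas Y0_meas _ _ lim q])
    show "K \<le> (\<E> \<omega>. ennreal (Y m \<omega> powr q))" if "n \<le> m" for m
      using that K[of "Suc m"] unfolding Y Z_def by simp
  qed (simp_all add: Y_def Y0_def)
qed

end

text \<open>The moment \<open>E \<mu>(B)\<^sup>q\<close> is of the order of \<open>mq\<^sup>n \<sigma>(B)\<^sup>q\<close>, uniformly over the levels \<open>n\<close>
  and over the sets \<open>B\<close> that lie in a cap of radius \<open>b\<^sup>-\<^sup>n\<close> and fill a fixed proportion of it.\<close>

definition cell_moment_law ::
    "'w measure \<Rightarrow> ('w \<Rightarrow> 'a::euclidean_space measure) \<Rightarrow> nat \<Rightarrow> real \<Rightarrow> real \<Rightarrow> real \<Rightarrow> bool" where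
  "cell_moment_law M \<mu> d b mq q \<longleftrightarrow>
     (\<forall>Cv\<ge>0. \<exists>c1>0. \<exists>c2>0. \<forall>n. \<forall>B\<in>sets sphere_borel. \<forall>y\<in>sphere 0 1.
        B \<subseteq> cap (1 / b ^ n) y \<longrightarrow> 0 < measure surface_measure B \<longrightarrow>
        (1 / b ^ n) ^ d \<le> Cv * measure surface_measure B \<longrightarrow>
        (\<integral>\<^sup>+\<omega>. epow (emeasure (\<mu> \<omega>) B) q \<partial>M)
          \<in> {ennreal (c1 * mq ^ n * measure surface_measure B powr q)..
              ennreal (c2 * mq ^ n * measure surface_measure B powr q)})"

context convergent_cascade
begin

text \<open>By the tail bound, the surface measure on such a set satisfies the preceding cell estimates for all
  \<open>m \<ge> n\<close> with one constant \<open>c\<close>; these estimates then pass to the limit \<open>m \<rightarrow> \<infinity>\<close>.\<close>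

lemma cell_moment_law:
  assumes dim: "DIM('a) = Suc d" and p: "2 \<le> p"
    and mean: "\<And>i \<theta>. \<theta> \<in> sphere 0 1 \<Longrightarrow> moment M (\<Lambda> i \<theta>) 1 = 1"
    and nonneg: "\<And>i. AE \<omega> in M. \<forall>\<theta>\<in>sphere 0 1. 0 \<le> \<Lambda> i \<theta> \<omega>"
    and limit: "limiting_measure M \<Lambda> p \<mu>"
    and q: "0 \<le> q" "q \<le> p" and mq_pos: "0 < mq"
    and mq: "\<And>i \<theta>. \<theta> \<in> sphere 0 1 \<Longrightarrow> moment M (\<Lambda> i \<theta>) q = ennreal mq"
    and D: "0 < D"
    and upper: "\<And>n y \<theta>. 0 < q \<Longrightarrow> q < 1 \<Longrightarrow> y \<in> sphere 0 1 \<Longrightarrow> \<theta> \<in> cap (1 / b ^ n) y \<Longrightarrow>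
       (\<Prod>i<n. correlation M (\<Lambda> i) (q - 1) y \<theta>) \<le> ennreal (D * mq ^ n)"
    and lower: "\<And>n y \<theta>. 1 \<le> q \<Longrightarrow> y \<in> sphere 0 1 \<Longrightarrow> \<theta> \<in> cap (1 / b ^ n) y \<Longrightarrow>
       ennreal (D * mq ^ n) \<le> (\<Prod>i<n. correlation M (\<Lambda> i) (q - 1) y \<theta>)"
  shows "cell_moment_law M \<mu> d b mq q"
proof (cases "q = 0")
  case True
  obtain e :: 'a where e: "e \<in> sphere 0 1"
    by (metis norm_Basis mem_sphere_0 nonempty_Basis ex_in_conv)
  have "mq = 1"
    using mq[OF e, of 0] True mq_pos by (simp add: moment_def emeasure_space_1)
  then show ?thesis
    unfolding cell_moment_law_def using True
    by (auto simp: emeasure_space_1 intro!: exI[of _ "1::real"])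
next
  case False
  with q have q0: "0 < q" by simp
  show ?thesis
    unfolding cell_moment_law_def
  proof (intro allI impI, goal_cases)
    case (1 Cv)
    then have Cv: "0 \<le> Cv" .
    define K where "K = 3 * real DIM('a) * unit_ball_vol DIM('a) * 2 ^ Suc d"
    have K: "0 \<le> K" by (simp add: K_def)
    define c where "c = R * (1 + k\<^sup>2 * K * Cv * \<rho> 0 / (1 - \<rho> 0 / b ^ d))"
    have c: "1 \<le> c"
    proof -
      have "\<rho> 0 / b ^ d < 1" using \<rho>_0 b by simp
      then have "1 * 1 \<le> R * (1 + k\<^sup>2 * K * Cv * \<rho> 0 / (1 - \<rho> 0 / b ^ d))"
        using R_ge_1 K Cv \<rho>_0_ge_1 by (intro mult_mono) auto
      then show ?thesis by (simp add: c_def)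
    qed
    have cell: "cell M \<Lambda> (cell_measure B) n m p c"
      if B: "B \<in> sets sphere_borel" and Bv: "(1 / b ^ n) ^ d \<le> Cv * measure surface_measure B" and nm: "n \<le> m" for B n m
    proof -
      interpret \<sigma>: finite_measure "surface_measure :: 'a measure" by (rule finite_measure_surface_measure)
      have cap: "emeasure (cell_measure B) (cap r \<theta>) \<le> ennreal (K * r ^ d)"
        if "0 < r" "\<theta> \<in> sphere 0 1" for r \<theta>
      proof -
        have "emeasure (cell_measure B) (cap r \<theta>) \<le> emeasure surface_measure (cap r \<theta>)"
          using B that by (auto simp: emeasure_cell_measure sets_cap intro!: emeasure_mono)
        also have "\<dots> \<le> ennreal (K * r ^ d)"
          unfolding K_def by (rule emeasure_cap_le[OF dim that(2,1)])
        finally show ?thesis .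
      qed
      have vol: "ennreal ((1 / b ^ n) ^ d) \<le> ennreal Cv * emeasure (cell_measure B) (space (cell_measure B))"
        using Bv Cv
        by (simp add: emeasure_cell_measure_space[OF B] \<sigma>.emeasure_eq_measure ennreal_mult[symmetric] ennreal_leI)
      show ?thesis
      proof (intro cell.intro[OF random_cascade_axioms] cell_axioms.intro)
        show "(\<E> \<omega>. epow (\<integral>\<^sup>+\<theta>. cascade {n..<m} \<theta> \<omega> \<partial>cell_measure B) p)
            \<le> ennreal c * epow (emeasure (cell_measure B) (space (cell_measure B))) p"
          unfolding c_def
          by (rule tail_moment_le[OF finite_measure_cell_measure[OF B] sets_cell_measure K cap Cv vol])
      qed (fact finite_measure_cell_measure[OF B] sets_cell_measure mean nm p c)+
    qed
    define l u where "l = (if q < 1 then c powr - ((1 - q) / (p - 1)) else D powr q)"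
      and "u = (if q < 1 then D powr q else c powr (q / p))"
    have lu: "0 < l" "0 < u" using c D by (auto simp: l_def u_def)
    have bounds: "ennreal l * ennreal mq ^ n * epow (emeasure surface_measure B) q
          \<le> (\<E> \<omega>. epow (\<integral>\<^sup>+\<theta>. cascade {..<m} \<theta> \<omega> \<partial>cell_measure B) q) \<and>
        (\<E> \<omega>. epow (\<integral>\<^sup>+\<theta>. cascade {..<m} \<theta> \<omega> \<partial>cell_measure B) q)
          \<le> ennreal u * ennreal mq ^ n * epow (emeasure surface_measure B) q"
      if B: "B \<in> sets sphere_borel" and y: "y \<in> sphere 0 1" and Bc: "B \<subseteq> cap (1 / b ^ n) y"
        and Bv: "(1 / b ^ n) ^ d \<le> Cv * measure surface_measure B" and nm: "n \<le> m" for B n m y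
    proof -
      interpret C: cell M \<Lambda> "cell_measure B" n m p c
        using B Bv nm by (rule cell)
      have AE_cap: "AE \<theta> in cell_measure B. \<theta> \<in> cap (1 / b ^ n) y"
        using B Bc unfolding cell_measure_def by (subst AE_density) (auto simp: indicator_def)
      have T: "C.T = emeasure surface_measure B"
        by (simp add: C.T_def emeasure_cell_measure_space[OF B])
      note Z = C.Z_def[symmetric]
      show ?thesis
      proof (cases "q < 1")
        case True
        have "AE \<theta> in cell_measure B. (\<Prod>i<n. correlation M (\<Lambda> i) (q - 1) y \<theta>)
                \<le> ennreal (D * mq ^ n)"
          using AE_cap by eventually_elim (rule upper[OF q0 True y])
        from C.upper_bound_less_1[OF q0 True mq mq_pos y less_imp_le[OF D] this]
          C.lower_bound_less_1[OF q0 True mq]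
        show ?thesis using True unfolding Z T by (simp add: l_def u_def)
      next
        case False
        then have q1: "1 \<le> q" by simp
        have "AE \<theta> in cell_measure B. ennreal (D * mq ^ n)
                \<le> (\<Prod>i<n. correlation M (\<Lambda> i) (q - 1) y \<theta>)"
          using AE_cap by eventually_elim (rule lower[OF q1 y])
        from C.lower_bound_ge_1[OF q1 mq mq_pos y D this] C.upper_bound_ge_1[OF q1 q(2) mq]
        show ?thesis using False unfolding Z T by (simp add: l_def u_def)
      qed
    qed
    show ?case
    proof (rule exI[of _ "l / 2 powr q"], rule conjI[OF _ exI[of _ "2 powr q * u"]], goal_cases)
      case 2
      show ?case
      proof (intro conjI allI ballI impI)
        fix n B and y :: 'a
        assume B: "B \<in> sets sphere_borel" and y: "y \<in> sphere 0 1" and Bc: "B \<subseteq> cap (1 / b ^ n) y"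
          and pos: "0 < measure surface_measure B" and Bv: "(1 / b ^ n) ^ d \<le> Cv * measure surface_measure B"
        interpret \<sigma>: finite_measure "surface_measure :: 'a measure" by (rule finite_measure_surface_measure)
        define t where "t = measure surface_measure B"
        have vol: "ennreal r * ennreal mq ^ n * epow (emeasure surface_measure B) q = ennreal (r * mq ^ n * t powr q)"
          if "0 \<le> r" for r
          using pos that mq_pos
          by (simp add: \<sigma>.emeasure_eq_measure epow_ennreal ennreal_power ennreal_mult t_def)
        have E: "(\<E> \<omega>. epow (emeasure (\<mu> \<omega>) B) q) \<le> ennreal (2 powr q) * ennreal (u * mq ^ n * t powr q)"
          using bounds[OF B y Bc Bv] lu
          by (intro limiting_mass_moment_le[OF mean nonneg limit B q0 q(2), of n]) (simp_all add: vol)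
        have "ennreal (l * mq ^ n * t powr q) \<le> ennreal (2 powr q) * (\<E> \<omega>. epow (emeasure (\<mu> \<omega>) B) q)"
          using bounds[OF B y Bc Bv] lu
          by (intro limiting_mass_moment_ge[OF mean nonneg limit B q0 q(2), of n]) (simp_all add: vol)
        then have "ennreal (1 / 2 powr q) * ennreal (l * mq ^ n * t powr q)
            \<le> ennreal (1 / 2 powr q) * (ennreal (2 powr q) * (\<E> \<omega>. epow (emeasure (\<mu> \<omega>) B) q))"
          by (rule mult_left_mono) simp
        also have "\<dots> = (\<E> \<omega>. epow (emeasure (\<mu> \<omega>) B) q)"
          by (simp add: mult.assoc[symmetric] ennreal_mult[symmetric])
        also have "ennreal (1 / 2 powr q) * ennreal (l * mq ^ n * t powr q) = ennreal (l / 2 powr q * mq ^ n * t powr q)"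
          using lu mq_pos by (simp add: ennreal_mult[symmetric])
        finally have "ennreal (l / 2 powr q * mq ^ n * t powr q) \<le> (\<E> \<omega>. epow (emeasure (\<mu> \<omega>) B) q)" .
        moreover have "ennreal (2 powr q) * ennreal (u * mq ^ n * t powr q) = ennreal (2 powr q * u * mq ^ n * t powr q)"
          using lu mq_pos by (simp add: ennreal_mult[symmetric] mult.assoc)
        ultimately show "(\<E> \<omega>. epow (emeasure (\<mu> \<omega>) B) q)
            \<in> {ennreal (l / 2 powr q * mq ^ n * measure surface_measure B powr q)..
                ennreal (2 powr q * u * mq ^ n * measure surface_measure B powr q)}"
          using E by (simp add: t_def)
      qed (use lu in simp)
    qed (use lu in simp)
  qed
qed

end


section \<open>The Renyi function\<close>

lemma tendsto_ratio_of_linear_growth: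
  fixes u v :: "nat \<Rightarrow> real"
  assumes u: "\<forall>\<^sub>F l in sequentially. \<bar>u l - h * real l\<bar> \<le> K"
    and v: "\<forall>\<^sub>F l in sequentially. \<bar>v l - g * real l\<bar> \<le> K'" and g: "g \<noteq> 0"
  shows "(\<lambda>l. u l / v l) \<longlonglongrightarrow> h / g"
proof -
  have lim: "(\<lambda>l. w l / real l) \<longlonglongrightarrow> a"
    if "\<forall>\<^sub>F l in sequentially. \<bar>w l - a * real l\<bar> \<le> L" for w :: "nat \<Rightarrow> real" and a L
  proof -
    have "(\<lambda>l. L / real l) \<longlonglongrightarrow> 0"
      by (rule lim_const_over_n)
    moreover have "\<forall>\<^sub>F l in sequentially. norm (w l / real l - a) \<le> L / real l"
      using that eventually_gt_at_top[of 0]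
    proof eventually_elim
      case (elim l)
      then have "w l / real l - a = (w l - a * real l) / real l" by (simp add: field_simps)
      then show ?case using elim by (simp add: divide_right_mono)
    qed
    ultimately have "(\<lambda>l. w l / real l - a) \<longlonglongrightarrow> 0"
      by (rule Lim_null_comparison[rotated])
    then show ?thesis by (simp add: LIM_zero_iff)
  qed
  have "(\<lambda>l. (u l / real l) / (v l / real l)) \<longlonglongrightarrow> h / g"
    by (intro tendsto_divide lim[OF u] lim[OF v] g)
  then show ?thesis
    by (rule Lim_transform_eventually)
      (use eventually_gt_at_top[of 0] in \<open>eventually_elim, simp\<close>)
qed

lemma ln_between_exponentials:
  fixes r :: real
  assumes "0 < A" "A * exp x \<le> r" "r \<le> B * exp x"
  shows "\<bar>ln r - x\<bar> \<le> max \<bar>ln A\<bar> \<bar>ln B\<bar>"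
proof -
  have "0 < A * exp x" using assms(1) by simp
  then have r: "0 < r" using assms(2) by linarith
  then have B: "0 < B" using assms(3) by (smt (verit) exp_gt_zero mult_nonpos_nonneg)
  have "ln (A * exp x) \<le> ln r" "ln r \<le> ln (B * exp x)"
    using assms r B by auto
  then show ?thesis
    using assms(1) B by (simp add: ln_mult)
qed

lemma Liminf_log_ratio:
  fixes S :: "nat \<Rightarrow> ennreal" and V :: "nat \<Rightarrow> real"
  assumes g: "0 < g" and A: "0 < A1" "0 < B1"
    and S: "\<forall>\<^sub>F l in sequentially. ennreal (A1 * exp (h * real l)) \<le> S l \<and> S l \<le> ennreal (A2 * exp (h * real l))"
    and V: "\<forall>\<^sub>F l in sequentially. B1 * exp (- g * real l) \<le> V l \<and> V l \<le> B2 * exp (- g * real l)"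
  shows "liminf (\<lambda>l. ennreal_ln (S l) / ereal (ln (V l))) = ereal (- h / g)"
proof -
  define u where "u l = ln (enn2real (S l))" for l
  define L where "L = max \<bar>ln B1\<bar> \<bar>ln B2\<bar>"
  have S': "\<forall>\<^sub>F l in sequentially. ennreal_ln (S l) = ereal (u l) \<and> \<bar>u l - h * real l\<bar> \<le> max \<bar>ln A1\<bar> \<bar>ln A2\<bar>"
    using S
  proof eventually_elim
    case (elim l)
    then have "S l \<noteq> \<infinity>" by (auto simp: top_unique)
    then obtain r where r: "S l = ennreal r" "0 \<le> r" by (cases "S l") auto
    have low: "A1 * exp (h * real l) \<le> r" using elim r by (simp add: ennreal_le_iff)
    have "0 < A1 * exp (h * real l)" using A(1) by simp
    then have pos: "0 < r" using low by linarith
    have up: "r \<le> A2 * exp (h * real l)"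
    proof (rule ccontr)
      assume "\<not> ?thesis"
      then have "ennreal (A2 * exp (h * real l)) < ennreal r"
        using pos by (intro ennreal_lessI) auto
      then show False using elim r(1) by (simp add: not_less[symmetric])
    qed
    show ?case
      using ln_between_exponentials[OF A(1) low up] pos r by (simp add: u_def ennreal_ln_def)
  qed
  have V': "\<forall>\<^sub>F l in sequentially. \<bar>ln (V l) - (- g) * real l\<bar> \<le> L"
    using V
  proof eventually_elim
    case (elim l)
    then show ?case
      using ln_between_exponentials[OF A(2), of "- g * real l" "V l" B2] by (simp add: L_def)
  qed
  have "\<forall>\<^sub>F l in sequentially. L / g < real l"
    using filterlim_real_sequentially by (simp add: filterlim_at_top_dense)
  then have "\<forall>\<^sub>F l in sequentially. ereal (u l / ln (V l)) = ennreal_ln (S l) / ereal (ln (V l))"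
    using S' V'
  proof eventually_elim
    case (elim l)
    then have "L < g * real l" using g by (simp add: field_simps)
    then have "ln (V l) < 0" using elim(3) by (simp add: abs_le_iff)
    then show ?case using elim(2) by simp
  qed
  moreover have "(\<lambda>l. ereal (u l / ln (V l))) \<longlonglongrightarrow> ereal (h / - g)"
    using S' g by (intro tendsto_ereal tendsto_ratio_of_linear_growth[OF _ V']) (auto elim: eventually_mono)
  ultimately have "(\<lambda>l. ennreal_ln (S l) / ereal (ln (V l))) \<longlonglongrightarrow> ereal (h / - g)"
    by (rule Lim_transform_eventually[rotated])
  then show ?thesis
    by (simp add: lim_imp_Liminf)
qed

text \<open>A cell of level \<open>l\<close> has volume of order \<open>2\<^sup>-\<^sup>l\<^sup>d\<close>, so there are about \<open>2\<^sup>l\<^sup>d\<close> of them. The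
  level \<open>n\<close> of the cascade that corresponds to \<open>l\<close> is determined by \<open>b\<^sup>n \<approx> 2\<^sup>l\<close>, and then
  \<open>mq ^ n\<close> is of order \<open>2 powr (l * log b mq)\<close>.\<close>

lemma renyi_function_of_cell_moments:
  fixes \<mu> :: "'w \<Rightarrow> 'a::euclidean_space measure"
  assumes dim: "DIM('a) = Suc d" "1 \<le> d" and mesh: "dyadic_mesh N \<Delta>"
    and b: "1 < b" and mq: "0 < mq" and q: "0 \<le> q"
    and cells: "cell_moment_law M \<mu> d b mq q"
  shows "renyi_function M \<mu> N \<Delta> q = ereal (q - 1 - 1 / real d * log b mq)"
proof -
  interpret \<sigma>: finite_measure "surface_measure :: 'a measure" by (rule finite_measure_surface_measure)
  let ?\<sigma> = "\<lambda>B :: 'a set. measure surface_measure B"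
  have \<Delta>_sets: "\<Delta> l m \<in> sets sphere_borel" if "m < N l" for l m
    using mesh that by (auto simp: dyadic_mesh_def)
  have disj: "disjoint_family_on (\<Delta> l) {..<N l}" and cover: "(\<Union>m<N l. \<Delta> l m) = sphere 0 1" for l
    using mesh by (auto simp: dyadic_mesh_def)
  obtain cm Cm where cm: "0 < cm" "0 < Cm" and centre:
    "\<And>l m. m < N l \<Longrightarrow> \<exists>\<theta>\<in>\<Delta> l m. cap (cm / 2 ^ l) \<theta> \<subseteq> \<Delta> l m \<and> \<Delta> l m \<subseteq> cap (Cm / 2 ^ l) \<theta>"
    using mesh unfolding dyadic_mesh_def by metis
  define a0 where "a0 = real DIM('a) * unit_ball_vol DIM('a) / (4 * 8 ^ Suc d)"
  define a1 where "a1 = 3 * real DIM('a) * unit_ball_vol DIM('a) * 2 ^ Suc d"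
  define c' where "c' = min cm 1"
  define \<alpha> where "\<alpha> = a0 * c' ^ d"
  define \<beta> where "\<beta> = a1 * Cm ^ d"
  define g where "g = real d * ln 2"
  have a: "0 < a0" "0 < a1" by (auto simp: a0_def a1_def)
  have c': "0 < c'" "c' \<le> 1" "c' \<le> cm" using cm by (auto simp: c'_def)
  have \<alpha>\<beta>: "0 < \<alpha>" "0 < \<beta>" using a c' cm by (auto simp: \<alpha>_def \<beta>_def)
  have g: "0 < g" using dim by (simp add: g_def)
  have scale: "1 / (2 ^ l) ^ d = exp (- g * real l)" for l :: nat
  proof -
    have "exp (g * real l) = exp (ln 2) ^ (d * l)"
      by (simp only: g_def exp_of_nat_mult[symmetric]) (simp add: mult_ac)
    also have "\<dots> = (2 ^ l) ^ d" by (simp add: power_mult[symmetric] mult.commute)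
    finally show ?thesis by (simp add: exp_minus inverse_eq_divide)
  qed
  have vol: "\<alpha> * exp (- g * real l) \<le> ?\<sigma> (\<Delta> l m)" "?\<sigma> (\<Delta> l m) \<le> \<beta> * exp (- g * real l)"
    if m: "m < N l" for l m
  proof -
    obtain \<theta> where \<theta>: "\<theta> \<in> \<Delta> l m" "cap (cm / 2 ^ l) \<theta> \<subseteq> \<Delta> l m" "\<Delta> l m \<subseteq> cap (Cm / 2 ^ l) \<theta>"
      using centre[OF m] by auto
    have \<theta>S: "\<theta> \<in> sphere 0 1" using \<theta>(1,3) cap_subset_sphere by blast
    have "c' / 2 ^ l \<le> 1"
      using order_trans[OF c'(2), of "2 ^ l"] by simp
    then have "ennreal (a0 * (c' / 2 ^ l) ^ d) \<le> emeasure surface_measure (cap (c' / 2 ^ l) \<theta>)"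
      unfolding a0_def using c' by (intro emeasure_cap_ge[OF dim(1) \<theta>S]) auto
    also have "\<dots> \<le> emeasure surface_measure (\<Delta> l m)"
    proof (rule emeasure_mono)
      have "c' / 2 ^ l \<le> cm / 2 ^ l" using c' by (intro divide_right_mono) auto
      then show "cap (c' / 2 ^ l) \<theta> \<subseteq> \<Delta> l m"
        using \<theta>(2) by (fastforce simp: cap_def)
    qed (use \<Delta>_sets[OF m] in simp)
    finally have "a0 * (c' / 2 ^ l) ^ d \<le> ?\<sigma> (\<Delta> l m)"
      by (simp add: \<sigma>.emeasure_eq_measure ennreal_le_iff)
    then show "\<alpha> * exp (- g * real l) \<le> ?\<sigma> (\<Delta> l m)"
      unfolding \<alpha>_def scale[symmetric] by (simp add: power_divide)
    have "emeasure surface_measure (\<Delta> l m) \<le> emeasure surface_measure (cap (Cm / 2 ^ l) \<theta>)"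
      using \<theta>(3) sets_cap[OF \<theta>S] by (intro emeasure_mono) auto
    also have "\<dots> \<le> ennreal (a1 * (Cm / 2 ^ l) ^ d)"
      unfolding a1_def using cm by (intro emeasure_cap_le[OF dim(1) \<theta>S]) auto
    finally have "?\<sigma> (\<Delta> l m) \<le> a1 * (Cm / 2 ^ l) ^ d"
      using a cm by (simp add: \<sigma>.emeasure_eq_measure ennreal_le_iff)
    then show "?\<sigma> (\<Delta> l m) \<le> \<beta> * exp (- g * real l)"
      unfolding \<beta>_def scale[symmetric] by (simp add: power_divide)
  qed
  \<comment> \<open>The volumes add up to that of the sphere, which determines the order of the number of cells.\<close>
  define \<sigma>0 where "\<sigma>0 = ?\<sigma> (sphere 0 1)"
  have total: "(\<Sum>m<N l. ?\<sigma> (\<Delta> l m)) = \<sigma>0" for l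
    unfolding \<sigma>0_def cover[of l, symmetric] using \<Delta>_sets disj[of l]
    by (intro \<sigma>.finite_measure_finite_Union[symmetric]) auto
  have N0: "0 < N l" for l
  proof (rule ccontr)
    assume "\<not> ?thesis"
    then have "(sphere 0 1 :: 'a set) = {}" using cover[of l] by simp
    moreover obtain e :: 'a where "e \<in> Basis" using nonempty_Basis by blast
    ultimately show False by (auto simp: sphere_eq_empty)
  qed
  have \<sigma>0: "0 < \<sigma>0"
  proof -
    have "0 < \<alpha> * exp (- g * real 0)" using \<alpha>\<beta> by simp
    also have "\<dots> \<le> ?\<sigma> (\<Delta> 0 0)" by (rule vol(1)[OF N0])
    also have "\<dots> \<le> \<sigma>0"
      unfolding total[of 0, symmetric] using N0[of 0] by (intro member_le_sum) auto
    finally show ?thesis .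
  qed
  have N_le: "real (N l) \<le> \<sigma>0 / \<alpha> * exp (g * real l)" for l
  proof -
    have "real (N l) * (\<alpha> * exp (- g * real l)) \<le> \<sigma>0"
      unfolding total[of l, symmetric] using sum_mono[of "{..<N l}" "\<lambda>_. \<alpha> * exp (- g * real l)"] vol(1) by simp
    then show ?thesis using \<alpha>\<beta> by (simp add: exp_minus field_simps)
  qed
  have N_ge: "\<sigma>0 / \<beta> * exp (g * real l) \<le> real (N l)" for l
  proof -
    have "\<sigma>0 \<le> real (N l) * (\<beta> * exp (- g * real l))"
      unfolding total[of l, symmetric] using sum_mono[of "{..<N l}" _ "\<lambda>_. \<beta> * exp (- g * real l)"] vol(2) by simp
    then show ?thesis using \<alpha>\<beta> by (simp add: exp_minus field_simps)
  qed
  \<comment> \<open>The largest \<open>n\<close> for which caps of radius \<open>Cm / 2\<^sup>l\<close> still lie in caps of radius \<open>b\<^sup>-\<^sup>n\<close>.\<close>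
  define n where "n l = nat \<lfloor>log b (2 ^ l / Cm)\<rfloor>" for l :: nat
  define Cv where "Cv = (b * Cm) ^ d / \<alpha>"
  have Cv: "0 \<le> Cv" using b cm \<alpha>\<beta> by (simp add: Cv_def)
  define \<kappa> where "\<kappa> = ln 2 * ln mq / ln b"
  define K0 where "K0 = \<bar>log b Cm\<bar> + 1"
  have large: "\<forall>\<^sub>F l in sequentially. Cm \<le> 2 ^ l"
  proof -
    obtain l0 where l0: "Cm < 2 ^ l0" using real_arch_pow[of 2 Cm] by auto
    have "Cm \<le> 2 ^ l" if "l0 \<le> l" for l
      using l0 power_increasing[OF that, of "2::real"] by linarith
    then show ?thesis by (auto simp: eventually_sequentially)
  qed
  have level: "Cm / 2 ^ l \<le> 1 / b ^ n l" "1 / b ^ n l \<le> b * Cm / 2 ^ l"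
      "exp (- (K0 * \<bar>ln mq\<bar>)) * exp (\<kappa> * real l) \<le> mq ^ n l"
      "mq ^ n l \<le> exp (K0 * \<bar>ln mq\<bar>) * exp (\<kappa> * real l)"
    if l: "Cm \<le> 2 ^ l" for l
  proof -
    define x where "x = 2 ^ l / Cm"
    have x: "1 \<le> x" using l cm by (simp add: x_def)
    then have "0 \<le> log b x" using b by (simp add: zero_le_log_cancel_iff)
    then have n: "real (n l) \<le> log b x" "log b x < real (n l) + 1"
      by (auto simp: n_def x_def of_nat_nat)
    have "b ^ n l = b powr real (n l)" using b by (simp add: powr_realpow)
    also have "\<dots> \<le> b powr log b x" using n(1) b by (intro powr_mono) auto
    also have "\<dots> = x" using b x by simp
    finally have "b ^ n l \<le> x" .
    then show "Cm / 2 ^ l \<le> 1 / b ^ n l"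
      using b cm by (simp add: x_def field_simps)
    have "x = b powr log b x" using b x by simp
    also have "\<dots> \<le> b powr (real (n l) + 1)" using n(2) b by (intro powr_mono) auto
    also have "\<dots> = b * b ^ n l" using b by (simp add: powr_add powr_realpow)
    finally have "x \<le> b * b ^ n l" .
    then show "1 / b ^ n l \<le> b * Cm / 2 ^ l"
      using b cm by (simp add: x_def field_simps)
    have "log b x = real l * ln 2 / ln b - log b Cm"
      using cm by (simp add: x_def log_def ln_div ln_realpow diff_divide_distrib)
    then have "\<bar>real (n l) - real l * ln 2 / ln b\<bar> \<le> K0"
      using n by (simp add: K0_def)
    then have "\<bar>real (n l) - real l * ln 2 / ln b\<bar> * \<bar>ln mq\<bar> \<le> K0 * \<bar>ln mq\<bar>"
      by (intro mult_right_mono) auto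
    also have "\<bar>real (n l) - real l * ln 2 / ln b\<bar> * \<bar>ln mq\<bar> = \<bar>real (n l) * ln mq - \<kappa> * real l\<bar>"
    proof -
      have "real (n l) * ln mq - \<kappa> * real l = (real (n l) - real l * ln 2 / ln b) * ln mq"
        by (simp add: \<kappa>_def left_diff_distrib)
      then show ?thesis by (simp only: abs_mult)
    qed
    finally have "- (K0 * \<bar>ln mq\<bar>) + \<kappa> * real l \<le> real (n l) * ln mq"
      "real (n l) * ln mq \<le> K0 * \<bar>ln mq\<bar> + \<kappa> * real l" by (simp_all add: abs_le_iff)
    moreover have "mq ^ n l = exp (real (n l) * ln mq)"
      using mq by (simp add: exp_of_nat_mult)
    ultimately show "exp (- (K0 * \<bar>ln mq\<bar>)) * exp (\<kappa> * real l) \<le> mq ^ n l"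
      "mq ^ n l \<le> exp (K0 * \<bar>ln mq\<bar>) * exp (\<kappa> * real l)"
      by (simp_all only: exp_add[symmetric] exp_le_cancel_iff)
  qed
  obtain c1 c2 where c12: "0 < c1" "0 < c2" and cell: "\<And>n B y. B \<in> sets sphere_borel \<Longrightarrow> y \<in> sphere 0 1 \<Longrightarrow>
       B \<subseteq> cap (1 / b ^ n) y \<Longrightarrow> 0 < ?\<sigma> B \<Longrightarrow> (1 / b ^ n) ^ d \<le> Cv * ?\<sigma> B \<Longrightarrow>
       (\<integral>\<^sup>+\<omega>. epow (emeasure (\<mu> \<omega>) B) q \<partial>M)
         \<in> {ennreal (c1 * mq ^ n * ?\<sigma> B powr q)..ennreal (c2 * mq ^ n * ?\<sigma> B powr q)}"
    using cells Cv unfolding cell_moment_law_def by meson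
  define E where "E l m = (\<integral>\<^sup>+\<omega>. epow (emeasure (\<mu> \<omega>) (\<Delta> l m)) q \<partial>M)" for l m
  define h where "h = g + \<kappa> - q * g"
  define e1 e2 where "e1 = c1 * exp (- (K0 * \<bar>ln mq\<bar>)) * \<alpha> powr q"
    and "e2 = c2 * exp (K0 * \<bar>ln mq\<bar>) * \<beta> powr q"
  have e: "0 < e1" "0 < e2" using c12 \<alpha>\<beta> by (auto simp: e1_def e2_def)
  have E: "ennreal (e1 * exp ((\<kappa> - q * g) * real l)) \<le> E l m" "E l m \<le> ennreal (e2 * exp ((\<kappa> - q * g) * real l))"
    if l: "Cm \<le> 2 ^ l" and m: "m < N l" for l m
  proof -
    obtain y where y: "y \<in> \<Delta> l m" "\<Delta> l m \<subseteq> cap (Cm / 2 ^ l) y"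
      using centre[OF m] by auto
    have yS: "y \<in> sphere 0 1" using y cap_subset_sphere by blast
    have sub: "\<Delta> l m \<subseteq> cap (1 / b ^ n l) y"
      using y(2) level(1)[OF l] by (fastforce simp: cap_def)
    have pos: "0 < ?\<sigma> (\<Delta> l m)"
    proof -
      have "0 < \<alpha> * exp (- g * real l)" using \<alpha>\<beta> by simp
      then show ?thesis using vol(1)[OF m] by linarith
    qed
    have "(1 / b ^ n l) ^ d \<le> (b * Cm / 2 ^ l) ^ d"
      using level(2)[OF l] b by (intro power_mono) auto
    also have "\<dots> = Cv * (\<alpha> * exp (- g * real l))"
      using \<alpha>\<beta> unfolding Cv_def scale[symmetric] by (simp add: power_divide)
    also have "\<dots> \<le> Cv * ?\<sigma> (\<Delta> l m)"
      using vol(1)[OF m] Cv by (rule mult_left_mono)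
    finally have "(1 / b ^ n l) ^ d \<le> Cv * ?\<sigma> (\<Delta> l m)" .
    note bnd = cell[OF \<Delta>_sets[OF m] yS sub pos this]
    have pw: "(s * exp (- g * real l)) powr q = s powr q * exp (- (q * g * real l))" if "0 < s" for s
      using that by (simp add: powr_mult powr_def[of "exp _"] mult_ac)
    have "e1 * exp ((\<kappa> - q * g) * real l)
        = c1 * (exp (- (K0 * \<bar>ln mq\<bar>)) * exp (\<kappa> * real l)) * (\<alpha> * exp (- g * real l)) powr q"
      unfolding e1_def pw[OF \<alpha>\<beta>(1)] by (simp add: exp_add[symmetric] algebra_simps)
    also have "\<dots> \<le> c1 * mq ^ n l * ?\<sigma> (\<Delta> l m) powr q"
      using level(3)[OF l] c12 vol(1)[OF m] q \<alpha>\<beta> mq by (intro mult_mono powr_mono2) auto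
    finally show "ennreal (e1 * exp ((\<kappa> - q * g) * real l)) \<le> E l m"
      using bnd unfolding E_def by (auto intro: order_trans[OF ennreal_leI])
    have "c2 * mq ^ n l * ?\<sigma> (\<Delta> l m) powr q
        \<le> c2 * (exp (K0 * \<bar>ln mq\<bar>) * exp (\<kappa> * real l)) * (\<beta> * exp (- g * real l)) powr q"
      using level(4)[OF l] c12 vol(2)[OF m] pos q \<alpha>\<beta> mq by (intro mult_mono powr_mono2) auto
    also have "\<dots> = e2 * exp ((\<kappa> - q * g) * real l)"
      unfolding e2_def pw[OF \<alpha>\<beta>(2)] by (simp add: exp_add[symmetric] algebra_simps)
    finally show "E l m \<le> ennreal (e2 * exp ((\<kappa> - q * g) * real l))"
      using bnd unfolding E_def by (auto intro: order_trans[OF _ ennreal_leI])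
  qed
  have S: "\<forall>\<^sub>F l in sequentially. ennreal (\<sigma>0 / \<beta> * e1 * exp (h * real l)) \<le> (\<Sum>m<N l. E l m)
      \<and> (\<Sum>m<N l. E l m) \<le> ennreal (\<sigma>0 / \<alpha> * e2 * exp (h * real l))"
    using large
  proof eventually_elim
    case (elim l)
    let ?x = "exp ((\<kappa> - q * g) * real l)"
    have hx: "exp (h * real l) = exp (g * real l) * ?x"
      by (simp add: h_def exp_add[symmetric] algebra_simps)
    have "\<sigma>0 / \<beta> * e1 * exp (h * real l) = (\<sigma>0 / \<beta> * exp (g * real l)) * (e1 * ?x)"
      by (simp add: hx)
    also have "\<dots> \<le> real (N l) * (e1 * ?x)"
      using N_ge[of l] e by (intro mult_right_mono) auto
    finally have "ennreal (\<sigma>0 / \<beta> * e1 * exp (h * real l)) \<le> ennreal (real (N l) * (e1 * ?x))"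
      by (rule ennreal_leI)
    also have "\<dots> = (\<Sum>m<N l. ennreal (e1 * ?x))"
      using e by (simp add: ennreal_mult ennreal_of_nat_eq_real_of_nat)
    also have "\<dots> \<le> (\<Sum>m<N l. E l m)"
      using E(1)[OF elim] by (intro sum_mono) auto
    finally have 1: "ennreal (\<sigma>0 / \<beta> * e1 * exp (h * real l)) \<le> (\<Sum>m<N l. E l m)" .
    have "(\<Sum>m<N l. E l m) \<le> (\<Sum>m<N l. ennreal (e2 * ?x))"
      using E(2)[OF elim] by (intro sum_mono) auto
    also have "\<dots> = ennreal (real (N l) * (e2 * ?x))"
      using e by (simp add: ennreal_mult ennreal_of_nat_eq_real_of_nat)
    also have "\<dots> \<le> ennreal ((\<sigma>0 / \<alpha> * exp (g * real l)) * (e2 * ?x))"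
      using N_le[of l] e by (intro ennreal_leI mult_right_mono) auto
    also have "(\<sigma>0 / \<alpha> * exp (g * real l)) * (e2 * ?x) = \<sigma>0 / \<alpha> * e2 * exp (h * real l)"
      by (simp add: hx)
    finally show ?case using 1 by blast
  qed
  have "liminf (\<lambda>l. ennreal_ln (\<Sum>m<N l. E l m) / ereal (ln (?\<sigma> (\<Delta> l 0)))) = ereal (- h / g)"
  proof (rule Liminf_log_ratio[OF g _ _ S])
    show "\<forall>\<^sub>F l in sequentially. \<alpha> * exp (- g * real l) \<le> ?\<sigma> (\<Delta> l 0) \<and> ?\<sigma> (\<Delta> l 0) \<le> \<beta> * exp (- g * real l)"
      using vol[OF N0] by simp
  qed (use \<sigma>0 \<alpha>\<beta> e in auto)
  also have "- h / g = q - 1 - 1 / real d * log b mq"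
  proof -
    have "\<kappa> / g = 1 / real d * log b mq"
      using dim b by (simp add: \<kappa>_def g_def log_def)
    moreover have "- h / g = q - 1 - \<kappa> / g"
      using g by (simp add: h_def field_simps)
    ultimately show ?thesis by simp
  qed
  finally show ?thesis by (simp add: renyi_function_def E_def)
qed

theorem theorem3:
  fixes d :: nat and p b :: real
    and M :: "'w measure"
    and \<Lambda> :: "nat \<Rightarrow> real ^ 'n \<Rightarrow> 'w \<Rightarrow> real"
    and \<mu> :: "'w \<Rightarrow> (real ^ 'n) measure"
    and N :: "nat \<Rightarrow> nat" and \<Delta> :: "nat \<Rightarrow> nat \<Rightarrow> (real ^ 'n) set"
    and pole :: "real ^ 'n"
  assumes dim: "CARD('n) = d + 1" "1 \<le> d"
    and pole: "pole \<in> Basis"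
    and prob: "prob_space M"
    and indep: "independent_fields M \<Lambda>"
    and conv: "convergence_hypotheses d M \<Lambda> p b"
    and limit: "limiting_measure M \<Lambda> p \<mu>"
    and mesh: "dyadic_mesh N \<Delta>"
    and isotropic: "\<forall>i. strongly_isotropic M (\<Lambda> i)"
    and moments: "\<forall>i j. \<forall>\<theta>\<in>sphere 0 1. \<forall>q\<in>{0..p}.
          moment M (\<Lambda> i pole) q = moment M (\<Lambda> j \<theta>) q"
    and small_q: "\<forall>q\<in>{0<..<1}. \<exists>\<rho> :: real \<Rightarrow> real. mono_on {0..} \<rho> \<and>
          (\<forall>i. \<forall>\<theta>\<^sub>1\<in>sphere 0 1. \<forall>\<theta>\<^sub>2\<in>sphere 0 1.
             (\<integral>\<^sup>+\<omega>. epow (ennreal (\<Lambda> i \<theta>\<^sub>1 \<omega>)) (q - 1) * ennreal (\<Lambda> i \<theta>\<^sub>2 \<omega>) \<partial>M)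
               \<le> ennreal (\<rho> (b ^ i * ang_dist \<theta>\<^sub>1 \<theta>\<^sub>2))) \<and>
          summable (\<lambda>i. ln (\<rho> (1 / b ^ i) / enn2real (moment M (\<Lambda> i pole) q)))"
    and large_q: "\<forall>q\<in>{1..p}. \<exists>\<theta>'\<in>sphere 0 1. \<exists>k\<ge>2. \<exists>\<upsilon> :: real \<Rightarrow> real.
          antimono_on {0..} \<upsilon> \<and> (\<forall>t\<ge>0. 0 < \<upsilon> t) \<and>
          (\<forall>i. \<forall>x\<in>{0..pi}. \<forall>\<theta> :: nat \<Rightarrow> real ^ 'n. (\<forall>j<k. \<theta> j \<in> cap x \<theta>') \<longrightarrow>
             ennreal (\<upsilon> (b ^ i * x))
               \<le> (\<integral>\<^sup>+\<omega>. (\<Prod>j<k. epow (ennreal (\<Lambda> i (\<theta> j) \<omega>)) (q / real k)) \<partial>M)) \<and>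
          summable (\<lambda>i. ln (enn2real (moment M (\<Lambda> i \<theta>') q) / \<upsilon> (1 / b ^ i)))"
  shows "\<forall>q\<in>{0..p}. renyi_function M \<mu> N \<Delta> q =
           ereal (q - 1 - 1 / real d * log b (enn2real (moment M (\<Lambda> 0 pole) q)))"
proof
  fix q assume "q \<in> {0..p}"
  then have q: "0 \<le> q" "q \<le> p" by auto
  interpret prob_space M by (rule prob)
  have b: "1 < b" and p: "2 \<le> p"
    and joint: "\<And>i. (\<lambda>(\<theta>, \<omega>). \<Lambda> i \<theta> \<omega>) \<in> borel_measurable (sphere_borel \<Otimes>\<^sub>M M)"
    and nonneg: "\<And>i. AE \<omega> in M. \<forall>\<theta>\<in>sphere 0 1. 0 \<le> \<Lambda> i \<theta> \<omega>"
    and integral: "\<And>i \<theta>. \<theta> \<in> sphere 0 1 \<Longrightarrow> integrable M (\<Lambda> i \<theta>)"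
      "\<And>i \<theta>. \<theta> \<in> sphere 0 1 \<Longrightarrow> integral\<^sup>L M (\<Lambda> i \<theta>) = 1"
    using conv unfolding convergence_hypotheses_def by blast+
  obtain k ps \<rho> where k: "2 \<le> k" and ps: "\<And>j. j < k \<Longrightarrow> 1 \<le> ps j" "(\<Sum>j<k. ps j) = p"
    and \<rho>: "antimono_on {0..} \<rho>" "\<And>t. 0 \<le> t \<Longrightarrow> 0 < \<rho> t"
    and k_point: "\<And>i \<theta>. (\<And>j. j < k \<Longrightarrow> \<theta> j \<in> sphere 0 1) \<Longrightarrow>
           (\<integral>\<^sup>+\<omega>. (\<Prod>j<k. epow (ennreal (\<Lambda> i (\<theta> j) \<omega>)) (ps j)) \<partial>M)
             \<le> ennreal (\<rho> (b ^ i * min_ang_dist k \<theta>))"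
    and \<rho>_0: "\<rho> 0 powr (1 / real d) < b" and \<rho>_sum: "summable (\<lambda>i. ln (\<rho> (b ^ i)))"
    using conv unfolding convergence_hypotheses_def by blast
  have "\<rho> 0 = (\<rho> 0 powr (1 / real d)) powr real d"
    using \<rho>(2)[of 0] dim by (simp add: powr_powr)
  also have "\<dots> < b powr real d"
    using \<rho>_0 dim by (intro powr_less_mono2) auto
  finally have \<rho>_0: "\<rho> 0 < b ^ d" using b by (simp add: powr_realpow)
  interpret convergent_cascade M \<Lambda> d p b k ps \<rho>
    by unfold_locales (fact indep joint b k ps \<rho> k_point \<rho>_0 \<rho>_sum)+
  have poleS: "pole \<in> sphere 0 1" using pole by simp
  have mean: "moment M (\<Lambda> i \<theta>) 1 = 1" if \<theta>: "\<theta> \<in> sphere 0 1" for i \<theta>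
  proof -
    have "AE \<omega> in M. 0 \<le> \<Lambda> i \<theta> \<omega>" using nonneg[of i] by eventually_elim (use \<theta> in auto)
    then show ?thesis
      using nn_integral_eq_integral[OF integral(1)[OF \<theta>]] integral(2)[OF \<theta>] by (simp add: moment_def)
  qed
  define mq where "mq = enn2real (moment M (\<Lambda> 0 pole) q)"
  note measurable_\<Lambda>_section[OF poleS, measurable]
  have "moment M (\<Lambda> 0 pole) q \<noteq> \<infinity>"
  proof -
    have ang: "min_ang_dist k (\<lambda>_. pole) = 0"
      using min_ang_dist_attained[OF k, of "\<lambda>_. pole"] poleS by (auto simp: ang_dist_self)
    have "(\<Prod>j<k. epow x (ps j)) = epow x p" for x
      using ps by (subst epow_sum_right) (force simp: ps(2))+
    then have "(\<integral>\<^sup>+\<omega>. epow (ennreal (\<Lambda> 0 pole \<omega>)) p \<partial>M) \<le> ennreal (\<rho> 0)"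
      using k_point[of "\<lambda>_. pole" 0] poleS by (simp add: ang)
    then have "(\<integral>\<^sup>+\<omega>. epow (ennreal (\<Lambda> 0 pole \<omega>)) p \<partial>M) \<noteq> top"
      by (auto simp: top_unique)
    moreover have "\<not> q / p < 0"
      using p q by (intro leD divide_nonneg_nonneg) auto
    ultimately have "epow (\<integral>\<^sup>+\<omega>. epow (ennreal (\<Lambda> 0 pole \<omega>)) p \<partial>M) (q / p) \<noteq> \<infinity>"
      unfolding infinity_ennreal_def epow_eq_top_iff by blast
    moreover have "moment M (\<Lambda> 0 pole) q \<le> epow (\<integral>\<^sup>+\<omega>. epow (ennreal (\<Lambda> 0 pole \<omega>)) p \<partial>M) (q / p)"
      unfolding moment_def using p q by (intro nn_integral_epow_Lyapunov) auto
    ultimately show ?thesis by (auto simp: top_unique)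
  qed
  moreover have "moment M (\<Lambda> 0 pole) q \<noteq> 0"
  proof
    assume "moment M (\<Lambda> 0 pole) q = 0"
    then have "AE \<omega> in M. epow (ennreal (\<Lambda> 0 pole \<omega>)) q = 0"
      by (simp add: moment_def nn_integral_0_iff_AE)
    then have "AE \<omega> in M. ennreal (\<Lambda> 0 pole \<omega>) = 0"
      by eventually_elim (use q in \<open>auto simp: epow_eq_0_iff\<close>)
    then have "moment M (\<Lambda> 0 pole) 1 = 0"
      by (simp add: moment_def nn_integral_0_iff_AE)
    then show False using mean[OF poleS, of 0] by simp
  qed
  ultimately have mq_pos: "0 < mq" and mq0: "moment M (\<Lambda> 0 pole) q = ennreal mq"
    by (auto simp: mq_def enn2real_positive_iff less_top ennreal_enn2real zero_less_iff_neq_zero)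
  have mq: "moment M (\<Lambda> i \<theta>) q = ennreal mq" if "\<theta> \<in> sphere 0 1" for i \<theta>
    using moments that \<open>q \<in> {0..p}\<close> mq0 by metis
  have DIM: "DIM(real ^ 'n) = Suc d" using dim by simp
  obtain D where D: "0 < D"
    and upper: "\<And>n y \<theta>. 0 < q \<Longrightarrow> q < 1 \<Longrightarrow> y \<in> sphere 0 1 \<Longrightarrow> \<theta> \<in> cap (1 / b ^ n) y \<Longrightarrow>
       (\<Prod>i<n. correlation M (\<Lambda> i) (q - 1) y \<theta>) \<le> ennreal (D * mq ^ n)"
    and lower: "\<And>n y \<theta>. 1 \<le> q \<Longrightarrow> y \<in> sphere 0 1 \<Longrightarrow> \<theta> \<in> cap (1 / b ^ n) y \<Longrightarrow>
       ennreal (D * mq ^ n) \<le> (\<Prod>i<n. correlation M (\<Lambda> i) (q - 1) y \<theta>)"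
  proof -
    consider "q = 0" | "0 < q" "q < 1" | "1 \<le> q" using q by linarith
    then show thesis
    proof cases
      case 1
      then show thesis by (intro that[of 1]) auto
    next
      case 2
      then obtain \<rho>' where \<rho>': "mono_on {0..} \<rho>'"
        "\<And>i y \<theta>. y \<in> sphere 0 1 \<Longrightarrow> \<theta> \<in> sphere 0 1 \<Longrightarrow>
           correlation M (\<Lambda> i) (q - 1) y \<theta> \<le> ennreal (\<rho>' (b ^ i * ang_dist y \<theta>))"
        "summable (\<lambda>i. ln (\<rho>' (1 / b ^ i) / enn2real (moment M (\<Lambda> i pole) q)))"
        using bspec[OF small_q, of q] unfolding greaterThanLessThan_iff correlation_def by blast
      have summ: "summable (\<lambda>i. ln (\<rho>' (1 / b ^ i) / mq))"
        using \<rho>'(3) mq_pos by (simp add: mq[OF poleS])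
      show thesis
      proof (rule correlation_product_le[where M=M and \<Lambda>=\<Lambda> and \<rho>=\<rho>' and b=b and mq=mq and q=q])
        fix D
        assume "0 < D" and "\<And>n y \<theta>. y \<in> sphere 0 1 \<Longrightarrow> \<theta> \<in> cap (1 / b ^ n) y \<Longrightarrow>
          (\<Prod>i<n. correlation M (\<Lambda> i) (q - 1) y \<theta>) \<le> ennreal (D * mq ^ n)"
        then show thesis using 2(2) by (intro that[of D]) (blast | simp)+
      qed (fact b mq_pos mq 2 \<rho>'(1,2) summ)+
    next
      case 3
      then have "q \<in> {1..p}" using q by simp
      from bspec[OF large_q this] obtain \<theta>' k' \<upsilon> where \<theta>': "\<theta>' \<in> sphere 0 1" and k': "2 \<le> k'"
        and *: "antimono_on {0..} \<upsilon> \<and> (\<forall>t\<ge>0. 0 < \<upsilon> t) \<and>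
          (\<forall>i. \<forall>x\<in>{0..pi}. \<forall>\<theta> :: nat \<Rightarrow> real ^ 'n. (\<forall>j<k'. \<theta> j \<in> cap x \<theta>') \<longrightarrow>
             ennreal (\<upsilon> (b ^ i * x))
               \<le> (\<integral>\<^sup>+\<omega>. (\<Prod>j<k'. epow (ennreal (\<Lambda> i (\<theta> j) \<omega>)) (q / real k')) \<partial>M)) \<and>
          summable (\<lambda>i. ln (enn2real (moment M (\<Lambda> i \<theta>') q) / \<upsilon> (1 / b ^ i)))"
        by (elim bexE exE conjE) simp
      have \<upsilon>: "antimono_on {0..} \<upsilon>" "\<And>t. 0 \<le> t \<Longrightarrow> 0 < \<upsilon> t"
        "\<And>i x \<theta>. 0 \<le> x \<Longrightarrow> x \<le> pi \<Longrightarrow> (\<And>j. j < k' \<Longrightarrow> \<theta> j \<in> cap x \<theta>') \<Longrightarrow>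
           ennreal (\<upsilon> (b ^ i * x)) \<le> (\<integral>\<^sup>+\<omega>. (\<Prod>j<k'. epow (ennreal (\<Lambda> i (\<theta> j) \<omega>)) (q / real k')) \<partial>M)"
        using * by simp_all
      have summ: "summable (\<lambda>i. ln (mq / \<upsilon> (1 / b ^ i)))"
        using * mq_pos by (simp add: mq[OF \<theta>'])
      have card: "2 \<le> CARD('n)" using dim by simp
      show thesis
      proof (rule correlation_product_ge[where M=M and \<Lambda>=\<Lambda> and \<upsilon>=\<upsilon> and b=b and mq=mq and q=q and \<theta>'=\<theta>' and k=k'])
        fix D
        assume "0 < D" and "\<And>n y \<theta>. y \<in> sphere 0 1 \<Longrightarrow> \<theta> \<in> cap (1 / b ^ n) y \<Longrightarrow>
          ennreal (D * mq ^ n) \<le> (\<Prod>i<n. correlation M (\<Lambda> i) (q - 1) y \<theta>)"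
        then show thesis using 3 by (intro that[of D]) (blast | simp)+
      qed (fact card b mq_pos mq 3 spec[OF isotropic] measurable_\<Lambda>_section \<theta>' k' \<upsilon> summ)+
    qed
  qed
  have "renyi_function M \<mu> N \<Delta> q = ereal (q - 1 - 1 / real d * log b mq)"
    using cell_moment_law[OF DIM p mean nonneg limit q mq_pos mq D upper lower]
    by (rule renyi_function_of_cell_moments[OF DIM dim(2) mesh b mq_pos q(1)])
  then show "renyi_function M \<mu> N \<Delta> q =
      ereal (q - 1 - 1 / real d * log b (enn2real (moment M (\<Lambda> 0 pole) q)))"
    by (simp add: mq_def)
qed

end
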